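(* Let $(\mathcal{A},H,\mathcal{D})$ be a unital von Neumann spectral triple relative to $(N,J)$ such that the norm closure $A=\overline{\mathcal{A}}$ is separable, and let $F_{\mathcal{D}}=\mathcal{D}(1+\mathcal{D}^2)^{-1/2}$. Let $\mathcal{B}$ be the smallest $C^*$-algebra in $\mathcal{L}(H)$ containing the elements $$F_{\mathcal{D}}[F_{\mathcal{D}},a],\qquad b[F_{\mathcal{D}},a],\qquad F_{\mathcal{D}}b[F_{\mathcal{D}},a],\qquad a\varphi(\mathcal{D})$$ for all $a,b\in\mathcal{A}$ and $\varphi\in C_0(\mathbb{R})$. Then $\mathcal{B}$ is separable, $\mathcal{B}$ is contained in $J$, and the pair $(\mathcal{M}_A,F_{\mathcal{D}})$ is a Kasparov $A$-$\mathcal{B}$-module, where $\mathcal{M}_A:A\to\mathcal{L}(\mathcal{B})$ is left multiplication. In particular $\mathcal{B}$ is $\sigma$-unital.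
   Context: Von Neumann spectral triple: let $N$ be a von Neumann algebra acting on a Hilbert space $H$ and $J\subseteq N$ a norm closed ideal. A von Neumann spectral triple $(\mathcal{A},H,\mathcal{D})$ relative to $(N,J)$ consists of a $*$-algebra $\mathcal{A}$ represented in $N$ and a self-adjoint operator $\mathcal{D}$ affiliated to $N$ such that (1) for all $a\in\mathcal{A}$, $[\mathcal{D},a]$ is defined on $\mathrm{Dom}(\mathcal{D})$ and extends to a bounded operator on $H$; (2) $a(\lambda-\mathcal{D})^{-1}\in J$ for all $\lambda\notin\mathbb{R}$, $a\in\mathcal{A}$. It is unital if the unit of $N$ is in $\mathcal{A}$. A $C^*$-algebra $\mathcal{B}$ is a right Hilbert $\mathcal{B}$-module with $\langle x,y\rangle=x^*y$, with compact operators $\mathcal{K}(\mathcal{B})=\mathcal{B}$ and adjointable operators $\mathcal{L}(\mathcal{B})$. That $(\mathcal{M}_A,F_{\mathcal{D}})$ is a Kasparov $A$-$\mathcal{B}$-module means: $\mathcal{B}$ is $\sigma$-unital, $A$ and $F_{\mathcal{D}}$ act on $\mathcal{B}$ by left multiplication ($A\mathcal{B}\subseteq\mathcal{B}$, $F_{\mathcal{D}}\mathcal{B}\subseteq\mathcal{B}$), and the operators $a(F_{\mathcal{D}}^2-1)$, $a(F_{\mathcal{D}}-F_{\mathcal{D}}^* )$, $[F_{\mathcal{D}},a]$ lie in $\mathcal{B}$ for all $a\in A$. *)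

theory Defs
  imports "HOL-Analysis.Analysis"
begin

section \<open>Complex Hilbert spaces and their bounded operators\<close>

text \<open>The inner product is conjugate linear in the first argument. The real scalar multiplication,
  the norm and the completeness come from \<^class>\<open>banach\<close>.\<close>

class complex_hilbert_space = banach +
  fixes scaleC :: "complex \<Rightarrow> 'a \<Rightarrow> 'a"  (infixr "*\<^sub>C" 75)
    and cinner :: "'a \<Rightarrow> 'a \<Rightarrow> complex"
  assumes scaleC_add_right: "c *\<^sub>C (x + y) = c *\<^sub>C x + c *\<^sub>C y"
    and scaleC_add_left: "(c + d) *\<^sub>C x = c *\<^sub>C x + d *\<^sub>C x"
    and scaleC_scaleC: "c *\<^sub>C d *\<^sub>C x = (c * d) *\<^sub>C x"
    and scaleR_eq_scaleC: "r *\<^sub>R x = complex_of_real r *\<^sub>C x"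
    and cinner_commute: "cinner x y = cnj (cinner y x)"
    and cinner_add_left: "cinner (x + y) z = cinner x z + cinner y z"
    and cinner_scaleC_left: "cinner (c *\<^sub>C x) y = cnj c * cinner x y"
    and cinner_self_nonneg: "0 \<le> Re (cinner x x)"
    and norm_eq_sqrt_cinner: "norm x = sqrt (Re (cinner x x))"

text \<open>The type \<^typ>\<open>'h \<Rightarrow>\<^sub>L 'h\<close> consists of the bounded \<^emph>\<open>real\<close>-linear operators;
  \<open>bounded_ops\<close> is $\mathcal{L}(H)$.\<close>

definition bounded_ops :: "('h::complex_hilbert_space \<Rightarrow>\<^sub>L 'h) set" where
  "bounded_ops = {T. \<forall>c x. blinfun_apply T (c *\<^sub>C x) = c *\<^sub>C blinfun_apply T x}"

definition scale_op :: "complex \<Rightarrow> ('h::complex_hilbert_space \<Rightarrow>\<^sub>L 'h) \<Rightarrow> ('h \<Rightarrow>\<^sub>L 'h)" where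
  "scale_op c T = Blinfun (\<lambda>x. c *\<^sub>C blinfun_apply T x)"

definition adj :: "('h::complex_hilbert_space \<Rightarrow>\<^sub>L 'h) \<Rightarrow> ('h \<Rightarrow>\<^sub>L 'h)" where
  "adj T = (THE S. \<forall>x y. cinner (blinfun_apply T x) y = cinner x (blinfun_apply S y))"

definition commutator :: "('h::complex_hilbert_space \<Rightarrow>\<^sub>L 'h) \<Rightarrow> ('h \<Rightarrow>\<^sub>L 'h) \<Rightarrow> ('h \<Rightarrow>\<^sub>L 'h)" where
  "commutator S T = (S o\<^sub>L T) - (T o\<^sub>L S)"

definition unitary_op :: "('h::complex_hilbert_space \<Rightarrow>\<^sub>L 'h) \<Rightarrow> bool" where
  "unitary_op u \<longleftrightarrow> u \<in> bounded_ops \<and> adj u o\<^sub>L u = id_blinfun \<and> u o\<^sub>L adj u = id_blinfun"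

definition positive_op :: "('h::complex_hilbert_space \<Rightarrow>\<^sub>L 'h) \<Rightarrow> bool" where
  "positive_op T \<longleftrightarrow> T \<in> bounded_ops \<and>
     (\<forall>x. cinner x (blinfun_apply T x) \<in> \<real> \<and> 0 \<le> Re (cinner x (blinfun_apply T x)))"


section \<open>Operator algebras\<close>

definition op_subspace :: "('h::complex_hilbert_space \<Rightarrow>\<^sub>L 'h) set \<Rightarrow> bool" where
  "op_subspace V \<longleftrightarrow> V \<subseteq> bounded_ops \<and> 0 \<in> V \<and>
     (\<forall>S\<in>V. \<forall>T\<in>V. S + T \<in> V) \<and> (\<forall>c. \<forall>T\<in>V. scale_op c T \<in> V)"

definition star_algebra :: "('h::complex_hilbert_space \<Rightarrow>\<^sub>L 'h) set \<Rightarrow> bool" where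
  "star_algebra V \<longleftrightarrow> op_subspace V \<and> (\<forall>S\<in>V. \<forall>T\<in>V. S o\<^sub>L T \<in> V) \<and> (\<forall>T\<in>V. adj T \<in> V)"

definition cstar_algebra :: "('h::complex_hilbert_space \<Rightarrow>\<^sub>L 'h) set \<Rightarrow> bool" where
  "cstar_algebra V \<longleftrightarrow> star_algebra V \<and> closed V"

definition commutant :: "('h::complex_hilbert_space \<Rightarrow>\<^sub>L 'h) set \<Rightarrow> ('h \<Rightarrow>\<^sub>L 'h) set" where
  "commutant V = {T \<in> bounded_ops. \<forall>S\<in>V. T o\<^sub>L S = S o\<^sub>L T}"

definition von_neumann_algebra :: "('h::complex_hilbert_space \<Rightarrow>\<^sub>L 'h) set \<Rightarrow> bool" where
  "von_neumann_algebra N \<longleftrightarrow> star_algebra N \<and> commutant (commutant N) = N"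

definition closed_ideal :: "('h::complex_hilbert_space \<Rightarrow>\<^sub>L 'h) set \<Rightarrow> ('h \<Rightarrow>\<^sub>L 'h) set \<Rightarrow> bool" where
  "closed_ideal J N \<longleftrightarrow> J \<subseteq> N \<and> op_subspace J \<and>
     (\<forall>S\<in>J. \<forall>T\<in>N. S o\<^sub>L T \<in> J \<and> T o\<^sub>L S \<in> J) \<and> closed J"

definition sigma_unital :: "('h::complex_hilbert_space \<Rightarrow>\<^sub>L 'h) set \<Rightarrow> bool" where
  "sigma_unital B \<longleftrightarrow> (\<exists>e :: nat \<Rightarrow> 'h \<Rightarrow>\<^sub>L 'h.
     (\<forall>n. e n \<in> B \<and> positive_op (e n) \<and> norm (e n) \<le> 1) \<and>
     (\<forall>b\<in>B. (\<lambda>n. e n o\<^sub>L b) \<longlonglongrightarrow> b \<and> (\<lambda>n. b o\<^sub>L e n) \<longlonglongrightarrow> b))"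


section \<open>Unbounded operators\<close>

text \<open>An unbounded operator is a partial function; its domain is \<^term>\<open>dom T\<close> and its value at a
  point \<open>x\<close> of the domain is \<^term>\<open>the (T x)\<close>.\<close>

type_synonym 'h unbounded_op = "'h \<Rightarrow> 'h option"

definition densely_defined_linear :: "'h::complex_hilbert_space unbounded_op \<Rightarrow> bool" where
  "densely_defined_linear T \<longleftrightarrow> closure (dom T) = UNIV \<and> 0 \<in> dom T \<and>
     (\<forall>x\<in>dom T. \<forall>y\<in>dom T. x + y \<in> dom T \<and> the (T (x + y)) = the (T x) + the (T y)) \<and>
     (\<forall>c. \<forall>x\<in>dom T. c *\<^sub>C x \<in> dom T \<and> the (T (c *\<^sub>C x)) = c *\<^sub>C the (T x))"

definition unbounded_adj :: "'h::complex_hilbert_space unbounded_op \<Rightarrow> 'h unbounded_op" where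
  "unbounded_adj T = (\<lambda>y.
     if \<exists>z. \<forall>x\<in>dom T. cinner (the (T x)) y = cinner x z
     then Some (THE z. \<forall>x\<in>dom T. cinner (the (T x)) y = cinner x z)
     else None)"

definition self_adjoint :: "'h::complex_hilbert_space unbounded_op \<Rightarrow> bool" where
  "self_adjoint T \<longleftrightarrow> densely_defined_linear T \<and> unbounded_adj T = T"

text \<open>Affiliation: $u T u^* = T$ for every unitary $u$ in the commutant of $N$.\<close>

definition affiliated ::
    "'h::complex_hilbert_space unbounded_op \<Rightarrow> ('h \<Rightarrow>\<^sub>L 'h) set \<Rightarrow> bool" where
  "affiliated T N \<longleftrightarrow> (\<forall>u\<in>commutant N. unitary_op u \<longrightarrow>
     blinfun_apply u ` dom T = dom T \<and>
     (\<forall>x\<in>dom T. the (T (blinfun_apply u x)) = blinfun_apply u (the (T x))))"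

text \<open>The resolvent $(\lambda - T)^{-1}$.\<close>

definition resolvent :: "'h::complex_hilbert_space unbounded_op \<Rightarrow> complex \<Rightarrow> ('h \<Rightarrow>\<^sub>L 'h)" where
  "resolvent T l = (THE R. R \<in> bounded_ops \<and>
     (\<forall>x. blinfun_apply R x \<in> dom T \<and>
          l *\<^sub>C blinfun_apply R x - the (T (blinfun_apply R x)) = x) \<and>
     (\<forall>x\<in>dom T. blinfun_apply R (l *\<^sub>C x - the (T x)) = x))"


section \<open>Functional calculus\<close>

definition C0 :: "(real \<Rightarrow> complex) set" where
  "C0 = {f. continuous_on UNIV f \<and> (f \<longlongrightarrow> 0) at_infinity}"

text \<open>The functional calculus of a self-adjoint operator $T$ is the unique $*$-homomorphism
  $C_0(\mathbb{R}) \to \mathcal{L}(H)$ that maps $x \mapsto (\lambda - x)^{-1}$ to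
  $(\lambda - T)^{-1}$ for all non-real $\lambda$; as every $*$-homomorphism between
  $C^*$-algebras it is automatically contractive.\<close>

definition is_C0_calculus ::
    "'h::complex_hilbert_space unbounded_op \<Rightarrow> ((real \<Rightarrow> complex) \<Rightarrow> ('h \<Rightarrow>\<^sub>L 'h)) \<Rightarrow> bool" where
  "is_C0_calculus T \<Phi> \<longleftrightarrow>
     (\<forall>f\<in>C0. \<Phi> f \<in> bounded_ops) \<and>
     (\<forall>f\<in>C0. \<forall>g\<in>C0. \<Phi> (\<lambda>x. f x + g x) = \<Phi> f + \<Phi> g) \<and>
     (\<forall>c. \<forall>f\<in>C0. \<Phi> (\<lambda>x. c * f x) = scale_op c (\<Phi> f)) \<and>
     (\<forall>f\<in>C0. \<forall>g\<in>C0. \<Phi> (\<lambda>x. f x * g x) = \<Phi> f o\<^sub>L \<Phi> g) \<and>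
     (\<forall>f\<in>C0. \<Phi> (\<lambda>x. cnj (f x)) = adj (\<Phi> f)) \<and>
     (\<forall>l. l \<notin> \<real> \<longrightarrow> \<Phi> (\<lambda>x. inverse (l - complex_of_real x)) = resolvent T l)"

definition fun_calc ::
    "'h::complex_hilbert_space unbounded_op \<Rightarrow> (real \<Rightarrow> complex) \<Rightarrow> ('h \<Rightarrow>\<^sub>L 'h)" where
  "fun_calc T f = (THE S. \<exists>\<Phi>. is_C0_calculus T \<Phi> \<and> S = \<Phi> f)"

text \<open>$F_T = T (1 + T^2)^{-1/2}$. Here $(1 + T^2)^{-1/2}$ is given by the functional calculus, since
  $(1 + x^2)^{-1/2}$ vanishes at infinity; it maps $H$ into the domain of $T$.\<close>

definition bounded_transform :: "'h::complex_hilbert_space unbounded_op \<Rightarrow> ('h \<Rightarrow>\<^sub>L 'h)" where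
  "bounded_transform T = Blinfun (\<lambda>x.
     the (T (blinfun_apply (fun_calc T (\<lambda>t. complex_of_real (1 / sqrt (1 + t\<^sup>2)))) x)))"


section \<open>Von Neumann spectral triples\<close>

definition vn_spectral_triple ::
    "('h::complex_hilbert_space \<Rightarrow>\<^sub>L 'h) set \<Rightarrow> ('h \<Rightarrow>\<^sub>L 'h) set \<Rightarrow>
     ('h \<Rightarrow>\<^sub>L 'h) set \<Rightarrow> 'h unbounded_op \<Rightarrow> bool" where
  "vn_spectral_triple N J \<A> D \<longleftrightarrow>
     von_neumann_algebra N \<and> closed_ideal J N \<and>
     star_algebra \<A> \<and> \<A> \<subseteq> N \<and>
     self_adjoint D \<and> affiliated D N \<and>
     (\<forall>a\<in>\<A>. blinfun_apply a ` dom D \<subseteq> dom D \<and>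
        (\<exists>T\<in>bounded_ops. \<forall>x\<in>dom D.
           blinfun_apply T x = the (D (blinfun_apply a x)) - blinfun_apply a (the (D x)))) \<and>
     (\<forall>a\<in>\<A>. \<forall>l. l \<notin> \<real> \<longrightarrow> a o\<^sub>L resolvent D l \<in> J)"

definition unital_vn_spectral_triple ::
    "('h::complex_hilbert_space \<Rightarrow>\<^sub>L 'h) set \<Rightarrow> ('h \<Rightarrow>\<^sub>L 'h) set \<Rightarrow>
     ('h \<Rightarrow>\<^sub>L 'h) set \<Rightarrow> 'h unbounded_op \<Rightarrow> bool" where
  "unital_vn_spectral_triple N J \<A> D \<longleftrightarrow> vn_spectral_triple N J \<A> D \<and> id_blinfun \<in> \<A>"

definition triple_algebra ::
    "('h::complex_hilbert_space \<Rightarrow>\<^sub>L 'h) set \<Rightarrow> 'h unbounded_op \<Rightarrow> ('h \<Rightarrow>\<^sub>L 'h) set" where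
  "triple_algebra \<A> D = (let F = bounded_transform D in
     cstar_algebra hull
       ({F o\<^sub>L commutator F a |a. a \<in> \<A>} \<union>
        {b o\<^sub>L commutator F a |a b. a \<in> \<A> \<and> b \<in> \<A>} \<union>
        {F o\<^sub>L b o\<^sub>L commutator F a |a b. a \<in> \<A> \<and> b \<in> \<A>} \<union>
        {a o\<^sub>L fun_calc D f |a f. a \<in> \<A> \<and> f \<in> C0}))"


section \<open>Kasparov modules with underlying Hilbert module a C*-algebra\<close>

text \<open>A $C^*$-algebra $B$ is a right Hilbert $B$-module with $\langle x, y\rangle = x^* y$.\<close>

definition module_inner ::
    "('h::complex_hilbert_space \<Rightarrow>\<^sub>L 'h) \<Rightarrow> ('h \<Rightarrow>\<^sub>L 'h) \<Rightarrow> ('h \<Rightarrow>\<^sub>L 'h)" where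
  "module_inner x y = adj x o\<^sub>L y"

definition adjointable_ops ::
    "('h::complex_hilbert_space \<Rightarrow>\<^sub>L 'h) set \<Rightarrow> (('h \<Rightarrow>\<^sub>L 'h) \<Rightarrow> ('h \<Rightarrow>\<^sub>L 'h)) set" where
  "adjointable_ops B = {t. t ` B \<subseteq> B \<and>
     (\<exists>s. s ` B \<subseteq> B \<and> (\<forall>x\<in>B. \<forall>y\<in>B. module_inner (t x) y = module_inner x (s y)))}"

definition left_mult ::
    "('h::complex_hilbert_space \<Rightarrow>\<^sub>L 'h) \<Rightarrow> ('h \<Rightarrow>\<^sub>L 'h) \<Rightarrow> ('h \<Rightarrow>\<^sub>L 'h)" where
  "left_mult T = (\<lambda>x. T o\<^sub>L x)"

text \<open>The compact operators on the Hilbert module $B$ are the left multiplications by elements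
  of $B$, so compactness of $a(F^2-1)$, $a(F-F^*)$ and $[F,a]$ is membership in $B$.\<close>

definition kasparov_left_mult_module ::
    "('h::complex_hilbert_space \<Rightarrow>\<^sub>L 'h) set \<Rightarrow> ('h \<Rightarrow>\<^sub>L 'h) set \<Rightarrow> ('h \<Rightarrow>\<^sub>L 'h) \<Rightarrow> bool" where
  "kasparov_left_mult_module A B F \<longleftrightarrow>
     cstar_algebra A \<and> cstar_algebra B \<and> sigma_unital B \<and> F \<in> bounded_ops \<and>
     (\<forall>a\<in>A. left_mult a \<in> adjointable_ops B) \<and>
     left_mult F \<in> adjointable_ops B \<and>
     (\<forall>a\<in>A. a o\<^sub>L ((F o\<^sub>L F) - id_blinfun) \<in> B \<and>
            a o\<^sub>L (F - adj F) \<in> B \<and>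
            commutator F a \<in> B)"

end

theory Submission
  imports Defs "HOL-Computational_Algebra.Fundamental_Theorem_Algebra" "HOL-Real_Asymp.Real_Asymp"
begin

text \<open>
  Since the triple is unital, the resolvents, and hence all \<open>\<phi>(D)\<close> with \<open>\<phi> \<in> C\<^sub>0(\<real>)\<close>, lie in
  \<open>J\<close>, and \<open>F\<close>, a strong limit of such operators, lies in \<open>N'' = N\<close>.
  The function \<open>x / sqrt (1 + x\<^sup>2) - (2/\<pi>) arctan (t x)\<close> is in \<open>C\<^sub>0(\<real>)\<close> for \<open>t > 0\<close>, and its
  \<open>t\<close>-derivative \<open>- (2/\<pi>) x / (1 + t\<^sup>2 x\<^sup>2)\<close> is a combination of the resolvents at
  \<open>\<plusminus> \<i>/t\<close>. From \<open>[R, a] = R [D, a] R\<close> the commutator of this derivative with \<open>a\<close> is bounded by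
  \<open>\<parallel>[D, a]\<parallel>\<close> uniformly in \<open>t\<close>, so \<open>[F, a]\<close> is a norm limit of commutators \<open>[\<phi>(D), a]\<close> with
  \<open>\<phi> \<in> C\<^sub>0(\<real>)\<close>. The same bound shows that \<open>e\<^sub>n = n\<^sup>2 (n\<^sup>2 + D\<^sup>2)\<^sup>-\<^sup>1\<close> asymptotically commutes with
  \<open>\<A>\<close>, so \<open>(e\<^sub>n)\<close> is an approximate unit of \<open>B\<close>; a bounded operator \<open>S\<close> with all \<open>S e\<^sub>n \<in> B\<close>
  therefore multiplies \<open>B\<close> into itself, which applies to \<open>A\<close> and to \<open>F\<close>.

  The functional calculus is obtained from the Cayley transform \<open>U\<close>: the estimate
  \<open>\<parallel>p(U)\<parallel> \<le> max |p|\<close> for trigonometric polynomials follows from the fundamental theorem of algebra,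
  and Stone--Weierstrass extends the calculus to all continuous functions on the circle.
\<close>

section \<open>Hilbert space geometry\<close>

text \<open>The obstacle is that \<open>x / sqrt (1 + x^2)\<close> tends to 1 and -1 at the two
  ends, so it lies outside \<open>C0\<close>, and a bound on \<open>[D, a]\<close> says nothing
  directly about \<open>[F, a]\<close>. Any correction with the same limits brings the function into
  \<open>C0\<close>. The arctangent is taken because its derivative in the scaling parameter is
  rational with two simple poles: two resolvents suffice, and an integral of operators over the
  parameter is replaced by the mean value inequality.

  Two features of the definitions shape the rest. \<open>closed_ideal\<close> is silent about
  adjoints while the generated algebra is closed under them, so containment is proved in the set of
  those elements of \<open>J\<close> whose adjoints lie in \<open>J\<close>.
  \<open>is_C0_calculus\<close> carries no norm bound, so contractivity is derived algebraically; it
  yields the uniqueness of the calculus on which the \<open>THE\<close> in \<open>fun_calc\<close>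
  rests.

  Separability has an argument of its own: the uncountably many generators lie in the closure of a
  countable set that is a C*-algebra.\<close>

interpretation cvec: vector_space "scaleC :: complex \<Rightarrow> 'a::complex_hilbert_space \<Rightarrow> 'a"
proof
  fix x :: 'a
  show "1 *\<^sub>C x = x"
    using scaleR_eq_scaleC[of 1 x] by simp
qed (simp_all add: scaleC_add_right scaleC_add_left scaleC_scaleC)

lemma cinner_add_right: "cinner x (y + z) = cinner x y + cinner x z"
  by (metis cinner_add_left cinner_commute complex_cnj_add)

lemma cinner_scaleC_right: "cinner x (c *\<^sub>C y) = c * cinner x y"
  by (metis cinner_commute cinner_scaleC_left complex_cnj_cnj complex_cnj_mult)

lemma cinner_zero_left [simp]: "cinner 0 x = 0"
  using cinner_scaleC_left[of 0 x x] by simp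

lemma cinner_zero_right [simp]: "cinner x 0 = 0"
  using cinner_scaleC_right[of x 0 x] by simp

lemma cinner_minus_left: "cinner (- x) y = - cinner x y"
  using cinner_scaleC_left[of "-1" x y] by simp

lemma cinner_minus_right: "cinner x (- y) = - cinner x y"
  using cinner_scaleC_right[of x "-1" y] by simp

lemma cinner_diff_left: "cinner (x - y) z = cinner x z - cinner y z"
  using cinner_add_left[of x "- y" z] by (simp add: cinner_minus_left)

lemma cinner_diff_right: "cinner x (y - z) = cinner x y - cinner x z"
  using cinner_add_right[of x y "- z"] by (simp add: cinner_minus_right)

lemma cinner_scaleR_left: "cinner (r *\<^sub>R x) y = of_real r * cinner x y"
  by (simp add: scaleR_eq_scaleC cinner_scaleC_left)

lemma cinner_scaleR_right: "cinner x (r *\<^sub>R y) = of_real r * cinner x y"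
  by (simp add: scaleR_eq_scaleC cinner_scaleC_right)

lemmas cinner_simps = cinner_add_left cinner_add_right cinner_diff_left cinner_diff_right
  cinner_minus_left cinner_minus_right cinner_scaleC_left cinner_scaleC_right
  cinner_scaleR_left cinner_scaleR_right

lemma power2_norm_eq_cinner: "(norm x)\<^sup>2 = Re (cinner x x)"
  by (simp add: norm_eq_sqrt_cinner cinner_self_nonneg)

lemma cinner_self: "cinner x x = complex_of_real ((norm x)\<^sup>2)"
  using cinner_commute[of x x] by (simp add: complex_eq_iff power2_norm_eq_cinner)

lemma norm_scaleC: "norm (c *\<^sub>C x) = cmod c * norm x"
proof -
  have "cinner (c *\<^sub>C x) (c *\<^sub>C x) = (c * cnj c) * cinner x x"
    by (simp add: cinner_simps)
  also have "\<dots> = of_real ((cmod c * norm x)\<^sup>2)"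
    unfolding cinner_self complex_norm_square[symmetric] by (simp add: power_mult_distrib)
  finally have "(norm (c *\<^sub>C x))\<^sup>2 = (cmod c * norm x)\<^sup>2"
    unfolding cinner_self of_real_eq_iff .
  then show ?thesis by simp
qed

lemma power2_norm_diff:
  fixes x y :: "'a::complex_hilbert_space"
  shows "(norm (x - y))\<^sup>2 = (norm x)\<^sup>2 + (norm y)\<^sup>2 - 2 * Re (cinner x y)"
proof -
  have "Re (cinner y x) = Re (cinner x y)"
    by (metis cinner_commute cnj.simps(1))
  then show ?thesis by (simp add: power2_norm_eq_cinner cinner_simps)
qed

text \<open>Subtracting from \<open>x\<close> its component along \<open>y\<close> is Pythagoras.
  The Cauchy-Schwarz inequality reads off that the result is nonnegative, the orthogonality of
  nearest points that it cannot drop below a minimal distance.\<close>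

lemma power2_norm_diff_orthogonal_part:
  fixes x y :: "'a::complex_hilbert_space"
  assumes "y \<noteq> 0"
  shows "(norm (x - (cinner y x / of_real ((norm y)\<^sup>2)) *\<^sub>C y))\<^sup>2
    = (norm x)\<^sup>2 - (cmod (cinner y x))\<^sup>2 / (norm y)\<^sup>2"
proof -
  define c where "c = cinner y x / of_real ((norm y)\<^sup>2)"
  have ny: "norm y > 0" using assms by simp
  have xy: "cinner x (c *\<^sub>C y) = of_real ((cmod (cinner y x))\<^sup>2 / (norm y)\<^sup>2)"
  proof -
    have "cinner x (c *\<^sub>C y) = cinner y x * cnj (cinner y x) / of_real ((norm y)\<^sup>2)"
      unfolding c_def cinner_scaleC_right using cinner_commute[of x y] by simp
    also have "\<dots> = of_real ((cmod (cinner y x))\<^sup>2) / of_real ((norm y)\<^sup>2)"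
      by (simp add: complex_norm_square del: of_real_power)
    finally show ?thesis by simp
  qed
  have "(norm (c *\<^sub>C y))\<^sup>2 = (cmod (cinner y x))\<^sup>2 / (norm y)\<^sup>2"
    using ny by (simp add: norm_scaleC c_def norm_divide norm_mult power2_eq_square)
  then show ?thesis
    unfolding c_def[symmetric] power2_norm_diff xy by simp
qed

lemma Cauchy_Schwarz: "cmod (cinner x y) \<le> norm x * norm y"
proof (cases "x = 0")
  case False
  have "0 \<le> (norm y)\<^sup>2 - (cmod (cinner x y))\<^sup>2 / (norm x)\<^sup>2"
    using power2_norm_diff_orthogonal_part[OF False, of y] by (metis zero_le_power2)
  then have "(cmod (cinner x y))\<^sup>2 \<le> (norm x * norm y)\<^sup>2"
    using False by (simp add: field_simps)
  then show ?thesis by (rule power2_le_imp_le) simp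
qed simp

lemma bounded_bilinear_cinner: "bounded_bilinear (cinner :: 'a::complex_hilbert_space \<Rightarrow> 'a \<Rightarrow> complex)"
  by standard (auto simp: cinner_simps scaleR_conv_of_real intro!: exI[of _ 1] Cauchy_Schwarz)

lemmas tendsto_cinner = bounded_bilinear.tendsto[OF bounded_bilinear_cinner]

lemma bounded_linear_scaleC: "bounded_linear (scaleC c :: 'a::complex_hilbert_space \<Rightarrow> 'a)"
  by (rule bounded_linear_intro[where K="cmod c"])
     (simp_all add: scaleC_add_right scaleR_eq_scaleC norm_scaleC mult.commute)

lemmas tendsto_scaleC = bounded_linear.tendsto[OF bounded_linear_scaleC]

lemma cinner_eqI: "(\<And>x. cinner x y = cinner x z) \<Longrightarrow> y = z"
  using cinner_self[of "y - z"] by (simp add: cinner_simps)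

lemma cinner_eqI_dense:
  fixes y z :: "'a::complex_hilbert_space"
  assumes "closure S = UNIV" and eq: "\<And>x. x \<in> S \<Longrightarrow> cinner x y = cinner x z"
  shows "y = z"
proof (rule cinner_eqI)
  fix x
  have "x \<in> closure S" using assms by simp
  then obtain s where s: "\<And>n. s n \<in> S" "s \<longlonglongrightarrow> x"
    by (auto simp: closure_sequential)
  have "(\<lambda>n. cinner (s n) y) \<longlonglongrightarrow> cinner x y" "(\<lambda>n. cinner (s n) z) \<longlonglongrightarrow> cinner x z"
    by (intro tendsto_cinner s tendsto_const)+
  then show "cinner x y = cinner x z"
    using eq s(1) LIMSEQ_unique by simp
qed

lemma parallelogram:
  fixes x y :: "'a::complex_hilbert_space"
  shows "(norm (x - y))\<^sup>2 + (norm (x + y))\<^sup>2 = 2 * (norm x)\<^sup>2 + 2 * (norm y)\<^sup>2"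
  by (simp add: power2_norm_eq_cinner cinner_simps)

section \<open>Nearest points, orthogonal projections and the Riesz representation\<close>

definition csubspace :: "'a::complex_hilbert_space set \<Rightarrow> bool" where
  "csubspace M \<longleftrightarrow> 0 \<in> M \<and> (\<forall>x\<in>M. \<forall>y\<in>M. x + y \<in> M) \<and> (\<forall>c. \<forall>x\<in>M. c *\<^sub>C x \<in> M)"

lemma bdd_below_image_dist: "bdd_below (dist x ` M)"
  by (rule bdd_belowI2[where m=0]) simp

text \<open>A minimising sequence is Cauchy by the parallelogram law: midpoints of its members stay
  in \<open>M\<close>, hence keep at least the distance \<open>d\<close> from
  \<open>x\<close>.\<close>

lemma nearest_point_exists:
  fixes x :: "'a::complex_hilbert_space"
  assumes M: "csubspace M" "closed M"
  shows "\<exists>m\<in>M. norm (x - m) = infdist x M"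
proof -
  define d where "d = infdist x M"
  have ne: "M \<noteq> {}" using M by (auto simp: csubspace_def)
  have d_le: "d \<le> norm (x - v)" if "v \<in> M" for v
    using infdist_le[OF that, of x] by (simp add: d_def dist_norm)
  have "d \<ge> 0" by (simp add: d_def infdist_nonneg)
  \<comment> \<open>The slack is put on the squared distance, so that the parallelogram law turns it
    directly into a bound for the squared norm of \<open>m i - m j\<close>.\<close>
  have "\<exists>v\<in>M. norm (x - v) < sqrt (d\<^sup>2 + inverse (Suc n))" for n
  proof -
    have "d < sqrt (d\<^sup>2 + inverse (Suc n))"
      by (rule real_less_rsqrt) simp
    then have "(INF v\<in>M. dist x v) < sqrt (d\<^sup>2 + inverse (Suc n))"
      unfolding d_def infdist_notempty[OF ne] .
    then have "\<exists>v\<in>M. dist x v < sqrt (d\<^sup>2 + inverse (Suc n))"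
      using cINF_less_iff[OF ne bdd_below_image_dist] by metis
    then show ?thesis
      unfolding dist_norm .
  qed
  then obtain m where m: "\<And>n. m n \<in> M" "\<And>n. norm (x - m n) < sqrt (d\<^sup>2 + inverse (Suc n))"
    by metis
  have m2: "(norm (x - m n))\<^sup>2 < d\<^sup>2 + inverse (Suc n)" for n
  proof -
    have "(norm (x - m n))\<^sup>2 < (sqrt (d\<^sup>2 + inverse (Suc n)))\<^sup>2"
      using m(2)[of n] by (intro power_strict_mono) auto
    also have "\<dots> = d\<^sup>2 + inverse (Suc n)"
      by (rule real_sqrt_pow2) (simp add: add_nonneg_nonneg)
    finally show ?thesis .
  qed
  have diff: "(norm (m i - m j))\<^sup>2 \<le> 2 * inverse (Suc i) + 2 * inverse (Suc j)" for i j
  proof -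
    have "(1/2) *\<^sub>R (m i + m j) \<in> M"
      using M(1) m(1) unfolding csubspace_def scaleR_eq_scaleC by blast
    then have "d \<le> norm (x - (1/2) *\<^sub>R (m i + m j))" by (rule d_le)
    also have "\<dots> = norm ((x - m i) + (x - m j)) / 2"
    proof -
      have "(x - m i) + (x - m j) = (x + x) - (m i + m j)" by simp
      then have "x - (1/2) *\<^sub>R (m i + m j) = (1/2) *\<^sub>R ((x - m i) + (x - m j))"
        by (simp only: scaleR_diff_right scaleR_half_double)
      then show ?thesis by simp
    qed
    finally have "2 * d \<le> norm ((x - m i) + (x - m j))" by simp
    then have "(2 * d)\<^sup>2 \<le> (norm ((x - m i) + (x - m j)))\<^sup>2"
      using \<open>d \<ge> 0\<close> by (intro power_mono) auto
    moreover have "(norm (m i - m j))\<^sup>2 = (norm ((x - m i) - (x - m j)))\<^sup>2"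
      by (simp add: norm_minus_commute)
    ultimately show ?thesis
      using parallelogram[of "x - m i" "x - m j"] m2[of i] m2[of j]
      by (simp add: power_mult_distrib)
  qed
  have "Cauchy m"
  proof (rule metric_CauchyI)
    fix e :: real assume "e > 0"
    then obtain k where k: "inverse (Suc k) < e\<^sup>2 / 4"
      using reals_Archimedean[of "e\<^sup>2 / 4"] by auto
    have "dist (m i) (m j) < e" if "i \<ge> k" "j \<ge> k" for i j
    proof -
      have "inverse (Suc i) \<le> inverse (Suc k)" "inverse (Suc j) \<le> inverse (Suc k)"
        using that by (auto simp: field_simps)
      then have "(norm (m i - m j))\<^sup>2 < e\<^sup>2"
        using diff[of i j] k by linarith
      then show ?thesis
        using \<open>e > 0\<close> by (simp add: dist_norm power2_less_imp_less)
    qed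
    then show "\<exists>K. \<forall>i\<ge>K. \<forall>j\<ge>K. dist (m i) (m j) < e" by blast
  qed
  then obtain l where l: "m \<longlonglongrightarrow> l"
    unfolding Cauchy_convergent_iff convergent_def by blast
  have lM: "l \<in> M"
    by (rule closed_sequentially[OF M(2) m(1) l])
  have "(\<lambda>n. (norm (x - m n))\<^sup>2) \<longlonglongrightarrow> (norm (x - l))\<^sup>2"
    by (intro tendsto_intros l)
  moreover have "(\<lambda>n. d\<^sup>2 + inverse (real (Suc n))) \<longlonglongrightarrow> d\<^sup>2 + 0"
    by (intro tendsto_intros LIMSEQ_inverse_real_of_nat)
  ultimately have "(norm (x - l))\<^sup>2 \<le> d\<^sup>2 + 0"
    by (rule LIMSEQ_le) (use m2 less_imp_le in blast)
  then have "norm (x - l) \<le> d"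
    using \<open>d \<ge> 0\<close> power2_le_imp_le[of "norm (x - l)" d] by simp
  with d_le[OF lM] lM show ?thesis
    unfolding d_def by (auto intro: bexI[of _ l])
qed

text \<open>At a nearest point \<open>m\<close>, moving by the component of \<open>x - m\<close>
  along \<open>v\<close> stays in \<open>M\<close> and would shorten the distance unless that
  component vanishes.\<close>

lemma orthogonal_projection_exists:
  fixes x :: "'a::complex_hilbert_space"
  assumes M: "csubspace M" "closed M"
  shows "\<exists>m\<in>M. \<forall>v\<in>M. cinner v (x - m) = 0"
proof -
  obtain m where m: "m \<in> M" "norm (x - m) = infdist x M"
    using nearest_point_exists[OF M] by blast
  have "cinner v (x - m) = 0" if v: "v \<in> M" for v
  proof (cases "v = 0")
    case False
    define c where "c = cinner v (x - m) / of_real ((norm v)\<^sup>2)"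
    have "m + c *\<^sub>C v \<in> M" using M(1) m v by (auto simp: csubspace_def)
    then have "infdist x M \<le> norm (x - (m + c *\<^sub>C v))"
      using infdist_le by (metis dist_norm)
    then have "(norm (x - m))\<^sup>2 \<le> (norm ((x - m) - c *\<^sub>C v))\<^sup>2"
      unfolding m(2)[symmetric] by (intro power_mono) (auto simp: algebra_simps)
    also have "\<dots> = (norm (x - m))\<^sup>2 - (cmod (cinner v (x - m)))\<^sup>2 / (norm v)\<^sup>2"
      unfolding c_def by (rule power2_norm_diff_orthogonal_part[OF False])
    finally show ?thesis using False by (simp add: divide_le_0_iff)
  qed simp
  with m show ?thesis by blast
qed

lemma dense_if_orthogonal_trivial:
  fixes M :: "'a::complex_hilbert_space set"
  assumes "csubspace M" "closed M" and "\<And>y. (\<And>v. v \<in> M \<Longrightarrow> cinner v y = 0) \<Longrightarrow> y = 0"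
  shows "M = UNIV"
proof -
  have "x \<in> M" for x
  proof -
    obtain m where m: "m \<in> M" "\<And>v. v \<in> M \<Longrightarrow> cinner v (x - m) = 0"
      using orthogonal_projection_exists[OF assms(1,2), of x] by blast
    have "x - m = 0" by (rule assms(3)) (rule m(2))
    with m(1) show ?thesis by simp
  qed
  then show ?thesis by blast
qed

text \<open>The kernel has a one-dimensional complement, spanned by the component \<open>w\<close>
  of \<open>x0\<close> orthogonal to it: every \<open>x\<close> differs from a multiple of
  \<open>w\<close> by an element of the kernel, so pairing with \<open>w\<close> recovers the
  functional.\<close>

lemma Riesz_representation:
  fixes \<phi> :: "'a::complex_hilbert_space \<Rightarrow> complex"
  assumes bl: "bounded_linear \<phi>" and cl: "\<And>c x. \<phi> (c *\<^sub>C x) = c * \<phi> x"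
  shows "\<exists>y. \<forall>x. \<phi> x = cinner y x"
proof (cases "\<exists>x. \<phi> x \<noteq> 0")
  case False
  then show ?thesis by (intro exI[of _ 0]) auto
next
  case True
  then obtain x0 where x0: "\<phi> x0 \<noteq> 0" by blast
  interpret bounded_linear \<phi> by (rule bl)
  define M where "M = {x. \<phi> x = 0}"
  have M: "csubspace M" "closed M"
    unfolding M_def csubspace_def
    by (auto simp: add zero cl intro!: closed_Collect_eq continuous_intros continuous_on)
  obtain m where m: "m \<in> M" "\<And>v. v \<in> M \<Longrightarrow> cinner v (x0 - m) = 0"
    using orthogonal_projection_exists[OF M, of x0] by blast
  define w where "w = x0 - m"
  have w: "\<phi> w = \<phi> x0" using m by (simp add: w_def M_def diff)
  then have "w \<noteq> 0" using x0 zero by auto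
  have "\<phi> x = cinner ((cnj (\<phi> w) / of_real ((norm w)\<^sup>2)) *\<^sub>C w) x" for x
  proof -
    have "x - (\<phi> x / \<phi> w) *\<^sub>C w \<in> M" using w x0 by (simp add: M_def diff cl)
    then have "cinner w (x - (\<phi> x / \<phi> w) *\<^sub>C w) = 0"
      using m(2) cinner_commute[of w] by (simp add: w_def)
    then have "cinner w x = \<phi> x / \<phi> w * of_real ((norm w)\<^sup>2)"
      by (simp add: cinner_simps cinner_self)
    then show ?thesis
      using w x0 \<open>w \<noteq> 0\<close> by (simp add: cinner_simps)
  qed
  then show ?thesis by blast
qed

section \<open>Bounded operators and adjoints\<close>

lemma scale_op_apply [simp]: "blinfun_apply (scale_op c T) x = c *\<^sub>C blinfun_apply T x"
  unfolding scale_op_def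
  by (subst bounded_linear_Blinfun_apply)
     (auto intro: bounded_linear_compose[OF bounded_linear_scaleC] blinfun.bounded_linear_right)

lemma bounded_opsD: "T \<in> bounded_ops \<Longrightarrow> blinfun_apply T (c *\<^sub>C x) = c *\<^sub>C blinfun_apply T x"
  by (simp add: bounded_ops_def)

lemma bounded_opsI:
  "(\<And>c x. blinfun_apply T (c *\<^sub>C x) = c *\<^sub>C blinfun_apply T x) \<Longrightarrow> T \<in> bounded_ops"
  by (simp add: bounded_ops_def)

lemmas blinfun_simps = blinfun.add_left blinfun.add_right blinfun.diff_left blinfun.diff_right
  blinfun.minus_left blinfun.minus_right

lemma bounded_ops_zero: "0 \<in> bounded_ops"
  and bounded_ops_id: "id_blinfun \<in> bounded_ops"
  by (auto intro!: bounded_opsI)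

lemma bounded_ops_add: "S \<in> bounded_ops \<Longrightarrow> T \<in> bounded_ops \<Longrightarrow> S + T \<in> bounded_ops"
  and bounded_ops_diff: "S \<in> bounded_ops \<Longrightarrow> T \<in> bounded_ops \<Longrightarrow> S - T \<in> bounded_ops"
  and bounded_ops_uminus: "T \<in> bounded_ops \<Longrightarrow> - T \<in> bounded_ops"
  and bounded_ops_scale: "T \<in> bounded_ops \<Longrightarrow> scale_op c T \<in> bounded_ops"
  and bounded_ops_compose: "S \<in> bounded_ops \<Longrightarrow> T \<in> bounded_ops \<Longrightarrow> S o\<^sub>L T \<in> bounded_ops"
  by (auto intro!: bounded_opsI simp: bounded_opsD blinfun_simps algebra_simps)

lemma bounded_ops_commutator:
  "S \<in> bounded_ops \<Longrightarrow> T \<in> bounded_ops \<Longrightarrow> commutator S T \<in> bounded_ops"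
  unfolding commutator_def by (intro bounded_ops_diff bounded_ops_compose)

lemmas bounded_ops_intros = bounded_ops_zero bounded_ops_id bounded_ops_add bounded_ops_diff
  bounded_ops_uminus bounded_ops_scale bounded_ops_compose bounded_ops_commutator

lemma tendsto_blinfun_apply_const: "(T \<longlongrightarrow> S) F \<Longrightarrow> ((\<lambda>n. blinfun_apply (T n) x) \<longlongrightarrow> blinfun_apply S x) F"
  by (intro blinfun.tendsto tendsto_const)

lemma closed_bounded_ops: "closed (bounded_ops :: ('h::complex_hilbert_space \<Rightarrow>\<^sub>L 'h) set)"
  unfolding closed_sequential_limits
proof (intro allI impI, elim conjE)
  fix T and S :: "'h \<Rightarrow>\<^sub>L 'h"
  assume T: "\<forall>n. T n \<in> bounded_ops" and lim: "T \<longlonglongrightarrow> S"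
  show "S \<in> bounded_ops"
  proof (rule bounded_opsI)
    fix c x
    have "(\<lambda>n. blinfun_apply (T n) (c *\<^sub>C x)) \<longlonglongrightarrow> blinfun_apply S (c *\<^sub>C x)"
      by (rule tendsto_blinfun_apply_const[OF lim])
    moreover have "(\<lambda>n. c *\<^sub>C blinfun_apply (T n) x) \<longlonglongrightarrow> c *\<^sub>C blinfun_apply S x"
      by (intro tendsto_scaleC tendsto_blinfun_apply_const[OF lim])
    ultimately show "blinfun_apply S (c *\<^sub>C x) = c *\<^sub>C blinfun_apply S x"
      using T LIMSEQ_unique by (simp add: bounded_opsD)
  qed
qed

lemma norm_scale_op: "norm (scale_op c T) \<le> cmod c * norm T"
  by (rule norm_blinfun_bound) (auto simp: norm_scaleC mult.assoc intro!: mult_left_mono norm_blinfun)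

lemma scale_op_add: "scale_op c (S + T) = scale_op c S + scale_op c T"
  and scale_op_add_left: "scale_op (c + d) T = scale_op c T + scale_op d T"
  and scale_op_scale_op [simp]: "scale_op c (scale_op d T) = scale_op (c * d) T"
  and scale_op_one [simp]: "scale_op 1 T = T"
  and scale_op_zero [simp]: "scale_op 0 T = 0"
  and scale_op_zero_right [simp]: "scale_op c 0 = 0"
  and scale_op_minus_one: "scale_op (- 1) T = - T"
  and scale_op_compose_left: "scale_op c S o\<^sub>L T = scale_op c (S o\<^sub>L T)"
  by (auto intro!: blinfun_eqI simp: blinfun_simps algebra_simps)

lemma scale_op_compose_right: "S \<in> bounded_ops \<Longrightarrow> S o\<^sub>L scale_op c T = scale_op c (S o\<^sub>L T)"
  by (auto intro!: blinfun_eqI simp: bounded_opsD)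

lemma scale_op_of_real: "scale_op (of_real r) T = r *\<^sub>R T"
  by (auto intro!: blinfun_eqI simp: blinfun.scaleR_left scaleR_eq_scaleC)

lemma bounded_linear_scale_op: "bounded_linear (scale_op c)"
  by (rule bounded_linear_intro[where K="cmod c"])
     (use norm_scale_op[of c] in \<open>auto simp: scale_op_add mult.commute simp flip: scale_op_of_real\<close>)

lemmas tendsto_scale_op = bounded_linear.tendsto[OF bounded_linear_scale_op]

lemmas tendsto_blinfun_compose = bounded_bilinear.tendsto[OF bounded_bilinear_blinfun_compose]

lemmas blinfun_compose_simps = bounded_bilinear.add_left[OF bounded_bilinear_blinfun_compose]
  bounded_bilinear.add_right[OF bounded_bilinear_blinfun_compose]
  bounded_bilinear.diff_left[OF bounded_bilinear_blinfun_compose]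
  bounded_bilinear.diff_right[OF bounded_bilinear_blinfun_compose]
  bounded_bilinear.minus_left[OF bounded_bilinear_blinfun_compose]
  bounded_bilinear.minus_right[OF bounded_bilinear_blinfun_compose]

lemma id_blinfun_compose [simp]: "id_blinfun o\<^sub>L T = T"
  and compose_id_blinfun [simp]: "T o\<^sub>L id_blinfun = T"
  by (auto intro!: blinfun_eqI)

lemma blinfun_compose_assoc: "(S o\<^sub>L T) o\<^sub>L V = S o\<^sub>L (T o\<^sub>L V)"
  by (auto intro!: blinfun_eqI)

text \<open>The Riesz representation gives one value for each \<open>y\<close>. Linearity of this
  pointwise choice follows from uniqueness of the representing vector, and the bound from cancelling
  one factor in \<open>norm (s y)^2 = |<T (s y), y>|\<close>.\<close>

lemma adj_exists:
  fixes T :: "'h::complex_hilbert_space \<Rightarrow>\<^sub>L 'h"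
  assumes T: "T \<in> bounded_ops"
  shows "\<exists>S\<in>bounded_ops. \<forall>x y. cinner (blinfun_apply T x) y = cinner x (blinfun_apply S y)"
proof -
  have "\<exists>z. \<forall>x. cinner y (blinfun_apply T x) = cinner z x" for y
  proof (rule Riesz_representation)
    show "bounded_linear (\<lambda>x. cinner y (blinfun_apply T x))"
      by (intro bounded_linear_compose[OF bounded_bilinear.bounded_linear_right[OF bounded_bilinear_cinner]]
          blinfun.bounded_linear_right)
  qed (simp add: bounded_opsD[OF T] cinner_simps)
  then obtain s where s: "\<And>x y. cinner y (blinfun_apply T x) = cinner (s y) x" by metis
  have s': "cinner (blinfun_apply T x) y = cinner x (s y)" for x y
    using s[of y x] by (metis cinner_commute)
  have add: "s (x + y) = s x + s y" for x y
    by (rule cinner_eqI) (simp add: cinner_simps flip: s')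
  have scale: "s (c *\<^sub>C x) = c *\<^sub>C s x" for c x
    by (rule cinner_eqI) (simp add: cinner_simps flip: s')
  have bound: "norm (s y) \<le> norm y * norm T" for y
  proof -
    have "norm (s y) * norm (s y) = cmod (cinner (s y) (s y))"
      by (simp add: cinner_self power2_eq_square norm_mult)
    also have "\<dots> = cmod (cinner (blinfun_apply T (s y)) y)" by (simp add: s')
    also have "\<dots> \<le> (norm T * norm (s y)) * norm y"
      by (rule order_trans[OF Cauchy_Schwarz]) (intro mult_right_mono norm_blinfun norm_ge_zero)
    finally have "norm (s y) * norm (s y) \<le> norm (s y) * (norm y * norm T)"
      by (simp add: mult_ac)
    then show ?thesis
      by (cases "norm (s y) = 0") (auto simp: mult_le_cancel_left)
  qed
  have "bounded_linear s"
    by (rule bounded_linear_intro[OF add _ bound]) (simp add: scaleR_eq_scaleC scale)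
  then show ?thesis
    using s' scale by (intro bexI[of _ "Blinfun s"]) (auto simp: bounded_linear_Blinfun_apply intro!: bounded_opsI)
qed

lemma adj_eqI:
  assumes "\<And>x y. cinner (blinfun_apply T x) y = cinner x (blinfun_apply S y)"
  shows "adj T = S"
  unfolding adj_def
proof (rule the_equality)
  fix S' assume S': "\<forall>x y. cinner (blinfun_apply T x) y = cinner x (blinfun_apply S' y)"
  show "S' = S"
    by (rule blinfun_eqI, rule cinner_eqI) (simp add: assms flip: S'[rule_format])
qed (use assms in blast)

lemma
  assumes "T \<in> bounded_ops"
  shows cinner_adj: "cinner (blinfun_apply T x) y = cinner x (blinfun_apply (adj T) y)"
    and adj_bounded_ops: "adj T \<in> bounded_ops"
proof -
  obtain S where S: "S \<in> bounded_ops"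
    "\<And>x y. cinner (blinfun_apply T x) y = cinner x (blinfun_apply S y)"
    using adj_exists[OF assms] by blast
  have "adj T = S" by (rule adj_eqI) (rule S)
  then show "cinner (blinfun_apply T x) y = cinner x (blinfun_apply (adj T) y)" "adj T \<in> bounded_ops"
    using S by auto
qed

lemma cinner_adj':
  "T \<in> bounded_ops \<Longrightarrow> cinner x (blinfun_apply T y) = cinner (blinfun_apply (adj T) x) y"
  by (metis cinner_adj cinner_commute)

lemma adj_adj: "T \<in> bounded_ops \<Longrightarrow> adj (adj T) = T"
  by (rule adj_eqI) (simp add: cinner_adj')

lemma adj_zero [simp]: "adj 0 = 0"
  and adj_id [simp]: "adj id_blinfun = id_blinfun"
  by (rule adj_eqI; simp)+

lemma adj_add: "S \<in> bounded_ops \<Longrightarrow> T \<in> bounded_ops \<Longrightarrow> adj (S + T) = adj S + adj T"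
  and adj_diff: "S \<in> bounded_ops \<Longrightarrow> T \<in> bounded_ops \<Longrightarrow> adj (S - T) = adj S - adj T"
  and adj_scale: "T \<in> bounded_ops \<Longrightarrow> adj (scale_op c T) = scale_op (cnj c) (adj T)"
  and adj_compose: "S \<in> bounded_ops \<Longrightarrow> T \<in> bounded_ops \<Longrightarrow> adj (S o\<^sub>L T) = adj T o\<^sub>L adj S"
  by (rule adj_eqI; simp add: blinfun_simps cinner_simps cinner_adj)+

lemma adj_commutator:
  "S \<in> bounded_ops \<Longrightarrow> T \<in> bounded_ops \<Longrightarrow> adj (commutator S T) = commutator (adj T) (adj S)"
  by (simp add: commutator_def adj_diff adj_compose bounded_ops_compose)

lemma norm_adj_le:
  assumes T: "T \<in> bounded_ops"
  shows "norm (adj T) \<le> norm T"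
proof (rule norm_blinfun_bound)
  fix y
  let ?s = "blinfun_apply (adj T) y"
  have "norm ?s * norm ?s = cmod (cinner ?s ?s)"
    by (simp add: cinner_self power2_eq_square norm_mult)
  also have "\<dots> = cmod (cinner (blinfun_apply T ?s) y)" by (simp add: cinner_adj[OF T])
  also have "\<dots> \<le> (norm T * norm ?s) * norm y"
    by (rule order_trans[OF Cauchy_Schwarz]) (intro mult_right_mono norm_blinfun norm_ge_zero)
  finally have "norm ?s * norm ?s \<le> norm ?s * (norm T * norm y)"
    by (simp add: mult_ac)
  then show "norm ?s \<le> norm T * norm y"
    by (cases "norm ?s = 0") (auto simp: mult_le_cancel_left)
qed simp

lemma tendsto_adj:
  assumes "\<And>n. T n \<in> bounded_ops" "S \<in> bounded_ops" "(T \<longlongrightarrow> S) F"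
  shows "((\<lambda>n. adj (T n)) \<longlongrightarrow> adj S) F"
proof -
  have "((\<lambda>n. adj (T n) - adj S) \<longlongrightarrow> 0) F"
  proof (rule Lim_null_comparison)
    show "((\<lambda>n. norm (T n - S)) \<longlongrightarrow> 0) F"
      using assms(3) by (simp add: LIM_zero_iff tendsto_norm_zero_iff)
    show "\<forall>\<^sub>F n in F. norm (adj (T n) - adj S) \<le> norm (T n - S)"
      using norm_adj_le[OF bounded_ops_diff[OF assms(1,2)]] by (simp add: adj_diff assms)
  qed
  then show ?thesis by (simp add: LIM_zero_iff)
qed

lemma power2_norm_apply_eq:
  assumes "T \<in> bounded_ops"
  shows "(norm (blinfun_apply T x))\<^sup>2 = Re (cinner x (blinfun_apply (adj T o\<^sub>L T) x))"
  by (simp add: power2_norm_eq_cinner cinner_adj[OF assms])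

lemma positive_op_adj_compose:
  assumes "T \<in> bounded_ops"
  shows "positive_op (adj T o\<^sub>L T)"
proof -
  have "cinner x (blinfun_apply (adj T o\<^sub>L T) x) = of_real ((norm (blinfun_apply T x))\<^sup>2)" for x
    by (metis assms blinfun_apply_blinfun_compose cinner_adj cinner_self)
  then show ?thesis
    by (simp add: positive_op_def bounded_ops_compose adj_bounded_ops assms)
qed

section \<open>C*-algebras of operators\<close>

lemma star_algebraD:
  assumes "star_algebra V"
  shows "V \<subseteq> bounded_ops" "0 \<in> V"
    "\<And>S T. S \<in> V \<Longrightarrow> T \<in> V \<Longrightarrow> S + T \<in> V"
    "\<And>c T. T \<in> V \<Longrightarrow> scale_op c T \<in> V"
    "\<And>S T. S \<in> V \<Longrightarrow> T \<in> V \<Longrightarrow> S o\<^sub>L T \<in> V"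
    "\<And>T. T \<in> V \<Longrightarrow> adj T \<in> V"
  using assms by (auto simp: star_algebra_def op_subspace_def)

lemma star_algebraI:
  assumes "V \<subseteq> bounded_ops" "0 \<in> V"
    "\<And>S T. S \<in> V \<Longrightarrow> T \<in> V \<Longrightarrow> S + T \<in> V"
    "\<And>c T. T \<in> V \<Longrightarrow> scale_op c T \<in> V"
    "\<And>S T. S \<in> V \<Longrightarrow> T \<in> V \<Longrightarrow> S o\<^sub>L T \<in> V"
    "\<And>T. T \<in> V \<Longrightarrow> adj T \<in> V"
  shows "star_algebra V"
  using assms by (simp add: star_algebra_def op_subspace_def)

lemma op_subspace_diff: "op_subspace V \<Longrightarrow> S \<in> V \<Longrightarrow> T \<in> V \<Longrightarrow> S - T \<in> V"
  unfolding op_subspace_def using scale_op_minus_one[of T] by (metis diff_conv_add_uminus)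

lemma star_algebra_diff: "star_algebra V \<Longrightarrow> S \<in> V \<Longrightarrow> T \<in> V \<Longrightarrow> S - T \<in> V"
  by (rule op_subspace_diff) (auto simp: star_algebra_def)

lemma star_algebra_commutator: "star_algebra V \<Longrightarrow> S \<in> V \<Longrightarrow> T \<in> V \<Longrightarrow> commutator S T \<in> V"
  unfolding commutator_def by (intro star_algebra_diff star_algebraD)

lemma star_algebra_Inter: "\<forall>V\<in>X. star_algebra V \<Longrightarrow> X \<noteq> {} \<Longrightarrow> star_algebra (\<Inter> X)"
  by (rule star_algebraI) (auto dest: star_algebraD)

lemma cstar_algebra_bounded_ops: "cstar_algebra bounded_ops"
  by (auto simp: cstar_algebra_def star_algebra_def op_subspace_def bounded_ops_intros adj_bounded_ops
      closed_bounded_ops)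

lemma cstar_algebra_hull:
  assumes "X \<subseteq> bounded_ops"
  shows "cstar_algebra (cstar_algebra hull X)"
  unfolding hull_def cstar_algebra_def
  using assms cstar_algebra_bounded_ops
  by (intro conjI star_algebra_Inter closed_Inter) (auto simp: cstar_algebra_def)

lemma tendsto_norm_bound:
  fixes f :: "_ \<Rightarrow> 'a::real_normed_vector"
  assumes "\<And>n. norm (f n - l) \<le> g n" "(g \<longlongrightarrow> 0) F"
  shows "(f \<longlongrightarrow> l) F"
  by (rule LIM_zero_cancel, rule Lim_null_comparison[OF _ assms(2)]) (simp add: assms(1))

lemma closureI_tendsto:
  fixes l :: "'a::metric_space"
  shows "(\<And>n. f n \<in> S) \<Longrightarrow> f \<longlonglongrightarrow> l \<Longrightarrow> l \<in> closure S"
  by (auto simp: closure_sequential)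

text \<open>The scalar hypothesis asks only for membership in the closure, which admits a countable
  \<open>V\<close> that is closed under a dense set of scalars.\<close>

lemma cstar_algebra_closure:
  assumes sub: "V \<subseteq> bounded_ops" and zero: "0 \<in> V"
    and add: "\<And>S T. S \<in> V \<Longrightarrow> T \<in> V \<Longrightarrow> S + T \<in> V"
    and comp: "\<And>S T. S \<in> V \<Longrightarrow> T \<in> V \<Longrightarrow> S o\<^sub>L T \<in> V"
    and adj: "\<And>T. T \<in> V \<Longrightarrow> adj T \<in> V"
    and scale: "\<And>c T. T \<in> V \<Longrightarrow> scale_op c T \<in> closure V"
  shows "cstar_algebra (closure V)"
proof -
  have cl: "closure V \<subseteq> bounded_ops"
    using sub closed_bounded_ops by (rule closure_minimal)
  have *: "\<exists>f. (\<forall>n. f n \<in> V) \<and> f \<longlonglongrightarrow> T" if "T \<in> closure V" for T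
    using that by (simp add: closure_sequential)
  have "S + T \<in> closure V \<and> S o\<^sub>L T \<in> closure V"
    if ST: "S \<in> closure V" "T \<in> closure V" for S T
  proof -
    obtain f g where "\<And>n. f n \<in> V" "f \<longlonglongrightarrow> S" "\<And>n. g n \<in> V" "g \<longlonglongrightarrow> T"
      using *[OF ST(1)] *[OF ST(2)] by blast
    then show ?thesis
      by (intro conjI closureI_tendsto[of "\<lambda>n. f n + g n"] closureI_tendsto[of "\<lambda>n. f n o\<^sub>L g n"]
          add comp tendsto_add tendsto_blinfun_compose)
  qed
  moreover have "adj T \<in> closure V \<and> scale_op c T \<in> closure V" if T: "T \<in> closure V" for T c
  proof -
    obtain f where f: "\<And>n. f n \<in> V" "f \<longlonglongrightarrow> T"
      using *[OF T] by blast
    have "adj T \<in> closure V"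
      by (rule closureI_tendsto[of "\<lambda>n. adj (f n)"]) (use f T sub cl in \<open>auto intro!: tendsto_adj adj\<close>)
    moreover have "scale_op c T \<in> closure (closure V)"
      by (rule closureI_tendsto[of "\<lambda>n. scale_op c (f n)"])
         (use f in \<open>auto intro!: tendsto_scale_op scale\<close>)
    ultimately show ?thesis by simp
  qed
  ultimately show ?thesis
    using cl zero closure_subset[of V]
    unfolding cstar_algebra_def star_algebra_def op_subspace_def by auto
qed

lemma cstar_algebra_closure_star_algebra: "star_algebra V \<Longrightarrow> cstar_algebra (closure V)"
  using closure_subset[of V] by (intro cstar_algebra_closure) (auto dest: star_algebraD)

section \<open>Countable generation: countability of the operators from countability of the
  syntax\<close>

datatype star_term = Gen nat | Scale nat star_term | Plus star_term star_term
  | Times star_term star_term | Star star_term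

instance star_term :: countable
  by countable_datatype

text \<open>The terms evaluate to the \<open>*\<close>-algebra that a sequence of operators generates over a countable
  dense field of scalars.\<close>

primrec eval_term ::
    "(nat \<Rightarrow> 'h::complex_hilbert_space \<Rightarrow>\<^sub>L 'h) \<Rightarrow> (nat \<Rightarrow> complex) \<Rightarrow> star_term \<Rightarrow> 'h \<Rightarrow>\<^sub>L 'h" where
  "eval_term g c (Gen n) = g n"
| "eval_term g c (Scale n t) = scale_op (c n) (eval_term g c t)"
| "eval_term g c (Plus s t) = eval_term g c s + eval_term g c t"
| "eval_term g c (Times s t) = eval_term g c s o\<^sub>L eval_term g c t"
| "eval_term g c (Star t) = adj (eval_term g c t)"

text \<open>The values of all terms are closed under the algebraic operations by construction and
  under a countable dense set of scalars. Density of the scalars then supplies the remaining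
  multiples in the closure.\<close>

lemma cstar_algebra_separable_if_countably_generated:
  fixes X :: "('h::complex_hilbert_space \<Rightarrow>\<^sub>L 'h) set"
  assumes "countable X" "X \<subseteq> bounded_ops"
  shows "\<exists>C. countable C \<and> cstar_algebra (closure C) \<and> X \<subseteq> closure C"
proof -
  \<comment> \<open>Adding 0 makes the enumerated set nonempty and also puts 0 into
    \<open>C\<close>.\<close>
  define g where "g = from_nat_into (insert 0 X)"
  have rg: "range g = insert 0 X" unfolding g_def using assms by (intro range_from_nat_into) auto
  obtain Q :: "complex set" where Q: "countable Q" and "UNIV \<subseteq> closure Q"
    by (rule separable)
  then have Q_dense: "closure Q = UNIV" by blast
  define c where "c = from_nat_into Q"
  have "Q \<noteq> {}" using Q_dense by auto
  then have rc: "range c = Q" unfolding c_def using Q by (intro range_from_nat_into)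
  define C where "C = range (eval_term g c)"
  have bo: "eval_term g c t \<in> bounded_ops" for t
  proof (induction t)
    case (Gen n)
    have "g n \<in> insert 0 X" using rg by blast
    then show ?case using assms bounded_ops_zero by auto
  qed (simp_all add: bounded_ops_intros adj_bounded_ops)
  have gen: "insert 0 X \<subseteq> C"
  proof (rule subsetI)
    fix T assume "T \<in> insert 0 X"
    then obtain n where "T = eval_term g c (Gen n)" unfolding rg[symmetric] by auto
    then show "T \<in> C" unfolding C_def by blast
  qed
  have "cstar_algebra (closure C)"
  proof (rule cstar_algebra_closure)
    fix d T assume "T \<in> C"
    then obtain t where t: "T = eval_term g c t" by (auto simp: C_def)
    have "d \<in> closure (range c)" by (simp add: rc Q_dense)
    then obtain s where s: "\<And>n. s n \<in> range c" "s \<longlonglongrightarrow> d" by (auto simp: closure_sequential)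
    show "scale_op d T \<in> closure C"
    proof (rule closureI_tendsto)
      show "scale_op (s n) T \<in> C" for n
      proof -
        obtain k where "s n = c k" using s(1)[of n] by blast
        then have "scale_op (s n) T = eval_term g c (Scale k t)" by (simp add: t)
        then show ?thesis unfolding C_def by blast
      qed
      have "(\<lambda>n. cmod (s n - d) * norm T) \<longlonglongrightarrow> 0"
        using s(2) by (intro tendsto_mult_left_zero tendsto_norm_zero LIM_zero)
      moreover have "norm (scale_op (s n) T - scale_op d T) \<le> cmod (s n - d) * norm T" for n
      proof -
        have "scale_op (s n) T - scale_op d T = scale_op (s n - d) T"
          by (auto intro!: blinfun_eqI simp: blinfun_simps algebra_simps)
        then show ?thesis using norm_scale_op by metis
      qed
      ultimately show "(\<lambda>n. scale_op (s n) T) \<longlonglongrightarrow> scale_op d T"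
        by (rule tendsto_norm_bound[rotated])
    qed
  next
    fix S T assume "S \<in> C" "T \<in> C"
    then obtain s t where st: "S = eval_term g c s" "T = eval_term g c t" by (auto simp: C_def)
    show "S + T \<in> C" "S o\<^sub>L T \<in> C"
      unfolding C_def st by (metis rangeI eval_term.simps(3)) (metis rangeI eval_term.simps(4))
  next
    fix T assume "T \<in> C"
    then obtain t where t: "T = eval_term g c t" by (auto simp: C_def)
    show "adj T \<in> C"
      unfolding C_def t by (metis rangeI eval_term.simps(5))
  qed (use bo gen in \<open>auto simp: C_def\<close>)
  moreover have "countable C" by (simp add: C_def)
  ultimately show ?thesis using gen closure_subset[of C] by blast
qed

section \<open>Resolvents of self-adjoint operators\<close>

locale self_adjoint_operator =
  fixes D :: "'h::complex_hilbert_space unbounded_op"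
  assumes self_adj: "self_adjoint D"
begin

definition D_val :: "'h \<Rightarrow> 'h" where "D_val x = the (D x)"

lemma dom_dense: "closure (dom D) = UNIV"
  and dom_zero: "0 \<in> dom D"
  and dom_add: "x \<in> dom D \<Longrightarrow> y \<in> dom D \<Longrightarrow> x + y \<in> dom D"
  and D_add: "x \<in> dom D \<Longrightarrow> y \<in> dom D \<Longrightarrow> D_val (x + y) = D_val x + D_val y"
  and dom_scale: "x \<in> dom D \<Longrightarrow> c *\<^sub>C x \<in> dom D"
  and D_scale: "x \<in> dom D \<Longrightarrow> D_val (c *\<^sub>C x) = c *\<^sub>C D_val x"
  using self_adj unfolding self_adjoint_def densely_defined_linear_def D_val_def by auto

lemma dom_diff: "x \<in> dom D \<Longrightarrow> y \<in> dom D \<Longrightarrow> x - y \<in> dom D"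
  using dom_add[OF _ dom_scale[of y "-1"], of x] by simp

lemma D_diff: "x \<in> dom D \<Longrightarrow> y \<in> dom D \<Longrightarrow> D_val (x - y) = D_val x - D_val y"
  using D_add[OF _ dom_scale[of y "-1"], of x] D_scale[of y "-1"] by simp

lemma D_zero: "D_val 0 = 0"
  using D_scale[OF dom_zero, of 0] by simp

text \<open>This is the half of self-adjointness that goes beyond symmetry: a vector at which an
  adjoint value exists already lies in the domain. Density of the domain makes the value unique.
  Closedness of \<open>D\<close> and surjectivity of \<open>l - D\<close> both rest on it.\<close>

lemma adjoint_domainI:
  assumes z: "\<And>x. x \<in> dom D \<Longrightarrow> cinner (D_val x) y = cinner x z"
  shows "y \<in> dom D" "D_val y = z"
proof -
  have "(THE z. \<forall>x\<in>dom D. cinner (the (D x)) y = cinner x z) = z"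
    using z by (intro the_equality) (auto simp: D_val_def intro!: cinner_eqI_dense[OF dom_dense])
  moreover have "\<exists>z. \<forall>x\<in>dom D. cinner (the (D x)) y = cinner x z"
    using z unfolding D_val_def by blast
  ultimately have "unbounded_adj D y = Some z" unfolding unbounded_adj_def by simp
  then have "D y = Some z" using self_adj by (simp add: self_adjoint_def)
  then show "y \<in> dom D" "D_val y = z" by (auto simp: D_val_def)
qed

lemma D_symmetric:
  assumes "x \<in> dom D" "y \<in> dom D"
  shows "cinner (D_val x) y = cinner x (D_val y)"
proof -
  have "unbounded_adj D y \<noteq> None"
    using assms(2) self_adj by (auto simp: self_adjoint_def)
  then obtain z where z: "\<And>x. x \<in> dom D \<Longrightarrow> cinner (D_val x) y = cinner x z"
    unfolding unbounded_adj_def D_val_def by (metis (no_types, lifting))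
  then show ?thesis using adjoint_domainI(2)[OF z] assms by simp
qed

lemma D_closed:
  assumes s: "\<And>n. s n \<in> dom D" "s \<longlonglongrightarrow> x" "(\<lambda>n. D_val (s n)) \<longlonglongrightarrow> z"
  shows "x \<in> dom D" "D_val x = z"
proof -
  have "cinner (D_val u) x = cinner u z" if u: "u \<in> dom D" for u
  proof -
    have "(\<lambda>n. cinner (D_val u) (s n)) \<longlonglongrightarrow> cinner (D_val u) x"
      by (intro tendsto_cinner tendsto_const s)
    moreover have "(\<lambda>n. cinner u (D_val (s n))) \<longlonglongrightarrow> cinner u z"
      by (intro tendsto_cinner tendsto_const s)
    ultimately show ?thesis
      using LIMSEQ_unique by (simp add: D_symmetric[OF u s(1)])
  qed
  then show "x \<in> dom D" "D_val x = z" by (rule adjoint_domainI; blast)+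
qed

text \<open>By symmetry \<open><x, D x>\<close> is real, so the imaginary part of
  \<open><x, (l - D) x>\<close> is exactly \<open>Im l\<close> times the squared norm of
  \<open>x\<close>.\<close>

lemma norm_shift_ge:
  assumes x: "x \<in> dom D"
  shows "\<bar>Im l\<bar> * norm x \<le> norm (l *\<^sub>C x - D_val x)"
proof (cases "x = 0")
  case False
  have "cinner x (D_val x) = cnj (cinner x (D_val x))"
    using D_symmetric[OF x x] cinner_commute[of x "D_val x"] by simp
  then have "Im (cinner x (D_val x)) = 0" by (simp add: complex_eq_iff)
  then have "Im (cinner x (l *\<^sub>C x - D_val x)) = Im l * (norm x)\<^sup>2"
    by (simp add: cinner_simps cinner_self)
  then have "\<bar>Im l\<bar> * (norm x)\<^sup>2 = \<bar>Im (cinner x (l *\<^sub>C x - D_val x))\<bar>"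
    by (simp add: abs_mult)
  also have "\<dots> \<le> norm x * norm (l *\<^sub>C x - D_val x)"
    using abs_Im_le_cmod Cauchy_Schwarz order_trans by blast
  finally have "norm x * (\<bar>Im l\<bar> * norm x) \<le> norm x * norm (l *\<^sub>C x - D_val x)"
    by (simp add: power2_eq_square mult_ac)
  then show ?thesis using False by (simp add: mult_le_cancel_left)
qed simp

lemma shift_eq_iff:
  assumes "Im l \<noteq> 0" "x \<in> dom D" "y \<in> dom D" "l *\<^sub>C x - D_val x = l *\<^sub>C y - D_val y"
  shows "x = y"
proof -
  have "l *\<^sub>C (x - y) - D_val (x - y) = (l *\<^sub>C x - D_val x) - (l *\<^sub>C y - D_val y)"
    using assms by (simp add: D_diff algebra_simps)
  then have "\<bar>Im l\<bar> * norm (x - y) \<le> 0"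
    using norm_shift_ge[OF dom_diff[OF assms(2,3)], of l] assms(4) by simp
  then show ?thesis using assms(1) by (simp add: mult_le_0_iff)
qed

text \<open>The range is closed because the lower bound makes preimages of a convergent sequence
  Cauchy and \<open>D\<close> is closed. A vector \<open>y\<close> orthogonal to it lies in the
  domain with \<open>D y = cnj l y\<close>, and the lower bound for \<open>cnj l\<close> forces
  \<open>y = 0\<close>.\<close>

lemma shift_surj:
  assumes l: "Im l \<noteq> 0"
  shows "\<exists>x\<in>dom D. l *\<^sub>C x - D_val x = y"
proof -
  define M where "M = (\<lambda>x. l *\<^sub>C x - D_val x) ` dom D"
  have sub: "csubspace M"
    unfolding csubspace_def
  proof (intro conjI ballI allI)
    show "0 \<in> M" unfolding M_def using dom_zero D_zero by force
    fix u c assume "u \<in> M"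
    then obtain x where x: "x \<in> dom D" "u = l *\<^sub>C x - D_val x" by (auto simp: M_def)
    have "c *\<^sub>C u = l *\<^sub>C (c *\<^sub>C x) - D_val (c *\<^sub>C x)"
      unfolding x(2) by (simp add: D_scale x(1) algebra_simps)
    then show "c *\<^sub>C u \<in> M" unfolding M_def using dom_scale[OF x(1)] by blast
    fix v assume "v \<in> M"
    then obtain y where y: "y \<in> dom D" "v = l *\<^sub>C y - D_val y" by (auto simp: M_def)
    have "u + v = l *\<^sub>C (x + y) - D_val (x + y)"
      unfolding x(2) y(2) by (simp add: D_add x(1) y(1) algebra_simps)
    then show "u + v \<in> M" unfolding M_def using dom_add[OF x(1) y(1)] by blast
  qed
  have closed: "closed M"
    unfolding closed_sequential_limits
  proof (intro allI impI, elim conjE)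
    fix v w assume "\<forall>n. v n \<in> M" and lim: "v \<longlonglongrightarrow> w"
    then have "\<forall>n. \<exists>x\<in>dom D. v n = l *\<^sub>C x - D_val x" unfolding M_def image_iff by blast
    then obtain x where x: "\<And>n. x n \<in> dom D" "\<And>n. v n = l *\<^sub>C x n - D_val (x n)" by metis
    have bound: "\<bar>Im l\<bar> * dist (x m) (x n) \<le> dist (v m) (v n)" for m n
    proof -
      have "v m - v n = l *\<^sub>C (x m - x n) - D_val (x m - x n)"
        unfolding x(2) by (simp add: D_diff x(1) algebra_simps)
      then show ?thesis
        using norm_shift_ge[OF dom_diff[OF x(1) x(1)], of l m n] by (simp add: dist_norm)
    qed
    have "Cauchy x"
    proof (rule metric_CauchyI)
      fix e :: real assume "e > 0"
      then have "\<bar>Im l\<bar> * e > 0" using l by simp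
      then obtain k where k: "\<And>m n. m \<ge> k \<Longrightarrow> n \<ge> k \<Longrightarrow> dist (v m) (v n) < \<bar>Im l\<bar> * e"
        using metric_CauchyD[OF LIMSEQ_imp_Cauchy[OF lim]] by blast
      have "dist (x m) (x n) < e" if "m \<ge> k" "n \<ge> k" for m n
      proof -
        have "\<bar>Im l\<bar> * dist (x m) (x n) < \<bar>Im l\<bar> * e"
          using bound[of m n] k[OF that] by linarith
        then show ?thesis using l by (simp add: mult_less_cancel_left)
      qed
      then show "\<exists>K. \<forall>m\<ge>K. \<forall>n\<ge>K. dist (x m) (x n) < e" by blast
    qed
    then obtain x0 where x0: "x \<longlonglongrightarrow> x0"
      unfolding Cauchy_convergent_iff convergent_def by blast
    have "(\<lambda>n. D_val (x n)) \<longlonglongrightarrow> l *\<^sub>C x0 - w"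
    proof -
      have "D_val (x n) = l *\<^sub>C x n - v n" for n by (simp add: x(2))
      then show ?thesis using x0 lim by (auto intro!: tendsto_diff tendsto_scaleC)
    qed
    from D_closed[OF x(1) x0 this] have "x0 \<in> dom D" "w = l *\<^sub>C x0 - D_val x0" by auto
    then show "w \<in> M" unfolding M_def by blast
  qed
  have "M = UNIV"
  proof (rule dense_if_orthogonal_trivial[OF sub closed])
    fix y assume y: "\<And>v. v \<in> M \<Longrightarrow> cinner v y = 0"
    have "cinner (D_val x) y = cinner x (cnj l *\<^sub>C y)" if "x \<in> dom D" for x
      using y[of "l *\<^sub>C x - D_val x"] that by (simp add: M_def cinner_simps)
    note * = adjoint_domainI[OF this]
    show "y = 0"
      using norm_shift_ge[OF *(1), of "cnj l"] *(2) l by (simp add: mult_le_0_iff)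
  qed
  then have "y \<in> (\<lambda>x. l *\<^sub>C x - D_val x) ` dom D" unfolding M_def by blast
  then show ?thesis unfolding image_iff by metis
qed

lemma resolvent_exists:
  assumes l: "Im l \<noteq> 0"
  shows "\<exists>R. R \<in> bounded_ops \<and> norm R \<le> inverse \<bar>Im l\<bar> \<and>
    (\<forall>x. blinfun_apply R x \<in> dom D \<and> l *\<^sub>C blinfun_apply R x - D_val (blinfun_apply R x) = x) \<and>
    (\<forall>x\<in>dom D. blinfun_apply R (l *\<^sub>C x - D_val x) = x)"
proof -
  obtain r where r: "\<And>y. r y \<in> dom D" "\<And>y. l *\<^sub>C r y - D_val (r y) = y"
    using shift_surj[OF l] by metis
  have left: "r (l *\<^sub>C x - D_val x) = x" if "x \<in> dom D" for x
    by (rule shift_eq_iff[OF l r(1) that]) (rule r(2))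
  have add: "r (x + y) = r x + r y" for x y
    using left[OF dom_add[OF r(1) r(1)], of x y] r(2)[of x] r(2)[of y]
    by (simp add: D_add r(1) algebra_simps)
  have scale: "r (c *\<^sub>C x) = c *\<^sub>C r x" for c x
  proof -
    have "l *\<^sub>C (c *\<^sub>C r x) - D_val (c *\<^sub>C r x) = c *\<^sub>C (l *\<^sub>C r x - D_val (r x))"
      by (simp add: D_scale r(1) algebra_simps)
    then show ?thesis using left[OF dom_scale[OF r(1)], of c x] r(2) by simp
  qed
  have bound: "norm (r x) \<le> norm x * inverse \<bar>Im l\<bar>" for x
    using norm_shift_ge[OF r(1), of l x] r(2)[of x] l by (simp add: field_simps)
  have "bounded_linear r"
    by (rule bounded_linear_intro[OF add _ bound]) (simp add: scaleR_eq_scaleC scale)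
  then have app: "blinfun_apply (Blinfun r) = r" by (rule bounded_linear_Blinfun_apply)
  have "norm (Blinfun r) \<le> inverse \<bar>Im l\<bar>"
    by (rule norm_blinfun_bound) (use bound in \<open>auto simp: app mult.commute\<close>)
  then show ?thesis
    using r left scale by (intro exI[of _ "Blinfun r"]) (auto simp: app intro!: bounded_opsI)
qed

context
  fixes l :: complex assumes l: "l \<notin> \<real>"
begin

lemma Im_nonzero: "Im l \<noteq> 0"
  using l by (simp add: complex_is_Real_iff)

text \<open>Since \<open>l - D\<close> is injective on the domain, a right inverse with values in
  the domain is determined; this unfolds the \<open>THE\<close> in \<open>resolvent\<close>.\<close>

lemma resolvent_unique:
  assumes "\<And>x. blinfun_apply R x \<in> dom D" "\<And>x. l *\<^sub>C blinfun_apply R x - D_val (blinfun_apply R x) = x"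
  shows "resolvent D l = R"
proof -
  obtain R' where R': "R' \<in> bounded_ops"
    "\<And>x. blinfun_apply R' x \<in> dom D" "\<And>x. l *\<^sub>C blinfun_apply R' x - D_val (blinfun_apply R' x) = x"
    "\<And>x. x \<in> dom D \<Longrightarrow> blinfun_apply R' (l *\<^sub>C x - D_val x) = x"
    using resolvent_exists[OF Im_nonzero] by blast
  have eq: "S = R'" if "\<And>x. blinfun_apply S x \<in> dom D"
    "\<And>x. l *\<^sub>C blinfun_apply S x - D_val (blinfun_apply S x) = x" for S
    by (rule blinfun_eqI, rule shift_eq_iff[OF Im_nonzero that(1) R'(2)]) (simp add: that R')
  have "resolvent D l = R'"
    unfolding resolvent_def using R' eq
    by (intro the_equality) (auto simp: D_val_def)
  then show ?thesis using eq[OF assms] by simp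
qed

lemma
  shows resolvent_bounded_ops: "resolvent D l \<in> bounded_ops"
    and norm_resolvent: "norm (resolvent D l) \<le> inverse \<bar>Im l\<bar>"
    and resolvent_dom: "blinfun_apply (resolvent D l) x \<in> dom D"
    and resolvent_right:
      "l *\<^sub>C blinfun_apply (resolvent D l) x - D_val (blinfun_apply (resolvent D l) x) = x"
    and resolvent_left: "x \<in> dom D \<Longrightarrow> blinfun_apply (resolvent D l) (l *\<^sub>C x - D_val x) = x"
proof -
  obtain R where R: "R \<in> bounded_ops" "norm R \<le> inverse \<bar>Im l\<bar>"
    "\<And>x. blinfun_apply R x \<in> dom D" "\<And>x. l *\<^sub>C blinfun_apply R x - D_val (blinfun_apply R x) = x"
    "\<And>x. x \<in> dom D \<Longrightarrow> blinfun_apply R (l *\<^sub>C x - D_val x) = x"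
    using resolvent_exists[OF Im_nonzero] by blast
  have "resolvent D l = R" by (rule resolvent_unique) (rule R)+
  then show "resolvent D l \<in> bounded_ops" "norm (resolvent D l) \<le> inverse \<bar>Im l\<bar>"
    "blinfun_apply (resolvent D l) x \<in> dom D"
    "l *\<^sub>C blinfun_apply (resolvent D l) x - D_val (blinfun_apply (resolvent D l) x) = x"
    "x \<in> dom D \<Longrightarrow> blinfun_apply (resolvent D l) (l *\<^sub>C x - D_val x) = x"
    using R by auto
qed

text \<open>With \<open>v = R x\<close> both \<open>v\<close> and \<open>a v\<close> lie in the
  domain, and there \<open>T v = a x - (l - D) (a v)\<close>. Applying \<open>R\<close> once more
  cancels \<open>l - D\<close>.\<close>

lemma commutator_resolvent:
  assumes a: "a \<in> bounded_ops" "blinfun_apply a ` dom D \<subseteq> dom D"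
    and T: "\<And>x. x \<in> dom D \<Longrightarrow> blinfun_apply T x = D_val (blinfun_apply a x) - blinfun_apply a (D_val x)"
  shows "commutator (resolvent D l) a = resolvent D l o\<^sub>L T o\<^sub>L resolvent D l"
proof (rule blinfun_eqI)
  fix x
  define R where "R = blinfun_apply (resolvent D l)"
  define v where "v = R x"
  have v: "v \<in> dom D" "x = l *\<^sub>C v - D_val v"
    unfolding v_def R_def by (simp_all add: resolvent_dom resolvent_right)
  have av: "blinfun_apply a v \<in> dom D" using a(2) v(1) by blast
  have "R (blinfun_apply T v) = R (blinfun_apply a x - (l *\<^sub>C blinfun_apply a v - D_val (blinfun_apply a v)))"
    by (simp add: T v blinfun_simps bounded_opsD[OF a(1)])
  also have "\<dots> = R (blinfun_apply a x) - blinfun_apply a v"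
    using resolvent_left[OF av] by (simp add: R_def blinfun_simps)
  finally show "blinfun_apply (commutator (resolvent D l) a) x =
      blinfun_apply (resolvent D l o\<^sub>L T o\<^sub>L resolvent D l) x"
    by (simp add: commutator_def blinfun_simps v_def R_def)
qed

end

lemma adj_resolvent:
  assumes l: "l \<notin> \<real>"
  shows "adj (resolvent D l) = resolvent D (cnj l)"
proof (rule adj_eqI)
  fix x y
  have l': "cnj l \<notin> \<real>" using l by (simp add: complex_is_Real_iff)
  let ?u = "blinfun_apply (resolvent D l) x" and ?v = "blinfun_apply (resolvent D (cnj l)) y"
  have "cinner ?u y = cinner ?u (cnj l *\<^sub>C ?v - D_val ?v)"
    by (simp add: resolvent_right[OF l'])
  also have "\<dots> = cinner (l *\<^sub>C ?u - D_val ?u) ?v"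
    using D_symmetric[OF resolvent_dom[OF l] resolvent_dom[OF l']] by (simp add: cinner_simps)
  finally show "cinner ?u y = cinner x ?v"
    by (simp add: resolvent_right[OF l])
qed

lemma resolvent_identity:
  assumes l: "l \<notin> \<real>" and m: "m \<notin> \<real>"
  shows "resolvent D l - resolvent D m = scale_op (m - l) (resolvent D l o\<^sub>L resolvent D m)"
proof (rule blinfun_eqI)
  fix x
  let ?R = "blinfun_apply (resolvent D l)" and ?v = "blinfun_apply (resolvent D m) x"
  have "x = (m - l) *\<^sub>C ?v + (l *\<^sub>C ?v - D_val ?v)"
    using resolvent_right[OF m, of x] by (simp add: algebra_simps)
  then have "?R x = (m - l) *\<^sub>C ?R ?v + ?v"
    using resolvent_left[OF l resolvent_dom[OF m], of x] bounded_opsD[OF resolvent_bounded_ops[OF l]]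
    by (metis blinfun.add_right)
  then show "blinfun_apply (resolvent D l - resolvent D m) x
      = blinfun_apply (scale_op (m - l) (resolvent D l o\<^sub>L resolvent D m)) x"
    by (simp add: blinfun_simps)
qed

end

section \<open>Continuous functions vanishing at infinity\<close>

lemma C0_continuous: "f \<in> C0 \<Longrightarrow> continuous_on UNIV f"
  and C0_tendsto: "f \<in> C0 \<Longrightarrow> (f \<longlongrightarrow> 0) at_infinity"
  by (auto simp: C0_def)

lemma C0_zero: "(\<lambda>x. 0) \<in> C0"
  by (auto simp: C0_def)

lemma C0_add: "f \<in> C0 \<Longrightarrow> g \<in> C0 \<Longrightarrow> (\<lambda>x. f x + g x) \<in> C0"
  using tendsto_add[of f 0 at_infinity g 0] by (auto simp: C0_def intro!: continuous_intros)

lemma C0_diff: "f \<in> C0 \<Longrightarrow> g \<in> C0 \<Longrightarrow> (\<lambda>x. f x - g x) \<in> C0"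
  using tendsto_diff[of f 0 at_infinity g 0] by (auto simp: C0_def intro!: continuous_intros)

lemma C0_scale: "f \<in> C0 \<Longrightarrow> (\<lambda>x. c * f x) \<in> C0"
  by (auto simp: C0_def intro!: continuous_intros tendsto_mult_right_zero)

lemma C0_cnj: "f \<in> C0 \<Longrightarrow> (\<lambda>x. cnj (f x)) \<in> C0"
  using tendsto_cnj[of f 0 at_infinity] by (auto simp: C0_def intro!: continuous_intros)

lemma C0_mult_bounded:
  assumes f: "f \<in> C0" and g: "continuous_on UNIV g" "\<And>x. cmod (g x) \<le> K"
  shows "(\<lambda>x. f x * g x) \<in> C0"
proof -
  have "((\<lambda>x. cmod (f x) * K) \<longlongrightarrow> 0) at_infinity"
    by (intro tendsto_mult_left_zero tendsto_norm_zero C0_tendsto[OF f])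
  then have "((\<lambda>x. f x * g x) \<longlongrightarrow> 0) at_infinity"
    by (rule Lim_null_comparison[rotated])
       (auto simp: norm_mult intro!: always_eventually mult_left_mono g)
  then show ?thesis using f g by (auto simp: C0_def intro!: continuous_intros)
qed

lemma C0_eventually_small:
  assumes "f \<in> C0" "e > 0"
  obtains b where "b > 0" "\<And>x. \<bar>x\<bar> \<ge> b \<Longrightarrow> cmod (f x) < e"
proof -
  have "\<forall>\<^sub>F x in at_infinity. cmod (f x) < e"
    using tendstoD[OF C0_tendsto[OF assms(1)] assms(2)] by simp
  then obtain b where "\<And>x. \<bar>x\<bar> \<ge> b \<Longrightarrow> cmod (f x) < e"
    by (auto simp: eventually_at_infinity)
  then show ?thesis using that[of "max b 1"] by simp
qed

lemma C0_bounded: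
  assumes "f \<in> C0"
  obtains K where "K > 0" "\<And>x. cmod (f x) \<le> K"
proof -
  obtain b where b: "b > 0" "\<And>x. \<bar>x\<bar> \<ge> b \<Longrightarrow> cmod (f x) < 1"
    using C0_eventually_small[OF assms, of 1] by auto
  have "compact (f ` {-b..b})"
    using C0_continuous[OF assms] continuous_on_subset by (intro compact_continuous_image) auto
  then have "bounded (f ` {-b..b})" by (rule compact_imp_bounded)
  then obtain k where k: "\<And>x. x \<in> {-b..b} \<Longrightarrow> cmod (f x) \<le> k"
    unfolding bounded_iff by blast
  have "cmod (f x) \<le> max k 1" for x
  proof (cases "\<bar>x\<bar> \<ge> b")
    case True
    then show ?thesis using b(2)[of x] by simp
  next
    case False
    then have "x \<in> {-b..b}" by auto
    then show ?thesis using k by (simp add: max.coboundedI1)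
  qed
  then show ?thesis using that[of "max k 1"] by simp
qed

lemma C0_mult: "f \<in> C0 \<Longrightarrow> g \<in> C0 \<Longrightarrow> (\<lambda>x. f x * g x) \<in> C0"
  by (rule C0_bounded[of g]) (auto intro: C0_mult_bounded C0_continuous)

lemma C0_I_bound:
  assumes "continuous_on UNIV f" "K > 0" "\<And>x. cmod (f x) * \<bar>x\<bar> \<le> K"
  shows "f \<in> C0"
proof -
  have "(f \<longlongrightarrow> 0) at_infinity"
    unfolding tendsto_iff eventually_at_infinity
  proof (intro allI impI exI)
    fix e x :: real assume e: "e > 0" "norm x \<ge> 2 * K / e"
    have "K / e > 0" using e assms(2) by simp
    then have x: "\<bar>x\<bar> > K / e" using e(2) by simp
    then have "\<bar>x\<bar> > 0" using \<open>K / e > 0\<close> by linarith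
    moreover have "e * \<bar>x\<bar> > K" using x e(1) by (simp add: field_simps)
    ultimately have "cmod (f x) * \<bar>x\<bar> < e * \<bar>x\<bar>" using assms(3)[of x] by linarith
    then show "dist (f x) 0 < e" using \<open>\<bar>x\<bar> > 0\<close> by simp
  qed
  then show ?thesis using assms by (simp add: C0_def)
qed

lemma nonreal_minus_real: "l \<notin> \<real> \<Longrightarrow> l - complex_of_real x \<noteq> 0"
  by auto

lemma C0_resolvent:
  assumes l: "l \<notin> \<real>"
  shows "(\<lambda>x. inverse (l - complex_of_real x)) \<in> C0"
proof (rule C0_I_bound)
  show "continuous_on UNIV (\<lambda>x. inverse (l - complex_of_real x))"
    using nonreal_minus_real[OF l] by (intro continuous_intros) auto
  have Im: "\<bar>Im l\<bar> > 0" using l by (simp add: complex_is_Real_iff)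
  \<comment> \<open>The constant comes from \<open>|x| \<le> |l - x| + |l|\<close> after absorbing
    \<open>|l|\<close> by means of \<open>|l - x| \<ge> |Im l|\<close>.\<close>
  then show "1 + cmod l / \<bar>Im l\<bar> > 0" by (intro add_pos_nonneg) auto
  fix x
  have a: "cmod (l - complex_of_real x) \<ge> \<bar>Im l\<bar>"
    using abs_Im_le_cmod[of "l - complex_of_real x"] by simp
  have "\<bar>x\<bar> \<le> cmod (l - complex_of_real x) + cmod l"
    using norm_triangle_ineq4[of l "l - complex_of_real x"] by simp
  also have "cmod l \<le> cmod l / \<bar>Im l\<bar> * cmod (l - complex_of_real x)"
    using a Im mult_left_mono[OF a, of "cmod l"] by (simp add: field_simps)
  finally have "\<bar>x\<bar> \<le> (1 + cmod l / \<bar>Im l\<bar>) * cmod (l - complex_of_real x)"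
    by (simp add: algebra_simps)
  moreover have "cmod (inverse (l - complex_of_real x)) * \<bar>x\<bar> = \<bar>x\<bar> / cmod (l - complex_of_real x)"
    by (simp add: norm_inverse divide_inverse)
  moreover have "cmod (l - complex_of_real x) > 0" using a Im by linarith
  ultimately show "cmod (inverse (l - complex_of_real x)) * \<bar>x\<bar> \<le> 1 + cmod l / \<bar>Im l\<bar>"
    by (simp only: pos_divide_le_eq)
qed

subsection \<open>Transport to the unit circle\<close>

definition cayley :: "real \<Rightarrow> complex" where
  "cayley x = (of_real x - \<i>) / (of_real x + \<i>)"

text \<open>On the circle without 1 the argument of \<open>Re\<close> is already real. Taking
  \<open>Re\<close> makes the function real-valued on the whole plane, where it is continuous away
  from 1.\<close>

definition inv_cayley :: "complex \<Rightarrow> real" where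
  "inv_cayley z = Re (\<i> * (1 + z) / (1 - z))"

text \<open>The point 1 of the circle corresponds to infinity on the line, so 0 is the value there
  that makes the lift of a \<open>C0\<close> function continuous.\<close>

definition lift_circle :: "(real \<Rightarrow> complex) \<Rightarrow> complex \<Rightarrow> complex" where
  "lift_circle f z = (if z = 1 then 0 else f (inv_cayley z))"

lemma real_plus_i_nonzero: "complex_of_real x + \<i> \<noteq> 0" "complex_of_real x - \<i> \<noteq> 0"
  by (auto simp: complex_eq_iff)

lemma cayley_circle: "cmod (cayley x) = 1"
proof -
  have "cmod (of_real x - \<i>) = cmod (of_real x + \<i>)"
    by (simp add: cmod_def)
  then show ?thesis using real_plus_i_nonzero[of x] by (simp add: cayley_def norm_divide)
qed

lemma cayley_eq: "cayley x = 1 + 2 * \<i> * inverse (- \<i> - complex_of_real x)"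
proof -
  have "- \<i> - complex_of_real x \<noteq> 0" using real_plus_i_nonzero(1)[of x] by (metis add.inverse_inverse minus_diff_eq diff_minus_eq_add neg_equal_0_iff_equal)
  then show ?thesis using real_plus_i_nonzero(1)[of x]
    by (simp add: cayley_def field_simps)
qed

lemma cayley_neq_1: "cayley x \<noteq> 1"
  using real_plus_i_nonzero[of x] by (simp add: cayley_def field_simps)

lemma inv_cayley_cayley [simp]: "inv_cayley (cayley x) = x"
proof -
  have "1 - cayley x = 2 * \<i> / (of_real x + \<i>)" "1 + cayley x = 2 * of_real x / (of_real x + \<i>)"
    using real_plus_i_nonzero[of x] by (simp_all add: cayley_def field_simps)
  then have "\<i> * (1 + cayley x) / (1 - cayley x) = of_real x"
    using real_plus_i_nonzero[of x] by simp
  then show ?thesis by (simp add: inv_cayley_def)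
qed

lemma lift_circle_cayley [simp]: "lift_circle f (cayley x) = f x"
  by (simp add: lift_circle_def cayley_neq_1)

lemma of_real_inv_cayley:
  assumes "cmod z = 1" "z \<noteq> 1"
  shows "complex_of_real (inv_cayley z) = \<i> * (1 + z) / (1 - z)"
proof -
  let ?w = "\<i> * (1 + z) / (1 - z)"
  have z0: "z \<noteq> 0" using assms by auto
  moreover have "cnj z = 1 / z"
    using z0 assms complex_norm_square[of z] by (simp add: eq_divide_eq mult.commute)
  ultimately have z: "z \<noteq> 0" "cnj z = 1 / z" by blast+
  have "cnj ?w = - \<i> * (1 + 1 / z) / (1 - 1 / z)"
    by (simp add: z(2))
  also have "\<dots> = - \<i> * (z + 1) / (z - 1)"
  proof -
    have "1 + 1 / z = (z + 1) / z" "1 - 1 / z = (z - 1) / z" using z(1) by (auto simp: field_simps)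
    then show ?thesis using z(1) by simp
  qed
  also have "\<dots> = ?w"
    using assms(2) by (simp add: field_simps)
  finally have "?w \<in> \<real>" by (simp add: Reals_cnj_iff)
  then show ?thesis unfolding inv_cayley_def by (rule of_real_Re)
qed

lemma continuous_on_lift_circle:
  assumes f: "f \<in> C0"
  shows "continuous_on (sphere 0 1) (lift_circle f)"
  unfolding continuous_on_eq_continuous_within
proof
  fix z :: complex assume z: "z \<in> sphere 0 1"
  show "continuous (at z within sphere 0 1) (lift_circle f)"
  proof (cases "z = 1")
    case False
    have "continuous_on (- {1}) (\<lambda>z. f (inv_cayley z))"
      unfolding inv_cayley_def
      by (intro continuous_on_compose2[OF C0_continuous[OF f]] continuous_intros) auto
    then have "continuous_on (- {1}) (lift_circle f)"
      by (rule continuous_on_eq) (auto simp: lift_circle_def)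
    then have "continuous (at z) (lift_circle f)"
      by (rule continuous_on_interior) (use False in \<open>simp add: interior_open open_Compl\<close>)
    then show ?thesis by (rule continuous_at_imp_continuous_at_within)
  next
    case True
    have "(lift_circle f \<longlongrightarrow> 0) (at 1 within sphere 0 1)"
      unfolding tendsto_iff eventually_at
    proof (intro allI impI)
      fix e :: real assume "e > 0"
      then obtain b where b: "b > 0" "\<And>x. \<bar>x\<bar> \<ge> b \<Longrightarrow> cmod (f x) < e"
        using C0_eventually_small[OF f] by metis
      \<comment> \<open>Distance below 1 keeps \<open>|1 + w|\<close> at least 1, so
        \<open>|inv_cayley w| \<ge> 1 / |1 - w|\<close>; distance below \<open>1 / b\<close> then
        pushes this beyond \<open>b\<close>.\<close>
      define d where "d = min 1 (1 / b)"
      have "dist (lift_circle f w) 0 < e" if w: "w \<in> sphere 0 1" "w \<noteq> 1" "dist w 1 < d" for w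
      proof -
        have w': "cmod w = 1" using w by simp
        have d: "cmod (1 - w) < 1" "cmod (1 - w) < 1 / b"
          using w(3) by (auto simp: d_def dist_norm norm_minus_commute)
        have "cmod (1 + w) \<ge> 2 - cmod (1 - w)"
          using norm_triangle_ineq[of "1 + w" "1 - w"] by simp
        then have "cmod (1 + w) \<ge> 1" using d by simp
        moreover have pos: "cmod (1 - w) > 0" using w(2) by simp
        moreover have "\<bar>inv_cayley w\<bar> = cmod (1 + w) / cmod (1 - w)"
          using arg_cong[OF of_real_inv_cayley[OF w' w(2)], of cmod] by (simp add: norm_divide norm_mult)
        ultimately have "\<bar>inv_cayley w\<bar> \<ge> 1 / cmod (1 - w)" by (simp add: divide_right_mono)
        moreover have "1 / cmod (1 - w) > b" using d(2) pos b(1) by (simp add: field_simps)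
        ultimately have "cmod (f (inv_cayley w)) < e" using b(2) by force
        then show ?thesis using w(2) by (simp add: lift_circle_def)
      qed
      moreover have "d > 0" using b(1) by (simp add: d_def)
      ultimately show "\<exists>d>0. \<forall>w\<in>sphere 0 1. w \<noteq> 1 \<and> dist w 1 < d \<longrightarrow> dist (lift_circle f w) 0 < e"
        by blast
    qed
    then show ?thesis
      unfolding True by (simp add: continuous_within lift_circle_def)
  qed
qed

section \<open>Polynomial approximation on the circle and induction over \<open>C0\<close>\<close>

inductive star_poly :: "(complex \<Rightarrow> complex) \<Rightarrow> bool" where
  star_poly_const: "star_poly (\<lambda>z. c)"
| star_poly_id: "star_poly (\<lambda>z. z)"
| star_poly_cnj: "star_poly cnj"
| star_poly_add: "star_poly p \<Longrightarrow> star_poly q \<Longrightarrow> star_poly (\<lambda>z. p z + q z)"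
| star_poly_mult: "star_poly p \<Longrightarrow> star_poly q \<Longrightarrow> star_poly (\<lambda>z. p z * q z)"

text \<open>A real linear functional on the plane is a combination of \<open>Re\<close> and
  \<open>Im\<close>, both polynomial in \<open>z\<close> and \<open>cnj z\<close>. This connects the
  real Stone-Weierstrass theorem with polynomials in \<open>z\<close> and
  \<open>cnj z\<close>.\<close>

lemma star_poly_real_polynomial_function:
  assumes "real_polynomial_function p"
  shows "star_poly (\<lambda>z. complex_of_real (p z))"
  using assms
proof induction
  case (linear f)
  interpret bounded_linear f by (rule linear)
  have Re: "star_poly (\<lambda>z. (1 / 2) * (z + cnj z))"
    and Im: "star_poly (\<lambda>z. (- \<i> / 2) * (z + (- 1) * cnj z))"
    by (intro star_poly.intros)+
  have lin: "f z = Re z * f 1 + Im z * f \<i>" for z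
  proof -
    have "z = Re z *\<^sub>R 1 + Im z *\<^sub>R \<i>" by (simp add: complex_eq_iff)
    then have "f z = f (Re z *\<^sub>R 1 + Im z *\<^sub>R \<i>)" by (rule arg_cong)
    then show ?thesis by (simp add: add scaleR)
  qed
  have "complex_of_real (f z) = of_real (f 1) * ((1 / 2) * (z + cnj z))
      + of_real (f \<i>) * ((- \<i> / 2) * (z + (- 1) * cnj z))" for z
    unfolding lin[of z] by (simp add: complex_eq_iff)
  then have eq: "(\<lambda>z. complex_of_real (f z)) = (\<lambda>z. of_real (f 1) * ((1 / 2) * (z + cnj z))
      + of_real (f \<i>) * ((- \<i> / 2) * (z + (- 1) * cnj z)))"
    by (rule ext)
  show ?case
    unfolding eq
    by (rule star_poly_add[OF star_poly_mult[OF star_poly_const Re] star_poly_mult[OF star_poly_const Im]])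
next
  case (add f g)
  then show ?case using star_poly_add by simp
next
  case (mult f g)
  then show ?case using star_poly_mult by simp
qed (rule star_poly_const)

lemma star_poly_dense:
  assumes "continuous_on (sphere 0 1) f" "e > 0"
  shows "\<exists>p. star_poly p \<and> (\<forall>z\<in>sphere 0 1. cmod (f z - p z) < e)"
proof -
  obtain g where g: "polynomial_function g" "\<And>z. z \<in> sphere 0 1 \<Longrightarrow> cmod (f z - g z) < e"
    using Stone_Weierstrass_polynomial_function[OF compact_sphere assms] by blast
  have "real_polynomial_function (\<lambda>z. Re (g z))" "real_polynomial_function (\<lambda>z. Im (g z))"
    using g(1) bounded_linear_Re bounded_linear_Im unfolding polynomial_function_def o_def by blast+
  then have "star_poly (\<lambda>z. of_real (Re (g z)) + \<i> * of_real (Im (g z)))"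
    by (intro star_poly_add star_poly_mult star_poly_const star_poly_real_polynomial_function)
  then have "star_poly g" by (simp add: complex_eq[symmetric])
  then show ?thesis using g(2) by blast
qed

text \<open>Stone-Weierstrass as an induction rule. A function is lifted to the circle and
  approximated there by a polynomial in \<open>z\<close> and \<open>cnj z\<close>. Along the Cayley
  transform, \<open>z - 1\<close> and \<open>cnj z - 1\<close> become multiples of the resolvent
  functions at \<open>-\<i>\<close> and \<open>\<i>\<close>, which are therefore the two base
  cases.\<close>

lemma C0_induct [consumes 1, case_names resolvent resolvent' add scale mult limit]:
  assumes f: "f \<in> C0"
    and res: "Q (\<lambda>x. inverse (\<i> - complex_of_real x))" "Q (\<lambda>x. inverse (- \<i> - complex_of_real x))"
    and add: "\<And>f g. f \<in> C0 \<Longrightarrow> g \<in> C0 \<Longrightarrow> Q f \<Longrightarrow> Q g \<Longrightarrow> Q (\<lambda>x. f x + g x)"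
    and scale: "\<And>c f. f \<in> C0 \<Longrightarrow> Q f \<Longrightarrow> Q (\<lambda>x. c * f x)"
    and mult: "\<And>f g. f \<in> C0 \<Longrightarrow> g \<in> C0 \<Longrightarrow> Q f \<Longrightarrow> Q g \<Longrightarrow> Q (\<lambda>x. f x * g x)"
    and lim: "\<And>f. f \<in> C0 \<Longrightarrow> (\<And>e. e > 0 \<Longrightarrow> \<exists>g\<in>C0. Q g \<and> (\<forall>x. cmod (f x - g x) \<le> e)) \<Longrightarrow> Q f"
  shows "Q f"
proof (rule lim[OF f])
  fix e :: real assume e: "e > 0"
  have i: "\<i> \<notin> \<real>" "- \<i> \<notin> \<real>" by (simp_all add: complex_is_Real_iff)
  have poly: "(\<lambda>x. p (cayley x) - p 1) \<in> C0 \<and> Q (\<lambda>x. p (cayley x) - p 1)" if "star_poly p" for p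
    using that
  proof induction
    case (star_poly_const c)
    \<comment> \<open>A constant leaves the zero function, which is reached as zero times a
      resolvent function.\<close>
    then show ?case using scale[OF C0_resolvent[OF i(1)] res(1), of 0] C0_zero by simp
  next
    case star_poly_id
    show ?case
      using scale[OF C0_resolvent[OF i(2)] res(2), of "2 * \<i>"] C0_scale[OF C0_resolvent[OF i(2)], of "2 * \<i>"]
      by (simp add: cayley_eq)
  next
    case star_poly_cnj
    show ?case
      using scale[OF C0_resolvent[OF i(1)] res(1), of "- 2 * \<i>"] C0_scale[OF C0_resolvent[OF i(1)], of "- 2 * \<i>"]
      by (simp add: cayley_eq)
  next
    case (star_poly_add p q)
    then show ?case using add C0_add
      by (simp add: add_diff_add)
  next
    case (star_poly_mult p q)
    let ?p = "\<lambda>x. p (cayley x) - p 1" and ?q = "\<lambda>x. q (cayley x) - q 1"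
    \<comment> \<open>Expanding around the values at 1 keeps every summand in \<open>C0\<close>; the
      factors \<open>p (cayley x)\<close> themselves need not vanish at infinity.\<close>
    have eq: "(\<lambda>x. p (cayley x) * q (cayley x) - p 1 * q 1)
        = (\<lambda>x. (?p x * ?q x + p 1 * ?q x) + q 1 * ?p x)"
      by (simp add: algebra_simps)
    show ?case
      unfolding eq using star_poly_mult.IH
      by (intro conjI add C0_add scale C0_scale mult C0_mult) auto
  qed
  \<comment> \<open>Half of \<open>e\<close> is reserved for \<open>p 1\<close>: it is small because
    the lift of \<open>f\<close> vanishes at 1, and it is subtracted to make the approximant vanish
    at infinity.\<close>
  obtain p where p: "star_poly p" "\<And>z. z \<in> sphere 0 1 \<Longrightarrow> cmod (lift_circle f z - p z) < e / 2"
    using star_poly_dense[OF continuous_on_lift_circle[OF f], of "e / 2"] e by auto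
  have "cmod (f x - (p (cayley x) - p 1)) \<le> e" for x
  proof -
    have "cmod (f x - p (cayley x)) < e / 2"
      using p(2)[of "cayley x"] by (simp add: cayley_circle)
    moreover have "cmod (p 1) < e / 2"
      using p(2)[of 1] by (simp add: lift_circle_def)
    ultimately show ?thesis
      using norm_triangle_ineq[of "f x - p (cayley x)" "p 1"] by (simp add: algebra_simps)
  qed
  then show "\<exists>g\<in>C0. Q g \<and> (\<forall>x. cmod (f x - g x) \<le> e)"
    using poly[OF p(1)] by (intro bexI[of _ "\<lambda>x. p (cayley x) - p 1"]) auto
qed

section \<open>Continuous functional calculus of a unitary operator\<close>

text \<open>Horner evaluation of the polynomial at \<open>U\<close>.\<close>

definition op_poly :: "('h::complex_hilbert_space \<Rightarrow>\<^sub>L 'h) \<Rightarrow> complex poly \<Rightarrow> ('h \<Rightarrow>\<^sub>L 'h)" where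
  "op_poly U p = fold_coeffs (\<lambda>c S. scale_op c id_blinfun + (U o\<^sub>L S)) p 0"

lemma op_poly_0 [simp]: "op_poly U 0 = 0"
  by (simp add: op_poly_def)

lemma op_poly_pCons [simp]: "op_poly U (pCons c p) = scale_op c id_blinfun + (U o\<^sub>L op_poly U p)"
  by (cases "p = 0 \<and> c = 0")
     (auto simp: op_poly_def fold_coeffs_pCons_coeff_not_0_eq fold_coeffs_pCons_not_0_0_eq)

lemma op_poly_add: "op_poly U (p + q) = op_poly U p + op_poly U q"
proof (induction p q rule: poly_induct2)
  case (pCons a p b q)
  then show ?case by (simp add: scale_op_add_left blinfun_compose_simps)
qed simp

lemma op_poly_smult:
  assumes "U \<in> bounded_ops"
  shows "op_poly U (smult c p) = scale_op c (op_poly U p)"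
  by (induction p) (simp_all add: scale_op_add scale_op_compose_right[OF assms])

lemma op_poly_mult:
  assumes "U \<in> bounded_ops"
  shows "op_poly U (p * q) = op_poly U p o\<^sub>L op_poly U q"
proof (induction p)
  case (pCons c p)
  then show ?case
    by (simp add: op_poly_add op_poly_smult[OF assms] blinfun_compose_simps scale_op_compose_left
        blinfun_compose_assoc)
qed simp

lemma op_poly_commute:
  assumes P: "P \<in> bounded_ops" "P o\<^sub>L U = U o\<^sub>L P"
  shows "P o\<^sub>L op_poly U p = op_poly U p o\<^sub>L P"
proof (induction p)
  case (pCons c p)
  have "P o\<^sub>L (U o\<^sub>L op_poly U p) = U o\<^sub>L (op_poly U p o\<^sub>L P)"
    by (metis P(2) blinfun_compose_assoc pCons.IH)
  then show ?case
    by (simp add: blinfun_compose_simps scale_op_compose_left scale_op_compose_right[OF P(1)]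
        blinfun_compose_assoc)
qed simp

lemma norm_op_poly_monom:
  assumes "\<And>x. norm (blinfun_apply U x) = norm x"
  shows "norm (blinfun_apply (op_poly U (monom 1 n)) x) = norm x"
  by (induction n) (simp_all add: monom_0 monom_Suc assms)

text \<open>Each root \<open>w\<close> splits off a factor \<open>U - w\<close>, which for an
  isometry is bounded below by the distance of \<open>|w|\<close> from 1. The bounds multiply along
  the factorisation.\<close>

lemma op_poly_bounded_below:
  assumes iso: "\<And>x. norm (blinfun_apply U x) = norm x" and U: "U \<in> bounded_ops"
    and roots: "\<And>z. cmod z = 1 \<Longrightarrow> poly p z \<noteq> 0"
  shows "\<exists>c>0. \<forall>x. c * norm x \<le> norm (blinfun_apply (op_poly U p) x)"
  using roots
proof (induction "degree p" arbitrary: p)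
  case 0
  then obtain a where a: "p = [:a:]" using degree_eq_zeroE by metis
  then have "a \<noteq> 0" using 0(2)[of 1] by simp
  then show ?case by (intro exI[of _ "cmod a"]) (simp add: a norm_scaleC)
next
  case (Suc n)
  have "\<not> constant (poly p)" using Suc.hyps(2) by (simp add: constant_degree)
  then obtain w where w: "poly p w = 0"
    using fundamental_theorem_of_algebra by blast
  then obtain q where q: "p = [:- w, 1:] * q"
    unfolding poly_eq_0_iff_dvd by (auto elim: dvdE)
  have "q \<noteq> 0" using q Suc.hyps(2) by auto
  then have "degree p = degree [:- w, 1:] + degree q"
    unfolding q by (intro degree_mult_eq) auto
  then have "n = degree q" using Suc.hyps(2) by simp
  moreover have "poly q z \<noteq> 0" if "cmod z = 1" for z
    using Suc.prems[OF that] by (auto simp: q)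
  ultimately obtain c where c: "c > 0" "\<And>x. c * norm x \<le> norm (blinfun_apply (op_poly U q) x)"
    using Suc.hyps(1)[of q] by blast
  have w1: "\<bar>1 - cmod w\<bar> > 0" using Suc.prems[of w] w by auto
  have "\<bar>1 - cmod w\<bar> * c * norm x \<le> norm (blinfun_apply (op_poly U p) x)" for x
  proof -
    define y where "y = blinfun_apply (op_poly U q) x"
    have "blinfun_apply (op_poly U p) x = blinfun_apply U y - w *\<^sub>C y"
      unfolding q op_poly_mult[OF U] by (simp add: y_def blinfun_simps)
    moreover have "norm (blinfun_apply U y - w *\<^sub>C y) \<ge> \<bar>norm (blinfun_apply U y) - norm (w *\<^sub>C y)\<bar>"
      by (rule norm_triangle_ineq3)
    moreover have "norm (blinfun_apply U y) - norm (w *\<^sub>C y) = (1 - cmod w) * norm y"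
      by (simp add: iso norm_scaleC algebra_simps)
    ultimately have "\<bar>1 - cmod w\<bar> * norm y \<le> norm (blinfun_apply (op_poly U p) x)"
      by (simp add: abs_mult)
    moreover have "\<bar>1 - cmod w\<bar> * (c * norm x) \<le> \<bar>1 - cmod w\<bar> * norm y"
      unfolding y_def by (intro mult_left_mono c) simp
    ultimately show ?thesis by (simp add: mult.assoc)
  qed
  then show ?case using w1 c(1) by (intro exI[of _ "\<bar>1 - cmod w\<bar> * c"]) auto
qed

text \<open>The graph of the polynomial functional calculus; that it is single-valued is a consequence of
  the norm estimate \<open>norm_star_graph\<close>.\<close>

inductive star_graph ::
    "('h::complex_hilbert_space \<Rightarrow>\<^sub>L 'h) \<Rightarrow> (complex \<Rightarrow> complex) \<Rightarrow> ('h \<Rightarrow>\<^sub>L 'h) \<Rightarrow> bool" for U where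
  star_graph_const: "star_graph U (\<lambda>z. c) (scale_op c id_blinfun)"
| star_graph_id: "star_graph U (\<lambda>z. z) U"
| star_graph_cnj: "star_graph U cnj (adj U)"
| star_graph_add: "star_graph U p P \<Longrightarrow> star_graph U q Q \<Longrightarrow> star_graph U (\<lambda>z. p z + q z) (P + Q)"
| star_graph_mult: "star_graph U p P \<Longrightarrow> star_graph U q Q \<Longrightarrow> star_graph U (\<lambda>z. p z * q z) (P o\<^sub>L Q)"

lemma star_poly_graph: "star_poly p \<Longrightarrow> \<exists>P. star_graph U p P"
  by (induction rule: star_poly.induct) (blast intro: star_graph.intros)+

lemma star_graph_diff:
  assumes "star_graph U p P" "star_graph U q Q"
  shows "star_graph U (\<lambda>z. p z - q z) (P - Q)"
  using star_graph_add[OF assms(1) star_graph_mult[OF star_graph_const[of U "-1"] assms(2)]]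
  by (simp add: scale_op_minus_one blinfun_compose_simps)

lemma continuous_star_graph: "star_graph U p P \<Longrightarrow> continuous_on S p"
  by (induction rule: star_graph.induct) (auto intro!: continuous_intros)

text \<open>The closure of the polynomial graph under joint limits. As a relation it admits sums and
  products at once; that the limit depends only on \<open>f\<close> is known only after the norm
  estimate for unitary \<open>U\<close>.\<close>

definition circle_calc ::
    "('h::complex_hilbert_space \<Rightarrow>\<^sub>L 'h) \<Rightarrow> (complex \<Rightarrow> complex) \<Rightarrow> ('h \<Rightarrow>\<^sub>L 'h) \<Rightarrow> bool" where
  "circle_calc U f T \<longleftrightarrow> (\<exists>p P. (\<forall>n::nat. star_graph U (p n) (P n)) \<and>
     uniform_limit (sphere 0 1) p f sequentially \<and> P \<longlonglongrightarrow> T)"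

lemma circle_calcE:
  assumes "circle_calc U f T"
  obtains p P where "\<And>n::nat. star_graph U (p n) (P n)"
    "uniform_limit (sphere 0 1) p f sequentially" "P \<longlonglongrightarrow> T"
  using assms unfolding circle_calc_def by metis

lemma circle_calcI:
  assumes "\<And>n::nat. star_graph U (p n) (P n)"
    "uniform_limit (sphere 0 1) p f sequentially" "P \<longlonglongrightarrow> T"
  shows "circle_calc U f T"
  using assms unfolding circle_calc_def by blast

lemma circle_calc_star_graph: "star_graph U p P \<Longrightarrow> circle_calc U p P"
  by (rule circle_calcI[of _ "\<lambda>_. p" "\<lambda>_. P"]) (auto intro: uniform_limit_const)

lemma circle_calc_cong:
  assumes "circle_calc U f T" "\<And>z. cmod z = 1 \<Longrightarrow> f z = g z"
  shows "circle_calc U g T"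
proof -
  obtain p P where p: "\<And>n::nat. star_graph U (p n) (P n)"
    "uniform_limit (sphere 0 1) p f sequentially" "P \<longlonglongrightarrow> T"
    using assms(1) by (rule circle_calcE) blast
  have "uniform_limit (sphere 0 1) p g sequentially \<longleftrightarrow> uniform_limit (sphere 0 1) p f sequentially"
    by (rule uniform_limit_cong') (use assms(2) in auto)
  then show ?thesis using p circle_calcI by metis
qed

lemma circle_calc_add:
  assumes "circle_calc U f S" "circle_calc U g T"
  shows "circle_calc U (\<lambda>z. f z + g z) (S + T)"
proof -
  obtain p P where p: "\<And>n::nat. star_graph U (p n) (P n)"
    "uniform_limit (sphere 0 1) p f sequentially" "P \<longlonglongrightarrow> S"
    using assms(1) by (rule circle_calcE) blast
  obtain q Q where q: "\<And>n::nat. star_graph U (q n) (Q n)"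
    "uniform_limit (sphere 0 1) q g sequentially" "Q \<longlonglongrightarrow> T"
    using assms(2) by (rule circle_calcE) blast
  show ?thesis
    by (rule circle_calcI[of _ "\<lambda>n z. p n z + q n z" "\<lambda>n. P n + Q n"])
       (intro star_graph_add uniform_limit_add tendsto_add p q)+
qed

text \<open>A product of uniform limits is a uniform limit when both limits are bounded; here this
  comes from continuity on the compact circle.\<close>

lemma circle_calc_bounded:
  assumes "circle_calc U f T"
  shows "bounded (f ` sphere 0 1)"
proof -
  obtain p P where p: "\<And>n::nat. star_graph U (p n) (P n)"
    "uniform_limit (sphere 0 1) p f sequentially"
    using assms by (rule circle_calcE) blast
  have "continuous_on (sphere 0 1) f"
    by (rule uniform_limit_theorem[OF _ p(2)])
       (auto intro!: always_eventually continuous_star_graph[OF p(1)])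
  then show ?thesis by (intro compact_imp_bounded compact_continuous_image compact_sphere)
qed

lemma circle_calc_mult:
  assumes "circle_calc U f S" "circle_calc U g T"
  shows "circle_calc U (\<lambda>z. f z * g z) (S o\<^sub>L T)"
proof -
  obtain p P where p: "\<And>n::nat. star_graph U (p n) (P n)"
    "uniform_limit (sphere 0 1) p f sequentially" "P \<longlonglongrightarrow> S"
    using assms(1) by (rule circle_calcE) blast
  obtain q Q where q: "\<And>n::nat. star_graph U (q n) (Q n)"
    "uniform_limit (sphere 0 1) q g sequentially" "Q \<longlonglongrightarrow> T"
    using assms(2) by (rule circle_calcE) blast
  show ?thesis
    by (rule circle_calcI[of _ "\<lambda>n z. p n z * q n z" "\<lambda>n. P n o\<^sub>L Q n"])
       (intro star_graph_mult uniform_lim_mult tendsto_blinfun_compose p q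
          circle_calc_bounded[OF assms(1)] circle_calc_bounded[OF assms(2)])+
qed

lemma circle_calc_scale:
  "circle_calc U f T \<Longrightarrow> circle_calc U (\<lambda>z. c * f z) (scale_op c T)"
  using circle_calc_mult[OF circle_calc_star_graph[OF star_graph_const[of U c]]]
  by (force simp: scale_op_compose_left)

lemma circle_calc_diff:
  "circle_calc U f S \<Longrightarrow> circle_calc U g T \<Longrightarrow> circle_calc U (\<lambda>z. f z - g z) (S - T)"
  using circle_calc_add[of U f S "\<lambda>z. -1 * g z" "- T"] circle_calc_scale[of U g T "-1"]
  by (simp add: scale_op_minus_one)

locale unitary_operator =
  fixes U :: "'h::complex_hilbert_space \<Rightarrow>\<^sub>L 'h"
  assumes unitary: "unitary_op U"
begin

lemma U_bounded: "U \<in> bounded_ops"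
  and adj_U_U: "adj U o\<^sub>L U = id_blinfun"
  and U_adj_U: "U o\<^sub>L adj U = id_blinfun"
  using unitary by (auto simp: unitary_op_def)

lemma norm_U: "norm (blinfun_apply U x) = norm x"
proof -
  have "(norm (blinfun_apply U x))\<^sup>2 = (norm x)\<^sup>2"
    using power2_norm_apply_eq[OF U_bounded, of x] by (simp add: adj_U_U power2_norm_eq_cinner)
  then show ?thesis by simp
qed

lemma star_graph_bounded_ops: "star_graph U p P \<Longrightarrow> P \<in> bounded_ops"
  by (induction rule: star_graph.induct)
     (auto intro: bounded_ops_intros adj_bounded_ops U_bounded)

lemma star_graph_commute: "star_graph U p P \<Longrightarrow> P o\<^sub>L U = U o\<^sub>L P"
proof (induction rule: star_graph.induct)
  case (star_graph_const c)
  then show ?case by (simp add: scale_op_compose_left scale_op_compose_right[OF U_bounded])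
next
  case (star_graph_mult p P q Q)
  then show ?case by (metis blinfun_compose_assoc)
qed (simp_all add: adj_U_U U_adj_U blinfun_compose_simps)

lemma star_graph_adj: "star_graph U p P \<Longrightarrow> star_graph U (\<lambda>z. cnj (p z)) (adj P)"
proof (induction rule: star_graph.induct)
  case (star_graph_const c)
  then show ?case using star_graph.star_graph_const[of U "cnj c"] by (simp add: adj_scale bounded_ops_id)
next
  case star_graph_id
  then show ?case by (rule star_graph.star_graph_cnj)
next
  case star_graph_cnj
  then show ?case using star_graph.star_graph_id[of U] by (simp add: adj_adj U_bounded)
next
  case (star_graph_add p P q Q)
  then show ?case
    using star_graph.star_graph_add[OF star_graph_add.IH] by (simp add: adj_add star_graph_bounded_ops)
next
  case (star_graph_mult p P q Q)
  then show ?case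
    using star_graph.star_graph_mult[OF star_graph_mult.IH(2,1)]
    by (simp add: adj_compose star_graph_bounded_ops mult.commute)
qed

text \<open>On the circle \<open>cnj z\<close> is the inverse of \<open>z\<close>, so a high enough
  power of \<open>z\<close> clears all conjugates, and \<open>U o adj U = id\<close> does the same
  for operators. Multiplying by a power of \<open>U\<close> preserves norms of vectors, so lower
  bounds may be read off from the ordinary polynomial \<open>q\<close>.\<close>

lemma star_graph_polynomial:
  assumes "star_graph U p P"
  shows "\<exists>n q. (\<forall>z. cmod z = 1 \<longrightarrow> z ^ n * p z = poly q z) \<and>
    op_poly U (monom 1 n) o\<^sub>L P = op_poly U q"
  using assms
proof (induction rule: star_graph.induct)
  case (star_graph_const c)
  show ?case by (intro exI[of _ 0] exI[of _ "[:c:]"]) (simp add: monom_0)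
next
  case star_graph_id
  show ?case by (intro exI[of _ 0] exI[of _ "[:0, 1:]"]) (simp add: monom_0)
next
  case star_graph_cnj
  show ?case
    by (intro exI[of _ 1] exI[of _ 1])
       (auto simp: monom_Suc monom_0 U_adj_U one_pCons complex_norm_square[symmetric])
next
  case (star_graph_add p P q Q)
  obtain n r where r: "\<And>z. cmod z = 1 \<Longrightarrow> z ^ n * p z = poly r z"
    "op_poly U (monom 1 n) o\<^sub>L P = op_poly U r"
    using star_graph_add.IH(1) by blast
  obtain m s where s: "\<And>z. cmod z = 1 \<Longrightarrow> z ^ m * q z = poly s z"
    "op_poly U (monom 1 m) o\<^sub>L Q = op_poly U s"
    using star_graph_add.IH(2) by blast
  have nm: "op_poly U (monom 1 (n + m)) = op_poly U (monom 1 m) o\<^sub>L op_poly U (monom 1 n)"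
    "op_poly U (monom 1 (n + m)) = op_poly U (monom 1 n) o\<^sub>L op_poly U (monom 1 m)"
    unfolding op_poly_mult[OF U_bounded, symmetric] mult_monom by (simp_all add: add.commute)
  have "op_poly U (monom 1 (n + m)) o\<^sub>L (P + Q) = op_poly U (monom 1 m * r + monom 1 n * s)"
    unfolding op_poly_add op_poly_mult[OF U_bounded] r(2)[symmetric] s(2)[symmetric]
      blinfun_compose_simps blinfun_compose_assoc[symmetric] nm(1)[symmetric] nm(2)[symmetric] ..
  moreover have "z ^ (n + m) * (p z + q z) = poly (monom 1 m * r + monom 1 n * s) z" if "cmod z = 1" for z
    using r(1)[OF that] s(1)[OF that] by (simp add: poly_monom power_add algebra_simps flip: r(1) s(1))
  ultimately show ?case by blast
next
  case (star_graph_mult p P q Q)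
  obtain n r where r: "\<And>z. cmod z = 1 \<Longrightarrow> z ^ n * p z = poly r z"
    "op_poly U (monom 1 n) o\<^sub>L P = op_poly U r"
    using star_graph_mult.IH(1) by blast
  obtain m s where s: "\<And>z. cmod z = 1 \<Longrightarrow> z ^ m * q z = poly s z"
    "op_poly U (monom 1 m) o\<^sub>L Q = op_poly U s"
    using star_graph_mult.IH(2) by blast
  \<comment> \<open>To collect the powers in front, \<open>U^m\<close> has to be moved past
    \<open>P\<close>.\<close>
  have comm: "P o\<^sub>L op_poly U (monom 1 m) = op_poly U (monom 1 m) o\<^sub>L P"
    by (rule op_poly_commute[OF star_graph_bounded_ops star_graph_commute]) (rule star_graph_mult)+
  have "op_poly U (monom 1 (n + m)) = op_poly U (monom 1 n) o\<^sub>L op_poly U (monom 1 m)"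
    unfolding op_poly_mult[OF U_bounded, symmetric] mult_monom by simp
  then have "op_poly U (monom 1 (n + m)) o\<^sub>L (P o\<^sub>L Q)
      = op_poly U (monom 1 n) o\<^sub>L ((op_poly U (monom 1 m) o\<^sub>L P) o\<^sub>L Q)"
    by (simp add: blinfun_compose_assoc)
  also have "\<dots> = (op_poly U (monom 1 n) o\<^sub>L P) o\<^sub>L (op_poly U (monom 1 m) o\<^sub>L Q)"
    unfolding comm[symmetric] by (simp add: blinfun_compose_assoc)
  also have "\<dots> = op_poly U (r * s)"
    unfolding r(2) s(2) op_poly_mult[OF U_bounded] ..
  finally have "op_poly U (monom 1 (n + m)) o\<^sub>L (P o\<^sub>L Q) = op_poly U (r * s)" .
  moreover have "z ^ (n + m) * (p z * q z) = poly (r * s) z" if "cmod z = 1" for z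
    unfolding poly_mult r(1)[OF that, symmetric] s(1)[OF that, symmetric]
    by (simp add: power_add mult_ac)
  ultimately show ?case by blast
qed

text \<open>If \<open>\<parallel>P\<parallel>\<^sup>2 - |p|\<^sup>2\<close> had no zero on the circle, then \<open>\<parallel>P\<parallel>\<^sup>2 - P\<^sup>* P\<close>
  would be bounded below, being a product of factors \<open>U - w\<close> with \<open>|w| \<noteq> 1\<close>; but it is not,
  because the norm of \<open>P\<close> is approximated on unit vectors.\<close>

lemma norm_star_graph:
  assumes p: "star_graph U p P"
  shows "\<exists>z. cmod z = 1 \<and> norm P \<le> cmod (p z)"
proof (cases "norm P = 0")
  case True
  then show ?thesis by (intro exI[of _ 1]) simp
next
  case False
  define M where "M = (norm P)\<^sup>2"
  have M: "M > 0" using False by (simp add: M_def)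
  have P: "P \<in> bounded_ops" by (rule star_graph_bounded_ops[OF p])
  define K where "K = (adj P o\<^sub>L P) - scale_op (of_real M) id_blinfun"
  have "star_graph U (\<lambda>z. cnj (p z) * p z - of_real M) K"
    unfolding K_def by (intro star_graph_diff star_graph_mult star_graph_adj p star_graph_const)
  then obtain n q where q: "\<And>z. cmod z = 1 \<Longrightarrow> z ^ n * (cnj (p z) * p z - of_real M) = poly q z"
    "op_poly U (monom 1 n) o\<^sub>L K = op_poly U q"
    using star_graph_polynomial by blast
  have normK: "norm (blinfun_apply (op_poly U q) x) = norm (blinfun_apply K x)" for x
    unfolding q(2)[symmetric] using norm_op_poly_monom[OF norm_U] by simp
  \<comment> \<open>In the expansion of the square of \<open>P* P x - M x\<close> the cross term is
    \<open>-2 M |P x|^2\<close>, and \<open>|P* P x|^2\<close> is at most \<open>M |P x|^2\<close>.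
    Thus \<open>K\<close> is small on unit vectors where \<open>P\<close> nearly attains its
    norm.\<close>
  have K: "(norm (blinfun_apply K x))\<^sup>2 \<le> M * (M * (norm x)\<^sup>2 - (norm (blinfun_apply P x))\<^sup>2)" for x
  proof -
    let ?y = "blinfun_apply (adj P) (blinfun_apply P x)"
    have Kx: "blinfun_apply K x = ?y - of_real M *\<^sub>C x" by (simp add: K_def blinfun_simps)
    have "Re (cinner ?y (of_real M *\<^sub>C x)) = M * (norm (blinfun_apply P x))\<^sup>2"
      using M by (simp add: cinner_simps cinner_adj'[OF P, symmetric] cinner_self)
    moreover have "norm ?y \<le> norm P * norm (blinfun_apply P x)"
      using norm_blinfun[of "adj P"] norm_adj_le[OF P] by (meson mult_right_mono norm_ge_zero order_trans)
    then have "(norm ?y)\<^sup>2 \<le> (norm P * norm (blinfun_apply P x))\<^sup>2"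
      by (rule power_mono) simp
    then have "(norm ?y)\<^sup>2 \<le> M * (norm (blinfun_apply P x))\<^sup>2"
      by (simp add: M_def power_mult_distrib)
    moreover have "(norm (of_real M *\<^sub>C x))\<^sup>2 = M * (M * (norm x)\<^sup>2)"
      by (simp add: norm_scaleC power_mult_distrib power2_eq_square)
    ultimately show ?thesis
      unfolding Kx power2_norm_diff by (simp add: algebra_simps)
  qed
  have "\<exists>z. cmod z = 1 \<and> poly q z = 0"
  proof (rule ccontr)
    assume "\<not> (\<exists>z. cmod z = 1 \<and> poly q z = 0)"
    then obtain c where c: "c > 0" "\<And>x. c * norm x \<le> norm (blinfun_apply K x)"
      using op_poly_bounded_below[OF norm_U U_bounded, of q] unfolding normK by blast
    \<comment> \<open>What the lower bound \<open>c\<close> for \<open>K\<close> leaves as a bound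
      for \<open>|P x|^2\<close> on unit vectors; it lies strictly below \<open>M\<close>, the
      squared norm of \<open>P\<close>.\<close>
    define d where "d = M - c\<^sup>2 / M"
    have bound: "(norm (blinfun_apply P x))\<^sup>2 \<le> d * (norm x)\<^sup>2" for x
    proof -
      have "(c * norm x)\<^sup>2 \<le> (norm (blinfun_apply K x))\<^sup>2"
        using c by (intro power_mono) auto
      then have "c\<^sup>2 * (norm x)\<^sup>2 \<le> M * (M * (norm x)\<^sup>2 - (norm (blinfun_apply P x))\<^sup>2)"
        using K[of x] by (simp add: power_mult_distrib)
      then show ?thesis using M by (simp add: d_def field_simps)
    qed
    \<comment> \<open>A negative \<open>d\<close> would force \<open>P = 0\<close>, which this case
      excludes; the sign is used for \<open>sqrt d\<close>.\<close>
    have "d \<ge> 0"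
    proof (rule ccontr)
      assume "\<not> d \<ge> 0"
      then have "blinfun_apply P x = 0" for x
      proof -
        have "d * (norm x)\<^sup>2 \<le> 0" using \<open>\<not> d \<ge> 0\<close> by (simp add: mult_nonpos_nonneg)
        then have "(norm (blinfun_apply P x))\<^sup>2 \<le> 0" using bound[of x] by linarith
        then show ?thesis by simp
      qed
      then have "P = 0" by (intro blinfun_eqI) simp
      then show False using False by simp
    qed
    have "norm P \<le> sqrt d"
    proof (rule norm_blinfun_bound)
      fix x
      have "norm (blinfun_apply P x) \<le> sqrt (d * (norm x)\<^sup>2)"
        by (rule real_le_rsqrt) (rule bound)
      then show "norm (blinfun_apply P x) \<le> sqrt d * norm x" by (simp add: real_sqrt_mult)
    qed (use \<open>d \<ge> 0\<close> in simp)
    then have "M \<le> (sqrt d)\<^sup>2" unfolding M_def by (rule power_mono) simp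
    then have "M \<le> d" using \<open>d \<ge> 0\<close> by simp
    moreover have "c\<^sup>2 / M > 0" using c(1) M by simp
    ultimately show False by (simp add: d_def)
  qed
  then obtain z where z: "cmod z = 1" "poly q z = 0" by blast
  then have "z ^ n * (cnj (p z) * p z - of_real M) = 0" using q(1) by simp
  moreover have "z \<noteq> 0" using z(1) by auto
  ultimately have "cnj (p z) * p z = of_real M" by simp
  then have "complex_of_real ((cmod (p z))\<^sup>2) = of_real M"
    unfolding complex_norm_square by (simp add: mult.commute)
  then have "(norm P)\<^sup>2 = (cmod (p z))\<^sup>2" unfolding of_real_eq_iff M_def by simp
  then have "norm P \<le> cmod (p z)" by simp
  with z show ?thesis by blast
qed

lemma norm_circle_calc:
  assumes T: "circle_calc U f T" and c: "\<And>z. cmod z = 1 \<Longrightarrow> cmod (f z) \<le> c"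
  shows "norm T \<le> c"
proof -
  obtain p P where p: "\<And>n::nat. star_graph U (p n) (P n)"
    "uniform_limit (sphere 0 1) p f sequentially" "P \<longlonglongrightarrow> T"
    using T by (rule circle_calcE) blast
  have "norm T \<le> c + e" if e: "e > 0" for e
  proof -
    have "\<forall>\<^sub>F n in sequentially. \<forall>z\<in>sphere 0 1. dist (p n z) (f z) < e"
      using uniform_limitD[OF p(2) e] .
    then have "\<forall>\<^sub>F n in sequentially. norm (P n) \<le> c + e"
    proof eventually_elim
      case (elim n)
      obtain z where z: "cmod z = 1" "norm (P n) \<le> cmod (p n z)"
        using norm_star_graph[OF p(1)] by blast
      have "cmod (p n z) \<le> cmod (f z) + cmod (p n z - f z)"
        using norm_triangle_sub by blast
      moreover have "cmod (p n z - f z) < e" using elim z(1) by (simp add: dist_norm)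
      ultimately show ?case using z(2) c[OF z(1)] by linarith
    qed
    then show ?thesis
      by (rule tendsto_upperbound[OF tendsto_norm[OF p(3)]]) simp
  qed
  then show ?thesis by (rule field_le_epsilon)
qed

lemma circle_calc_unique:
  assumes "circle_calc U f S" "circle_calc U f T"
  shows "S = T"
proof -
  have "norm (S - T) \<le> 0"
    by (rule norm_circle_calc[OF circle_calc_diff[OF assms]]) simp
  then show ?thesis by simp
qed

lemma circle_calc_bounded_ops:
  assumes "circle_calc U f T"
  shows "T \<in> bounded_ops"
proof -
  obtain p P where p: "\<And>n::nat. star_graph U (p n) (P n)" "P \<longlonglongrightarrow> T"
    using assms by (rule circle_calcE) blast
  show ?thesis
    by (rule closed_sequentially[OF closed_bounded_ops star_graph_bounded_ops p(2)]) (rule p(1))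
qed

lemma circle_calc_cnj:
  assumes "circle_calc U f T"
  shows "circle_calc U (\<lambda>z. cnj (f z)) (adj T)"
proof -
  obtain p P where p: "\<And>n::nat. star_graph U (p n) (P n)"
    "uniform_limit (sphere 0 1) p f sequentially" "P \<longlonglongrightarrow> T"
    using assms(1) by (rule circle_calcE) blast
  have "uniform_limit (sphere 0 1) (\<lambda>n z. cnj (p n z)) (\<lambda>z. cnj (f z)) sequentially"
    by (rule bounded_linear.uniform_limit[OF bounded_linear_cnj p(2)])
  then show ?thesis
    by (rule circle_calcI[of _ "\<lambda>n z. cnj (p n z)" "\<lambda>n. adj (P n)", rotated])
       (intro star_graph_adj tendsto_adj p star_graph_bounded_ops[OF p(1)]
          circle_calc_bounded_ops[OF assms])+
qed

text \<open>The norm estimate, applied to differences, turns uniform convergence of the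
  approximating polynomials into the Cauchy property of their operators.\<close>

lemma circle_calc_exists:
  assumes f: "continuous_on (sphere 0 1) f"
  shows "\<exists>T. circle_calc U f T"
proof -
  have "\<exists>p P. star_graph U p P \<and> (\<forall>z. cmod z = 1 \<longrightarrow> cmod (f z - p z) < inverse (Suc n))" for n
  proof -
    obtain p where "star_poly p" "\<And>z. z \<in> sphere 0 1 \<Longrightarrow> cmod (f z - p z) < inverse (Suc n)"
      using star_poly_dense[OF f, of "inverse (Suc n)"] by auto
    moreover from this obtain P where "star_graph U p P" using star_poly_graph by blast
    ultimately show ?thesis by auto
  qed
  then obtain p P where p: "\<And>n::nat. star_graph U (p n) (P n)"
    "\<And>n z. cmod z = 1 \<Longrightarrow> cmod (f z - p n z) < inverse (Suc n)"
    by metis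
  have small: "\<exists>k. \<forall>n\<ge>k. inverse (Suc n) < e" if e: "e > 0" for e :: real
  proof -
    obtain k where k: "inverse (Suc k) < e" using reals_Archimedean[OF e] by auto
    have "inverse (Suc n) < e" if "n \<ge> k" for n
      by (rule order_le_less_trans[OF _ k]) (use that in \<open>simp add: field_simps\<close>)
    then show ?thesis by blast
  qed
  have lim: "uniform_limit (sphere 0 1) p f sequentially"
    unfolding uniform_limit_iff eventually_sequentially
  proof (intro allI impI)
    fix e :: real assume "e > 0"
    then obtain k where k: "\<And>n. n \<ge> k \<Longrightarrow> inverse (Suc n) < e" using small by blast
    have "dist (p n z) (f z) < e" if "n \<ge> k" "z \<in> sphere 0 1" for n z
      using p(2)[of z n] k[OF that(1)] that(2) by (simp add: dist_norm norm_minus_commute)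
    then show "\<exists>N. \<forall>n\<ge>N. \<forall>x\<in>sphere 0 1. dist (p n x) (f x) < e" by blast
  qed
  have "Cauchy P"
  proof (rule metric_CauchyI)
    fix e :: real assume "e > 0"
    then obtain k where k: "\<And>n. n \<ge> k \<Longrightarrow> inverse (Suc n) < e / 2" using small[of "e / 2"] by auto
    have "dist (P m) (P n) < e" if "m \<ge> k" "n \<ge> k" for m n
    proof -
      obtain z where z: "cmod z = 1" "norm (P m - P n) \<le> cmod (p m z - p n z)"
        using norm_star_graph[OF star_graph_diff[OF p(1) p(1)]] by blast
      have "cmod (p m z - p n z) \<le> cmod (f z - p n z) + cmod (f z - p m z)"
        using norm_triangle_ineq4[of "f z - p n z" "f z - p m z"] by simp
      then show ?thesis
        using z p(2)[OF z(1), of m] p(2)[OF z(1), of n] k[OF that(1)] k[OF that(2)]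
        by (simp add: dist_norm)
    qed
    then show "\<exists>K. \<forall>m\<ge>K. \<forall>n\<ge>K. dist (P m) (P n) < e" by blast
  qed
  then obtain T where "P \<longlonglongrightarrow> T"
    unfolding Cauchy_convergent_iff convergent_def by blast
  then show ?thesis using circle_calcI[OF p(1) lim] by blast
qed

end

section \<open>Functional calculus of a self-adjoint operator\<close>

lemma C0_calculusD:
  assumes "is_C0_calculus T \<Phi>"
  shows "\<And>f. f \<in> C0 \<Longrightarrow> \<Phi> f \<in> bounded_ops"
    "\<And>f g. f \<in> C0 \<Longrightarrow> g \<in> C0 \<Longrightarrow> \<Phi> (\<lambda>x. f x + g x) = \<Phi> f + \<Phi> g"
    "\<And>c f. f \<in> C0 \<Longrightarrow> \<Phi> (\<lambda>x. c * f x) = scale_op c (\<Phi> f)"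
    "\<And>f g. f \<in> C0 \<Longrightarrow> g \<in> C0 \<Longrightarrow> \<Phi> (\<lambda>x. f x * g x) = \<Phi> f o\<^sub>L \<Phi> g"
    "\<And>f. f \<in> C0 \<Longrightarrow> \<Phi> (\<lambda>x. cnj (f x)) = adj (\<Phi> f)"
    "\<And>l. l \<notin> \<real> \<Longrightarrow> \<Phi> (\<lambda>x. inverse (l - complex_of_real x)) = resolvent T l"
  using assms by (auto simp: is_C0_calculus_def)

lemma C0_calculus_diff:
  assumes \<Phi>: "is_C0_calculus T \<Phi>" and "f \<in> C0" "g \<in> C0"
  shows "\<Phi> (\<lambda>x. f x - g x) = \<Phi> f - \<Phi> g"
  using C0_calculusD(2)[OF \<Phi> assms(2) C0_scale[OF assms(3), of "-1"]] C0_calculusD(3)[OF \<Phi> assms(3), of "-1"]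
  by (simp add: scale_op_minus_one)

text \<open>The function \<open>h = c - sqrt (c\<^sup>2 - |f|\<^sup>2)\<close> belongs to \<open>C\<^sub>0\<close> and satisfies
  \<open>c\<^sup>2 - |f|\<^sup>2 = (c - h)\<^sup>2\<close>, which exhibits \<open>c\<^sup>2 - \<Phi>(f)\<^sup>* \<Phi>(f)\<close> as a square.\<close>

lemma norm_C0_calculus_le:
  assumes \<Phi>: "is_C0_calculus T \<Phi>" and f: "f \<in> C0" and c: "\<And>x. cmod (f x) \<le> c"
  shows "norm (\<Phi> f) \<le> c"
proof -
  have c0: "c \<ge> 0" using c[of 0] norm_ge_zero[of "f 0"] by linarith
  define h where "h x = complex_of_real (c - sqrt (c\<^sup>2 - (cmod (f x))\<^sup>2))" for x
  have "(h \<longlongrightarrow> complex_of_real (c - sqrt (c\<^sup>2 - (cmod 0)\<^sup>2))) at_infinity"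
    unfolding h_def by (intro tendsto_intros C0_tendsto[OF f])
  then have h: "h \<in> C0"
    using c0 C0_continuous[OF f] by (auto simp: C0_def h_def intro!: continuous_intros)
  have le: "(cmod (f x))\<^sup>2 \<le> c\<^sup>2" for x using c[of x] by (intro power_mono) auto
  have id: "cnj (f x) * f x = 2 * of_real c * h x - h x * h x" for x
  proof -
    let ?s = "sqrt (c\<^sup>2 - (cmod (f x))\<^sup>2)"
    have "?s * ?s = c\<^sup>2 - (cmod (f x))\<^sup>2" using le[of x] by simp
    then have "(cmod (f x))\<^sup>2 = 2 * c * (c - ?s) - (c - ?s) * (c - ?s)"
      by (simp add: algebra_simps power2_eq_square)
    then have "complex_of_real ((cmod (f x))\<^sup>2) = complex_of_real (2 * c * (c - ?s) - (c - ?s) * (c - ?s))"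
      by (rule arg_cong)
    then show ?thesis unfolding h_def complex_norm_square by (simp add: mult.commute)
  qed
  define H where "H = \<Phi> h"
  have H: "H \<in> bounded_ops" unfolding H_def by (rule C0_calculusD(1)[OF \<Phi> h])
  have "(\<lambda>x. cnj (h x)) = h" by (simp add: h_def fun_eq_iff)
  then have H_adj: "adj H = H" using C0_calculusD(5)[OF \<Phi> h] by (simp add: H_def)
  have "adj (\<Phi> f) o\<^sub>L \<Phi> f = \<Phi> (\<lambda>x. cnj (f x) * f x)"
    by (simp add: C0_calculusD(4,5)[OF \<Phi>] f C0_cnj)
  also have "\<dots> = scale_op (2 * of_real c) H - (H o\<^sub>L H)"
    unfolding id H_def
    by (simp add: C0_calculus_diff[OF \<Phi>] C0_calculusD(3,4)[OF \<Phi>] h C0_scale C0_mult)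
  finally have ff: "adj (\<Phi> f) o\<^sub>L \<Phi> f = scale_op (2 * of_real c) H - (H o\<^sub>L H)" .
  show ?thesis
  proof (rule norm_blinfun_bound[OF c0])
    fix x
    let ?y = "blinfun_apply H x"
    have "Re (cinner ?y x) = Re (cinner x ?y)"
      by (metis cinner_commute cnj.simps(1))
    moreover have "cinner x (blinfun_apply H ?y) = cinner ?y ?y"
      using cinner_adj'[OF H, of x ?y] by (simp add: H_adj)
    \<comment> \<open>This is the square \<open>(c - H)^2\<close> evaluated at \<open>x\<close>,
      with \<open>H\<close> self-adjoint. Constants are not in \<open>C0\<close>, so the square is
      completed on vectors and not inside the calculus.\<close>
    ultimately have "(norm (blinfun_apply (\<Phi> f) x))\<^sup>2 = (c * norm x)\<^sup>2 - (norm (of_real c *\<^sub>C x - ?y))\<^sup>2"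
      unfolding power2_norm_apply_eq[OF C0_calculusD(1)[OF \<Phi> f]] ff power2_norm_diff
      by (simp add: blinfun_simps cinner_simps norm_scaleC c0 cinner_self)
    then have "(norm (blinfun_apply (\<Phi> f) x))\<^sup>2 \<le> (c * norm x)\<^sup>2" by simp
    then show "norm (blinfun_apply (\<Phi> f) x) \<le> c * norm x"
      by (rule power2_le_imp_le) (simp add: c0)
  qed
qed

lemma norm_C0_calculus_diff_le:
  assumes \<Phi>: "is_C0_calculus T \<Phi>" and "f \<in> C0" "g \<in> C0" and "\<And>x. cmod (f x - g x) \<le> c"
  shows "norm (\<Phi> f - \<Phi> g) \<le> c"
  unfolding C0_calculus_diff[OF \<Phi> assms(2,3), symmetric]
  by (rule norm_C0_calculus_le[OF \<Phi> C0_diff[OF assms(2,3)]]) (rule assms(4))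

lemma nonreal_i: "\<i> \<notin> \<real>" "- \<i> \<notin> \<real>"
  by (simp_all add: complex_is_Real_iff)

text \<open>The two resolvents fix both calculi on a dense set of functions; the limit case is
  closed by the automatic contractivity.\<close>

lemma C0_calculus_unique:
  assumes \<Phi>: "is_C0_calculus T \<Phi>" and \<Psi>: "is_C0_calculus T \<Psi>" and f: "f \<in> C0"
  shows "\<Phi> f = \<Psi> f"
  using f
proof (induction rule: C0_induct)
  case resolvent
  then show ?case using C0_calculusD(6)[OF \<Phi> nonreal_i(1)] C0_calculusD(6)[OF \<Psi> nonreal_i(1)] by simp
next
  case resolvent'
  then show ?case using C0_calculusD(6)[OF \<Phi> nonreal_i(2)] C0_calculusD(6)[OF \<Psi> nonreal_i(2)] by simp
next
  case (limit f)
  have "norm (\<Phi> f - \<Psi> f) \<le> 0 + e" if e: "e > 0" for e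
  proof -
    have "e / 2 > 0" using e by simp
    then obtain g where g: "g \<in> C0" "\<Phi> g = \<Psi> g" "\<And>x. cmod (f x - g x) \<le> e / 2"
      using limit(2) by blast
    have "norm (\<Phi> f - \<Phi> g) \<le> e / 2" "norm (\<Psi> f - \<Psi> g) \<le> e / 2"
      by (rule norm_C0_calculus_diff_le[OF \<Phi> limit(1) g(1,3)])
         (rule norm_C0_calculus_diff_le[OF \<Psi> limit(1) g(1,3)])
    moreover have "\<Phi> f - \<Psi> f = (\<Phi> f - \<Phi> g) - (\<Psi> f - \<Psi> g)" by (simp add: g(2))
    ultimately show ?thesis
      using norm_triangle_ineq4[of "\<Phi> f - \<Phi> g" "\<Psi> f - \<Psi> g"] by simp
  qed
  then have "norm (\<Phi> f - \<Psi> f) \<le> 0" by (rule field_le_epsilon)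
  then show ?case by simp
qed (simp_all add: C0_calculusD(2-4)[OF \<Phi>] C0_calculusD(2-4)[OF \<Psi>])

context self_adjoint_operator
begin

text \<open>This is \<open>(D - \<i>) (D + \<i>)^{-1}\<close>, written through the resolvent as in
  \<open>cayley_eq\<close> to obtain a bounded operator directly.\<close>

definition cayley_op :: "'h \<Rightarrow>\<^sub>L 'h" where
  "cayley_op = id_blinfun + scale_op (2 * \<i>) (resolvent D (- \<i>))"

lemma unitary_cayley_op: "unitary_op cayley_op"
proof -
  let ?P = "resolvent D \<i>" and ?Q = "resolvent D (- \<i>)"
  have P: "?P \<in> bounded_ops" and Q: "?Q \<in> bounded_ops"
    by (intro resolvent_bounded_ops nonreal_i)+
  have adj: "adj cayley_op = id_blinfun - scale_op (2 * \<i>) ?P"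
    unfolding cayley_op_def using adj_resolvent[OF nonreal_i(2)]
    by (auto simp: adj_add adj_scale Q bounded_ops_intros blinfun_simps intro!: blinfun_eqI)
  have PQ: "blinfun_apply ?P x = blinfun_apply ?Q x - (2 * \<i>) *\<^sub>C blinfun_apply ?P (blinfun_apply ?Q x)" for x
    using arg_cong[OF resolvent_identity[OF nonreal_i], of "\<lambda>T. blinfun_apply T x"]
    by (simp add: blinfun_simps algebra_simps)
  have QP: "blinfun_apply ?Q x = blinfun_apply ?P x + (2 * \<i>) *\<^sub>C blinfun_apply ?Q (blinfun_apply ?P x)" for x
    using arg_cong[OF resolvent_identity[OF nonreal_i(2,1)], of "\<lambda>T. blinfun_apply T x"]
    by (simp add: blinfun_simps algebra_simps)
  have "blinfun_apply (adj cayley_op o\<^sub>L cayley_op) x = x" for x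
  proof -
    define u where "u = blinfun_apply ?Q x"
    define v where "v = blinfun_apply ?P u"
    have "blinfun_apply ?P x = u - (2 * \<i>) *\<^sub>C v" using PQ[of x] by (simp add: u_def v_def)
    then show ?thesis
      unfolding adj unfolding cayley_op_def
      by (simp add: blinfun_simps bounded_opsD[OF P] flip: u_def v_def) (simp add: algebra_simps)
  qed
  moreover have "blinfun_apply (cayley_op o\<^sub>L adj cayley_op) x = x" for x
  proof -
    define u where "u = blinfun_apply ?P x"
    define v where "v = blinfun_apply ?Q u"
    have "blinfun_apply ?Q x = u + (2 * \<i>) *\<^sub>C v" using QP[of x] by (simp add: u_def v_def)
    then show ?thesis
      unfolding adj unfolding cayley_op_def
      by (simp add: blinfun_simps bounded_opsD[OF Q] flip: u_def v_def) (simp add: algebra_simps)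
  qed
  moreover have "cayley_op \<in> bounded_ops"
    unfolding cayley_op_def by (intro bounded_ops_intros Q)
  ultimately show ?thesis
    by (auto simp: unitary_op_def intro!: blinfun_eqI)
qed

sublocale cayley: unitary_operator cayley_op
  by standard (rule unitary_cayley_op)

definition C0_calc :: "(real \<Rightarrow> complex) \<Rightarrow> ('h \<Rightarrow>\<^sub>L 'h)" where
  "C0_calc f = (THE T. circle_calc cayley_op (lift_circle f) T)"

lemma C0_calc_eqI: "circle_calc cayley_op (lift_circle f) T \<Longrightarrow> C0_calc f = T"
  unfolding C0_calc_def by (rule the_equality) (auto intro: cayley.circle_calc_unique)

lemma circle_calc_C0_calc:
  assumes "f \<in> C0"
  shows "circle_calc cayley_op (lift_circle f) (C0_calc f)"
  using cayley.circle_calc_exists[OF continuous_on_lift_circle[OF assms]] C0_calc_eqI by metis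

text \<open>Multiplying \<open>l - x\<close> by \<open>1 - z\<close>, with
  \<open>x = inv_cayley z\<close>, gives the linear polynomial
  \<open>(l - \<i>) - (l + \<i>) z\<close>. The lifted resolvent function times this polynomial is
  therefore \<open>1 - z\<close>, which becomes an operator identity \<open>T K = 1 - U\<close>; as
  \<open>K\<close> is onto, it determines \<open>T\<close>.\<close>

lemma C0_calc_resolvent:
  assumes l: "l \<notin> \<real>"
  shows "C0_calc (\<lambda>x. inverse (l - complex_of_real x)) = resolvent D l"
proof -
  let ?g = "\<lambda>x. inverse (l - complex_of_real x)" and ?T = "C0_calc (\<lambda>x. inverse (l - complex_of_real x))"
  define K where "K = scale_op (l - \<i>) id_blinfun - scale_op (l + \<i>) cayley_op"
  have "circle_calc cayley_op (\<lambda>z. (l - \<i>) - (l + \<i>) * z) K"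
    unfolding K_def
    by (intro circle_calc_diff circle_calc_scale circle_calc_star_graph star_graph_const star_graph_id)
  then have "circle_calc cayley_op (\<lambda>z. lift_circle ?g z * ((l - \<i>) - (l + \<i>) * z)) (?T o\<^sub>L K)"
    by (intro circle_calc_mult circle_calc_C0_calc C0_resolvent l)
  then have "circle_calc cayley_op (\<lambda>z. 1 - z) (?T o\<^sub>L K)"
  proof (rule circle_calc_cong)
    fix z assume z: "cmod z = 1"
    show "lift_circle ?g z * ((l - \<i>) - (l + \<i>) * z) = 1 - z"
    proof (cases "z = 1")
      case False
      define x where "x = inv_cayley z"
      have "(1 - z) * (l - of_real x) = (l - \<i>) - (l + \<i>) * z"
        using False unfolding x_def of_real_inv_cayley[OF z False] by (simp add: field_simps)
      then show ?thesis
        using False nonreal_minus_real[OF l, of x] by (simp add: lift_circle_def x_def[symmetric] field_simps)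
    qed (simp add: lift_circle_def)
  qed
  moreover have "circle_calc cayley_op (\<lambda>z. 1 - z) (scale_op 1 id_blinfun - cayley_op)"
    by (intro circle_calc_diff circle_calc_star_graph star_graph_const star_graph_id)
  ultimately have TK: "?T o\<^sub>L K = scale_op 1 id_blinfun - cayley_op"
    by (rule cayley.circle_calc_unique)
  have T: "?T \<in> bounded_ops"
    by (rule cayley.circle_calc_bounded_ops[OF circle_calc_C0_calc[OF C0_resolvent[OF l]]])
  let ?Q = "resolvent D (- \<i>)" and ?R = "resolvent D l"
  have K: "blinfun_apply K x = (- 2 * \<i>) *\<^sub>C (x + (l + \<i>) *\<^sub>C blinfun_apply ?Q x)" for x
    unfolding K_def cayley_op_def
    by (simp add: blinfun_simps algebra_simps) (metis mult_2_right scaleC_add_left)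
  show ?thesis
  proof (rule blinfun_eqI)
    fix y
    define u where "u = blinfun_apply ?R y"
    \<comment> \<open>Chosen such that the resolvent at \<open>-\<i>\<close> returns
      \<open>u\<close>; then \<open>K x\<close> is the multiple \<open>-2 \<i>\<close> of
      \<open>y\<close>, so \<open>T\<close> can be evaluated at \<open>y\<close>.\<close>
    define x where "x = (- \<i>) *\<^sub>C u - D_val u"
    have u: "u \<in> dom D" "l *\<^sub>C u - D_val u = y"
      unfolding u_def using resolvent_dom[OF l] resolvent_right[OF l] by auto
    have Qx: "blinfun_apply ?Q x = u"
      unfolding x_def using resolvent_left[OF nonreal_i(2) u(1)] by simp
    have "x + (l + \<i>) *\<^sub>C u = y" unfolding x_def u(2)[symmetric] by (simp add: algebra_simps)
    then have "blinfun_apply K x = (- 2 * \<i>) *\<^sub>C y" using K[of x] Qx by simp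
    then have "(- 2 * \<i>) *\<^sub>C blinfun_apply ?T y = blinfun_apply (?T o\<^sub>L K) x"
      by (simp add: bounded_opsD[OF T] del: cvec.scale_minus_left)
    also have "\<dots> = (- 2 * \<i>) *\<^sub>C u"
      unfolding TK cayley_op_def by (simp add: blinfun_simps Qx)
    finally show "blinfun_apply ?T y = blinfun_apply ?R y" by (simp add: u_def)
  qed
qed

lemma is_C0_calculus_C0_calc: "is_C0_calculus D C0_calc"
  unfolding is_C0_calculus_def
proof (intro conjI ballI allI impI)
  fix f assume f: "f \<in> C0"
  note F = circle_calc_C0_calc[OF f]
  show "C0_calc f \<in> bounded_ops" by (rule cayley.circle_calc_bounded_ops[OF F])
  show "C0_calc (\<lambda>x. c * f x) = scale_op c (C0_calc f)" for c
    by (rule C0_calc_eqI, rule circle_calc_cong[OF circle_calc_scale[OF F]]) (simp add: lift_circle_def)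
  show "C0_calc (\<lambda>x. cnj (f x)) = adj (C0_calc f)"
    by (rule C0_calc_eqI, rule circle_calc_cong[OF cayley.circle_calc_cnj[OF F]]) (simp add: lift_circle_def)
  fix g assume g: "g \<in> C0"
  note G = circle_calc_C0_calc[OF g]
  show "C0_calc (\<lambda>x. f x + g x) = C0_calc f + C0_calc g"
    by (rule C0_calc_eqI, rule circle_calc_cong[OF circle_calc_add[OF F G]]) (simp add: lift_circle_def)
  show "C0_calc (\<lambda>x. f x * g x) = C0_calc f o\<^sub>L C0_calc g"
    by (rule C0_calc_eqI, rule circle_calc_cong[OF circle_calc_mult[OF F G]]) (simp add: lift_circle_def)
qed (rule C0_calc_resolvent)

lemma fun_calc_eq:
  assumes "f \<in> C0"
  shows "fun_calc D f = C0_calc f"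
  unfolding fun_calc_def
proof (rule the_equality)
  show "\<exists>\<Phi>. is_C0_calculus D \<Phi> \<and> C0_calc f = \<Phi> f" using is_C0_calculus_C0_calc by blast
qed (use C0_calculus_unique[OF _ is_C0_calculus_C0_calc assms] in blast)

lemma is_C0_calculus_fun_calc: "is_C0_calculus D (fun_calc D)"
  using is_C0_calculus_C0_calc unfolding is_C0_calculus_def
  by (simp add: fun_calc_eq C0_add C0_scale C0_mult C0_cnj C0_resolvent)

lemmas fun_calc_bounded_ops = C0_calculusD(1)[OF is_C0_calculus_fun_calc]
  and fun_calc_add = C0_calculusD(2)[OF is_C0_calculus_fun_calc]
  and fun_calc_scale = C0_calculusD(3)[OF is_C0_calculus_fun_calc]
  and fun_calc_mult = C0_calculusD(4)[OF is_C0_calculus_fun_calc]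
  and fun_calc_cnj = C0_calculusD(5)[OF is_C0_calculus_fun_calc]
  and fun_calc_resolvent = C0_calculusD(6)[OF is_C0_calculus_fun_calc]
  and fun_calc_diff = C0_calculus_diff[OF is_C0_calculus_fun_calc]
  and norm_fun_calc_le = norm_C0_calculus_le[OF is_C0_calculus_fun_calc]
  and norm_fun_calc_diff_le = norm_C0_calculus_diff_le[OF is_C0_calculus_fun_calc]

text \<open>\<open>C0_induct\<close> with \<open>V\<close> as the target. Membership of both
  resolvents is assumed separately because the rule is also applied to \<open>J\<close>, whose
  definition does not mention adjoints.\<close>

lemma fun_calc_mem:
  assumes V: "closed V" "op_subspace V" "\<And>S T. S \<in> V \<Longrightarrow> T \<in> V \<Longrightarrow> S o\<^sub>L T \<in> V"
    and res: "resolvent D \<i> \<in> V" "resolvent D (- \<i>) \<in> V"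
    and f: "f \<in> C0"
  shows "fun_calc D f \<in> V"
  using f
proof (induction rule: C0_induct)
  case (limit f)
  have "\<exists>S\<in>V. dist S (fun_calc D f) < e" if e: "e > 0" for e
  proof -
    have "e / 2 > 0" using e by simp
    then obtain g where g: "g \<in> C0" "fun_calc D g \<in> V" "\<And>x. cmod (f x - g x) \<le> e / 2"
      using limit(2) by blast
    have "norm (fun_calc D f - fun_calc D g) \<le> e / 2"
      by (rule norm_fun_calc_diff_le[OF limit(1) g(1,3)])
    then show ?thesis
      using g(2) e by (intro bexI[of _ "fun_calc D g"]) (auto simp: dist_norm norm_minus_commute)
  qed
  then have "fun_calc D f \<in> closure V" unfolding closure_approachable by blast
  then show ?case using V(1) by simp
qed (use V res in \<open>simp_all add: fun_calc_resolvent nonreal_i fun_calc_add fun_calc_scale fun_calc_mult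
      op_subspace_def\<close>)

end

section \<open>The bounded transform\<close>

lemma blinfun_eq_on_dense:
  fixes S T :: "'a::real_normed_vector \<Rightarrow>\<^sub>L 'b::real_normed_vector"
  assumes "closure X = UNIV" "\<And>x. x \<in> X \<Longrightarrow> blinfun_apply S x = blinfun_apply T x"
  shows "S = T"
proof (rule blinfun_eqI)
  fix x
  have "x \<in> closure X" using assms by simp
  then obtain s where s: "\<And>n. s n \<in> X" "s \<longlonglongrightarrow> x"
    by (auto simp: closure_sequential)
  have "(\<lambda>n. blinfun_apply S (s n)) \<longlonglongrightarrow> blinfun_apply S x"
    "(\<lambda>n. blinfun_apply T (s n)) \<longlonglongrightarrow> blinfun_apply T x"
    by (intro blinfun.tendsto s tendsto_const)+
  then show "blinfun_apply S x = blinfun_apply T x"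
    using assms(2) s(1) LIMSEQ_unique by simp
qed

lemma strong_limit_exists:
  fixes T :: "nat \<Rightarrow> 'a::real_normed_vector \<Rightarrow>\<^sub>L 'b::banach"
  assumes C: "\<And>n. norm (T n) \<le> C" and X: "closure X = UNIV"
    and conv: "\<And>x. x \<in> X \<Longrightarrow> convergent (\<lambda>n. blinfun_apply (T n) x)"
  shows "\<exists>L. \<forall>x. (\<lambda>n. blinfun_apply (T n) x) \<longlonglongrightarrow> blinfun_apply L x"
proof -
  have C0: "C \<ge> 0" using C[of 0] norm_ge_zero order_trans by blast
  have "convergent (\<lambda>n. blinfun_apply (T n) x)" for x
    unfolding Cauchy_convergent_iff[symmetric]
  proof (rule metric_CauchyI)
    fix e :: real assume e: "e > 0"
    define d where "d = e / (4 * (C + 1))"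
    have d: "d > 0" "C * d \<le> e / 4" using e C0 by (auto simp: d_def field_simps)
    have "x \<in> closure X" using X by simp
    then obtain y where y: "y \<in> X" "dist y x < d"
      using d(1) unfolding closure_approachable by blast
    have "Cauchy (\<lambda>n. blinfun_apply (T n) y)"
      using conv[OF y(1)] by (rule convergent_Cauchy)
    moreover have "e / 2 > 0" using e by simp
    ultimately obtain k where k: "\<And>m n. m \<ge> k \<Longrightarrow> n \<ge> k \<Longrightarrow>
        dist (blinfun_apply (T m) y) (blinfun_apply (T n) y) < e / 2"
      using metric_CauchyD by blast
    have near: "dist (blinfun_apply (T n) y) (blinfun_apply (T n) x) \<le> e / 4" for n
    proof -
      have "norm (blinfun_apply (T n) (y - x)) \<le> norm (T n) * norm (y - x)" by (rule norm_blinfun)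
      also have "\<dots> \<le> C * d" using y(2) C0 by (intro mult_mono C) (auto simp: dist_norm)
      finally show ?thesis using d(2) by (simp add: dist_norm blinfun.diff_right)
    qed
    have "dist (blinfun_apply (T m) x) (blinfun_apply (T n) x) < e" if "m \<ge> k" "n \<ge> k" for m n
    proof -
      have "dist (blinfun_apply (T m) x) (blinfun_apply (T n) x)
          \<le> dist (blinfun_apply (T m) y) (blinfun_apply (T m) x)
            + dist (blinfun_apply (T m) y) (blinfun_apply (T n) y)
            + dist (blinfun_apply (T n) y) (blinfun_apply (T n) x)"
        by metric
      then show ?thesis using near[of m] near[of n] k[OF that] by linarith
    qed
    then show "\<exists>K. \<forall>m\<ge>K. \<forall>n\<ge>K. dist (blinfun_apply (T m) x) (blinfun_apply (T n) x) < e" by blast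
  qed
  then obtain f where f: "\<And>x. (\<lambda>n. blinfun_apply (T n) x) \<longlonglongrightarrow> f x"
    unfolding convergent_def by metis
  have "bounded_linear f"
  proof (rule bounded_linear_intro)
    show "f (x + y) = f x + f y" for x y
      using LIMSEQ_unique[OF f[of "x + y"]] tendsto_add[OF f[of x] f[of y]]
      by (simp add: blinfun.add_right)
    show "f (r *\<^sub>R x) = r *\<^sub>R f x" for r x
      using LIMSEQ_unique[OF f[of "r *\<^sub>R x"]] tendsto_scaleR[OF tendsto_const f[of x], of r]
      by (simp add: blinfun.scaleR_right)
    show "norm (f x) \<le> norm x * C" for x
    proof (rule tendsto_upperbound[OF tendsto_norm[OF f[of x]]])
      show "\<forall>\<^sub>F n in sequentially. norm (blinfun_apply (T n) x) \<le> norm x * C"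
      proof (intro always_eventually allI)
        fix n
        have "norm (blinfun_apply (T n) x) \<le> norm (T n) * norm x" by (rule norm_blinfun)
        also have "\<dots> \<le> C * norm x" by (intro mult_right_mono C norm_ge_zero)
        finally show "norm (blinfun_apply (T n) x) \<le> norm x * C" by (simp add: mult.commute)
      qed
    qed simp
  qed
  then show ?thesis
    using f by (intro exI[of _ "Blinfun f"]) (simp add: bounded_linear_Blinfun_apply)
qed

lemma strong_limit_on_dense:
  fixes T :: "nat \<Rightarrow> 'a::real_normed_vector \<Rightarrow>\<^sub>L 'b::banach"
  assumes C: "\<And>n. norm (T n) \<le> C" and X: "closure X = UNIV"
    and lim: "\<And>x. x \<in> X \<Longrightarrow> (\<lambda>n. blinfun_apply (T n) x) \<longlonglongrightarrow> blinfun_apply S x"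
  shows "(\<lambda>n. blinfun_apply (T n) x) \<longlonglongrightarrow> blinfun_apply S x"
proof -
  obtain L where L: "\<And>x. (\<lambda>n. blinfun_apply (T n) x) \<longlonglongrightarrow> blinfun_apply L x"
    using strong_limit_exists[of T, OF C X convergentI[OF lim]] by blast
  have "L = S" by (rule blinfun_eq_on_dense[OF X]) (rule LIMSEQ_unique[OF L lim])
  then show ?thesis using L by blast
qed

definition cutoff :: "nat \<Rightarrow> real \<Rightarrow> complex" where
  "cutoff n x = of_real ((real (Suc n))\<^sup>2 / ((real (Suc n))\<^sup>2 + x\<^sup>2))"

text \<open>Bounded and continuous, but with limits 1 and -1 at the ends. It enters the calculus
  only multiplied by a \<open>C0\<close> function.\<close>

definition transform_fun :: "real \<Rightarrow> complex" where
  "transform_fun x = of_real (x / sqrt (1 + x\<^sup>2))"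

definition inv_sqrt_fun :: "real \<Rightarrow> complex" where
  "inv_sqrt_fun x = of_real (1 / sqrt (1 + x\<^sup>2))"

definition inv_square_fun :: "real \<Rightarrow> complex" where
  "inv_square_fun x = of_real (1 / (1 + x\<^sup>2))"

lemma sum_squares_pos: "m > 0 \<Longrightarrow> m\<^sup>2 + x\<^sup>2 > (0::real)"
  by (intro add_pos_nonneg) auto

lemma one_plus_square_pos: "1 + x\<^sup>2 > (0::real)"
  by (intro add_pos_nonneg) auto

lemma i_real_nonreal: "m \<noteq> 0 \<Longrightarrow> \<i> * complex_of_real m \<notin> \<real>"
  by (simp add: complex_is_Real_iff)

lemma inverse_i_minus:
  assumes "m \<noteq> 0"
  shows "inverse (\<i> * complex_of_real m - of_real x) = - (of_real x + \<i> * of_real m) / of_real (m\<^sup>2 + x\<^sup>2)"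
proof -
  have ne: "\<i> * complex_of_real m - of_real x \<noteq> 0" using assms by (auto simp: complex_eq_iff)
  have ne2: "complex_of_real (m\<^sup>2 + x\<^sup>2) \<noteq> 0"
    using assms by (simp add: sum_power2_eq_zero_iff del: of_real_add of_real_power)
  have "(\<i> * complex_of_real m - of_real x) * (- (of_real x + \<i> * of_real m)) = of_real (m\<^sup>2 + x\<^sup>2)"
    by (simp add: algebra_simps power2_eq_square)
  then have "(\<i> * complex_of_real m - of_real x) * (- (of_real x + \<i> * of_real m) / of_real (m\<^sup>2 + x\<^sup>2)) = 1"
    using ne2 by (simp del: of_real_add of_real_power)
  then show ?thesis using ne by (metis inverse_unique)
qed

lemma cutoff_eq:
  "cutoff n x = (\<i> * of_real (real (Suc n)) / 2) *
     (inverse (\<i> * of_real (real (Suc n)) - of_real x) - inverse (\<i> * of_real (- real (Suc n)) - of_real x))"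
proof -
  have "real (Suc n) \<noteq> 0" "- real (Suc n) \<noteq> 0" by auto
  note eqs = this[THEN inverse_i_minus[of _ x]]
  show ?thesis
    unfolding eqs cutoff_def
    by (simp add: diff_divide_distrib[symmetric] power2_eq_square del: of_nat_Suc) (simp add: ac_simps)
qed

lemma C0_cutoff: "cutoff n \<in> C0"
proof -
  have "(\<lambda>x. (\<i> * of_real (real (Suc n)) / 2) *
     (inverse (\<i> * of_real (real (Suc n)) - of_real x) - inverse (\<i> * of_real (- real (Suc n)) - of_real x))) \<in> C0"
    by (intro C0_scale C0_diff C0_resolvent i_real_nonreal) auto
  then show ?thesis unfolding cutoff_eq[abs_def] .
qed

lemma cmod_cutoff_le: "cmod (cutoff n x) \<le> 1"
  using sum_squares_pos[of "real (Suc n)" x]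
  unfolding cutoff_def norm_of_real by (simp add: abs_of_nonneg del: of_nat_Suc)

text \<open>A uniform bound and a bound that is small on compact sets: together they are the form of
  convergence that \<open>fun_calc_tendsto\<close> accepts.\<close>

lemma one_minus_cutoff:
  "cmod (cutoff n x - 1) \<le> 1" "cmod (cutoff n x - 1) \<le> inverse (real (Suc n)) * (1 + x\<^sup>2)"
proof -
  let ?m = "real (Suc n)"
  have pos: "?m\<^sup>2 + x\<^sup>2 > 0" by (rule sum_squares_pos) simp
  have "cutoff n x - 1 = of_real (?m\<^sup>2 / (?m\<^sup>2 + x\<^sup>2) - 1)"
    by (simp add: cutoff_def)
  also have "?m\<^sup>2 / (?m\<^sup>2 + x\<^sup>2) - 1 = - (x\<^sup>2 / (?m\<^sup>2 + x\<^sup>2))"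
    using pos by (simp add: field_simps)
  finally have eq: "cmod (cutoff n x - 1) = x\<^sup>2 / (?m\<^sup>2 + x\<^sup>2)"
    using pos by (simp only: norm_of_real abs_minus_cancel) (simp add: abs_of_nonneg)
  show "cmod (cutoff n x - 1) \<le> 1" unfolding eq using pos by (simp add: field_simps)
  have "?m ^ 1 \<le> ?m ^ 2" by (rule power_increasing) auto
  then have "?m \<le> ?m\<^sup>2 + x\<^sup>2" by (simp add: add_increasing2)
  then have "x\<^sup>2 / (?m\<^sup>2 + x\<^sup>2) \<le> x\<^sup>2 / ?m" by (intro divide_left_mono mult_pos_pos pos) auto
  also have "\<dots> \<le> (1 + x\<^sup>2) / ?m" by (intro divide_right_mono) auto
  finally show "cmod (cutoff n x - 1) \<le> inverse ?m * (1 + x\<^sup>2)"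
    unfolding eq by (simp only: divide_inverse mult.commute)
qed

lemma abs_le_sqrt_one_plus: "\<bar>x\<bar> \<le> sqrt (1 + x\<^sup>2)"
  by (rule real_le_rsqrt) simp

lemma cmod_transform_fun_le: "cmod (transform_fun x) \<le> 1"
  using abs_le_sqrt_one_plus[of x] one_plus_square_pos[of x]
  by (simp add: transform_fun_def norm_divide field_simps)

lemma continuous_transform_fun: "continuous_on S transform_fun"
  unfolding transform_fun_def[abs_def]
  using one_plus_square_pos by (intro continuous_intros) (auto simp: less_le)

lemma C0_inv_sqrt_fun: "inv_sqrt_fun \<in> C0"
proof (rule C0_I_bound)
  show "continuous_on UNIV inv_sqrt_fun"
    unfolding inv_sqrt_fun_def[abs_def]
    using one_plus_square_pos by (intro continuous_intros) (auto simp: less_le)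
  show "cmod (inv_sqrt_fun x) * \<bar>x\<bar> \<le> 1" for x
    using abs_le_sqrt_one_plus[of x] one_plus_square_pos[of x]
    by (simp add: inv_sqrt_fun_def norm_divide field_simps)
qed simp

lemma inv_square_fun_eq: "inv_square_fun x = inv_sqrt_fun x * inv_sqrt_fun x"
  using one_plus_square_pos[of x]
  by (simp add: inv_square_fun_def inv_sqrt_fun_def less_imp_le flip: of_real_mult)

lemma C0_inv_square_fun: "inv_square_fun \<in> C0"
  unfolding inv_square_fun_eq[abs_def] by (intro C0_mult C0_inv_sqrt_fun)

lemma transform_fun_square: "transform_fun x * transform_fun x = 1 - inv_square_fun x"
proof -
  have "x / sqrt (1 + x\<^sup>2) * (x / sqrt (1 + x\<^sup>2)) = x\<^sup>2 / (1 + x\<^sup>2)"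
    using one_plus_square_pos[of x] by (simp add: power2_eq_square)
  also have "\<dots> = 1 - 1 / (1 + x\<^sup>2)"
    using one_plus_square_pos[of x] by (simp add: field_simps)
  finally have "complex_of_real (x / sqrt (1 + x\<^sup>2) * (x / sqrt (1 + x\<^sup>2))) = of_real (1 - 1 / (1 + x\<^sup>2))"
    by (rule arg_cong)
  then show ?thesis
    unfolding transform_fun_def inv_square_fun_def by (simp only: of_real_mult of_real_diff of_real_1)
qed

lemma C0_cutoff_transform: "(\<lambda>x. cutoff n x * transform_fun x) \<in> C0"
  by (rule C0_mult_bounded[OF C0_cutoff continuous_transform_fun cmod_transform_fun_le])

lemma C0_transform_mult: "g \<in> C0 \<Longrightarrow> (\<lambda>x. transform_fun x * g x) \<in> C0"
  using C0_mult_bounded[OF _ continuous_transform_fun cmod_transform_fun_le, of g] by (simp add: mult.commute)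

context self_adjoint_operator
begin

text \<open>The functions \<open>g n\<close> approach \<open>h\<close> only locally uniformly. The
  \<open>C0\<close> factor \<open>f\<close> is small outside a compact interval, where the uniform
  bound \<open>C\<close> suffices, so the products converge uniformly and contractivity
  applies.\<close>

lemma fun_calc_tendsto:
  assumes f: "f \<in> C0" and C0: "\<And>n. (\<lambda>x. g n x * f x) \<in> C0" "(\<lambda>x. h x * f x) \<in> C0"
    and C: "\<And>n x. cmod (g n x - h x) \<le> C"
    and d: "\<And>n x. cmod (g n x - h x) \<le> d n * (1 + x\<^sup>2)" "d \<longlonglongrightarrow> 0"
  shows "(\<lambda>n::nat. fun_calc D (\<lambda>x. g n x * f x)) \<longlonglongrightarrow> fun_calc D (\<lambda>x. h x * f x)"
proof (rule metric_LIMSEQ_I)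
  fix e :: real assume e: "e > 0"
  have C_nonneg: "C \<ge> 0" using C[of 0 0] norm_ge_zero order_trans by blast
  \<comment> \<open>\<open>e'\<close> serves the region \<open>|x| \<ge> b\<close> against the bound
    \<open>C\<close>, and \<open>e''\<close> below serves \<open>|x| < b\<close> against
    \<open>(1 + b^2) K\<close>; each region is brought below \<open>e / 2\<close>.\<close>
  define e' where "e' = e / (2 * (C + 1))"
  have e': "e' > 0" "C * e' \<le> e / 2" using e C_nonneg by (auto simp: e'_def field_simps)
  obtain b where b: "b > 0" "\<And>x. \<bar>x\<bar> \<ge> b \<Longrightarrow> cmod (f x) < e'"
    using C0_eventually_small[OF f e'(1)] by metis
  obtain K where K: "K > 0" "\<And>x. cmod (f x) \<le> K"
    using C0_bounded[OF f] by metis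
  define e'' where "e'' = e / (2 * ((1 + b\<^sup>2) * K))"
  have bK: "(1 + b\<^sup>2) * K > 0" using K(1) one_plus_square_pos by simp
  then have "e'' > 0" using e by (simp add: e''_def)
  then obtain k where k: "\<And>n. n \<ge> k \<Longrightarrow> \<bar>d n\<bar> < e''"
    using metric_LIMSEQ_D[OF d(2)] by (auto simp: dist_norm)
  have "dist (fun_calc D (\<lambda>x. g n x * f x)) (fun_calc D (\<lambda>x. h x * f x)) < e" if n: "n \<ge> k" for n
  proof -
    have "cmod (g n x * f x - h x * f x) \<le> e / 2" for x
    proof -
      have eq: "cmod (g n x * f x - h x * f x) = cmod (g n x - h x) * cmod (f x)"
        by (simp add: left_diff_distrib[symmetric] norm_mult)
      show ?thesis
      proof (cases "\<bar>x\<bar> \<ge> b")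
        case True
        have "cmod (g n x - h x) * cmod (f x) \<le> C * e'"
          using C[of n x] b(2)[OF True] C_nonneg by (intro mult_mono) auto
        then show ?thesis unfolding eq using e'(2) by linarith
      next
        case False
        have "x\<^sup>2 \<le> b\<^sup>2" using False by (simp add: abs_le_square_iff[symmetric])
        have "cmod (g n x - h x) \<le> \<bar>d n\<bar> * (1 + x\<^sup>2)"
          using d(1)[of n x] one_plus_square_pos[of x]
          by (meson abs_ge_self less_imp_le mult_right_mono order_trans)
        also have "\<dots> \<le> e'' * (1 + b\<^sup>2)"
          using k[OF n] \<open>x\<^sup>2 \<le> b\<^sup>2\<close> \<open>e'' > 0\<close> by (intro mult_mono) auto
        finally have "cmod (g n x - h x) * cmod (f x) \<le> e'' * (1 + b\<^sup>2) * K"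
          using K \<open>e'' > 0\<close> by (intro mult_mono) auto
        also have "\<dots> = e / 2" using bK by (simp add: e''_def field_simps)
        finally show ?thesis unfolding eq .
      qed
    qed
    then have "norm (fun_calc D (\<lambda>x. g n x * f x) - fun_calc D (\<lambda>x. h x * f x)) \<le> e / 2"
      by (rule norm_fun_calc_diff_le[OF C0])
    then show ?thesis using e by (simp add: dist_norm)
  qed
  then show "\<exists>k. \<forall>n\<ge>k. dist (fun_calc D (\<lambda>x. g n x * f x)) (fun_calc D (\<lambda>x. h x * f x)) < e" by blast
qed

lemma fun_calc_cutoff_tendsto:
  assumes f: "f \<in> C0"
  shows "(\<lambda>n. fun_calc D (\<lambda>x. cutoff n x * f x)) \<longlonglongrightarrow> fun_calc D f"
  using fun_calc_tendsto[of f cutoff "\<lambda>_. 1" 1 "\<lambda>n. inverse (real (Suc n))"]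
    one_minus_cutoff f C0_mult[OF C0_cutoff f] LIMSEQ_inverse_real_of_nat
  by (simp del: of_nat_Suc)

lemma dom_resolvent:
  assumes "y \<in> dom D"
  shows "\<exists>z. y = blinfun_apply (resolvent D \<i>) z"
  using resolvent_left[OF nonreal_i(1) assms] by metis

text \<open>Factor \<open>g\<close> as the resolvent function at \<open>\<i>\<close> times
  \<open>k\<close>, where \<open>k = (\<i> - x) g\<close> lies in \<open>C0\<close> by the second
  hypothesis. The range is then inside the domain, and \<open>\<i> - D\<close> maps
  \<open>g(D) y\<close> to \<open>k(D) y\<close>.\<close>

lemma D_fun_calc:
  assumes g: "g \<in> C0" "(\<lambda>x. of_real x * g x) \<in> C0"
  shows "blinfun_apply (fun_calc D g) y \<in> dom D"
    "D_val (blinfun_apply (fun_calc D g) y) = blinfun_apply (fun_calc D (\<lambda>x. of_real x * g x)) y"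
proof -
  define k where "k x = \<i> * g x - of_real x * g x" for x
  have k: "k \<in> C0" unfolding k_def[abs_def] by (intro C0_diff C0_scale g)
  have "g x = inverse (\<i> - of_real x) * k x" for x
    using nonreal_minus_real[OF nonreal_i(1), of x]
    by (simp add: k_def left_diff_distrib[symmetric] mult.assoc[symmetric])
  then have "fun_calc D g = fun_calc D (\<lambda>x. inverse (\<i> - of_real x) * k x)" by presburger
  then have gk: "fun_calc D g = resolvent D \<i> o\<^sub>L fun_calc D k"
    by (simp add: fun_calc_mult C0_resolvent nonreal_i k fun_calc_resolvent)
  then show "blinfun_apply (fun_calc D g) y \<in> dom D"
    by (simp add: resolvent_dom nonreal_i)
  have "fun_calc D k = scale_op \<i> (fun_calc D g) - fun_calc D (\<lambda>x. of_real x * g x)"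
    unfolding k_def[abs_def] by (simp add: fun_calc_diff fun_calc_scale g C0_scale)
  then have "blinfun_apply (fun_calc D k) y =
      \<i> *\<^sub>C blinfun_apply (fun_calc D g) y - blinfun_apply (fun_calc D (\<lambda>x. of_real x * g x)) y"
    by (simp add: blinfun_simps)
  moreover have "\<i> *\<^sub>C blinfun_apply (fun_calc D g) y - D_val (blinfun_apply (fun_calc D g) y)
      = blinfun_apply (fun_calc D k) y"
    unfolding gk using resolvent_right[OF nonreal_i(1)] by simp
  ultimately show "D_val (blinfun_apply (fun_calc D g) y) = blinfun_apply (fun_calc D (\<lambda>x. of_real x * g x)) y"
    by simp
qed

text \<open>\<open>Blinfun\<close> in the definition of \<open>bounded_transform\<close> is
  meaningful only for a bounded linear argument. The strong limit \<open>L\<close> supplies such an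
  operator, and closedness of \<open>D\<close> identifies it with the defining expression.\<close>

lemma bounded_transform_limit:
  "(\<lambda>n. blinfun_apply (fun_calc D (\<lambda>x. cutoff n x * transform_fun x)) y)
     \<longlonglongrightarrow> blinfun_apply (bounded_transform D) y"
proof -
  let ?f = "\<lambda>n x. cutoff n x * transform_fun x" and ?s = "\<lambda>n x. cutoff n x * inv_sqrt_fun x"
  have "convergent (\<lambda>n. blinfun_apply (fun_calc D (?f n)) y)" if y: "y \<in> dom D" for y
  proof -
    obtain z where z: "y = blinfun_apply (resolvent D \<i>) z" using dom_resolvent[OF y] by blast
    let ?r = "\<lambda>x. inverse (\<i> - complex_of_real x)"
    have r: "?r \<in> C0" by (rule C0_resolvent[OF nonreal_i(1)])
    have "fun_calc D (?f n) o\<^sub>L resolvent D \<i> = fun_calc D (\<lambda>x. cutoff n x * (transform_fun x * ?r x))" for n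
      unfolding fun_calc_resolvent[OF nonreal_i(1), symmetric]
        fun_calc_mult[OF C0_cutoff_transform r, symmetric] by (simp only: mult.assoc)
    then have "(\<lambda>n. fun_calc D (?f n) o\<^sub>L resolvent D \<i>) \<longlonglongrightarrow> fun_calc D (\<lambda>x. transform_fun x * ?r x)"
      using fun_calc_cutoff_tendsto[OF C0_transform_mult[OF r]] by simp
    from tendsto_blinfun_apply_const[OF this, of z] show ?thesis
      unfolding convergent_def z by auto
  qed
  moreover have "norm (fun_calc D (?f n)) \<le> 1" for n
    by (rule norm_fun_calc_le[OF C0_cutoff_transform])
       (use cmod_cutoff_le cmod_transform_fun_le in \<open>simp add: norm_mult mult_le_one\<close>)
  ultimately obtain L where L: "\<And>y. (\<lambda>n. blinfun_apply (fun_calc D (?f n)) y) \<longlonglongrightarrow> blinfun_apply L y"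
    using strong_limit_exists[OF _ dom_dense, of "\<lambda>n. fun_calc D (?f n)" 1] by blast
  have s: "?s n \<in> C0" for n by (intro C0_mult C0_cutoff C0_inv_sqrt_fun)
  \<comment> \<open>\<open>D_fun_calc\<close> does not apply to \<open>inv_sqrt_fun\<close> itself,
    since \<open>x\<close> times it is \<open>transform_fun\<close>, which is not in
    \<open>C0\<close>; with the cutoff it applies.\<close>
  have xs: "(\<lambda>x. of_real x * ?s n x) = ?f n" for n
    by (simp add: fun_eq_iff transform_fun_def inv_sqrt_fun_def)
  have xs': "(\<lambda>x. of_real x * ?s n x) \<in> C0" for n unfolding xs by (rule C0_cutoff_transform)
  have "D_val (blinfun_apply (fun_calc D inv_sqrt_fun) y) = blinfun_apply L y" for y
  proof (rule D_closed(2))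
    show "blinfun_apply (fun_calc D (?s n)) y \<in> dom D" for n
      by (rule D_fun_calc(1)[OF s xs'])
    show "(\<lambda>n. blinfun_apply (fun_calc D (?s n)) y) \<longlonglongrightarrow> blinfun_apply (fun_calc D inv_sqrt_fun) y"
      by (rule tendsto_blinfun_apply_const[OF fun_calc_cutoff_tendsto[OF C0_inv_sqrt_fun]])
    show "(\<lambda>n. D_val (blinfun_apply (fun_calc D (?s n)) y)) \<longlonglongrightarrow> blinfun_apply L y"
      unfolding D_fun_calc(2)[OF s xs'] unfolding xs by (rule L)
  qed
  then have "bounded_transform D = L"
    unfolding bounded_transform_def inv_sqrt_fun_def[abs_def, symmetric] D_val_def
    by (simp add: blinfun_apply_inverse)
  then show ?thesis using L by simp
qed

lemma bounded_transform_bounded_ops: "bounded_transform D \<in> bounded_ops"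
proof (rule bounded_opsI)
  fix c x
  show "blinfun_apply (bounded_transform D) (c *\<^sub>C x) = c *\<^sub>C blinfun_apply (bounded_transform D) x"
    by (rule LIMSEQ_unique[OF bounded_transform_limit])
       (use tendsto_scaleC[OF bounded_transform_limit, of c x] in
         \<open>simp add: bounded_opsD[OF fun_calc_bounded_ops[OF C0_cutoff_transform]]\<close>)
qed

text \<open>\<open>F\<close> acts on the range of the calculus as multiplication by
  \<open>transform_fun\<close>, although that function has no \<open>fun_calc\<close> value of its
  own. Strong limits against cutoffs justify this.\<close>

lemma bounded_transform_fun_calc:
  assumes g: "g \<in> C0"
  shows "bounded_transform D o\<^sub>L fun_calc D g = fun_calc D (\<lambda>x. transform_fun x * g x)"
proof (rule blinfun_eqI)
  fix y
  have "fun_calc D (\<lambda>x. cutoff n x * (transform_fun x * g x))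
      = fun_calc D (\<lambda>x. cutoff n x * transform_fun x) o\<^sub>L fun_calc D g" for n
    unfolding fun_calc_mult[OF C0_cutoff_transform g, symmetric] by (simp only: mult.assoc)
  then have "(\<lambda>n. blinfun_apply (fun_calc D (\<lambda>x. cutoff n x * transform_fun x)) (blinfun_apply (fun_calc D g) y))
      \<longlonglongrightarrow> blinfun_apply (fun_calc D (\<lambda>x. transform_fun x * g x)) y"
    using tendsto_blinfun_apply_const[OF fun_calc_cutoff_tendsto[OF C0_transform_mult[OF g]], of y] by simp
  from LIMSEQ_unique[OF bounded_transform_limit this]
  show "blinfun_apply (bounded_transform D o\<^sub>L fun_calc D g) y
      = blinfun_apply (fun_calc D (\<lambda>x. transform_fun x * g x)) y" by simp
qed

lemma fun_calc_bounded_transform: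
  assumes g: "g \<in> C0"
  shows "fun_calc D g o\<^sub>L bounded_transform D = fun_calc D (\<lambda>x. transform_fun x * g x)"
proof (rule blinfun_eqI)
  fix y
  have "fun_calc D (\<lambda>x. cutoff n x * (transform_fun x * g x))
      = fun_calc D g o\<^sub>L fun_calc D (\<lambda>x. cutoff n x * transform_fun x)" for n
    unfolding fun_calc_mult[OF g C0_cutoff_transform, symmetric] by (simp only: mult_ac)
  then have "(\<lambda>n. blinfun_apply (fun_calc D g) (blinfun_apply (fun_calc D (\<lambda>x. cutoff n x * transform_fun x)) y))
      \<longlonglongrightarrow> blinfun_apply (fun_calc D (\<lambda>x. transform_fun x * g x)) y"
    using tendsto_blinfun_apply_const[OF fun_calc_cutoff_tendsto[OF C0_transform_mult[OF g]], of y] by simp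
  moreover have "(\<lambda>n. blinfun_apply (fun_calc D g) (blinfun_apply (fun_calc D (\<lambda>x. cutoff n x * transform_fun x)) y))
      \<longlonglongrightarrow> blinfun_apply (fun_calc D g) (blinfun_apply (bounded_transform D) y)"
    by (intro blinfun.tendsto tendsto_const bounded_transform_limit)
  ultimately show "blinfun_apply (fun_calc D g o\<^sub>L bounded_transform D) y
      = blinfun_apply (fun_calc D (\<lambda>x. transform_fun x * g x)) y"
    using LIMSEQ_unique by simp
qed

lemma adj_bounded_transform: "adj (bounded_transform D) = bounded_transform D"
proof (rule adj_eqI)
  fix x y
  let ?T = "\<lambda>n. fun_calc D (\<lambda>x. cutoff n x * transform_fun x)"
  have "adj (?T n) = ?T n" for n
    unfolding fun_calc_cnj[OF C0_cutoff_transform, symmetric]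
    by (simp add: cutoff_def transform_fun_def)
  then have eq: "cinner (blinfun_apply (?T n) x) y = cinner x (blinfun_apply (?T n) y)" for n
    using cinner_adj[OF fun_calc_bounded_ops[OF C0_cutoff_transform]] by metis
  have "(\<lambda>n. cinner (blinfun_apply (?T n) x) y) \<longlonglongrightarrow> cinner (blinfun_apply (bounded_transform D) x) y"
    by (intro tendsto_cinner bounded_transform_limit tendsto_const)
  moreover have "(\<lambda>n. cinner x (blinfun_apply (?T n) y)) \<longlonglongrightarrow> cinner x (blinfun_apply (bounded_transform D) y)"
    by (intro tendsto_cinner bounded_transform_limit tendsto_const)
  ultimately show "cinner (blinfun_apply (bounded_transform D) x) y = cinner x (blinfun_apply (bounded_transform D) y)"
    unfolding eq using LIMSEQ_unique by blast
qed

text \<open>The identity for functions involves the constant 1, which is outside \<open>C0\<close>.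
  Multiplied by a resolvent function it enters the calculus, and the range of the resolvent is the
  dense domain.\<close>

lemma bounded_transform_square:
  "(bounded_transform D o\<^sub>L bounded_transform D) - id_blinfun = - fun_calc D inv_square_fun"
proof (rule blinfun_eq_on_dense[OF dom_dense])
  fix y assume "y \<in> dom D"
  then obtain z where z: "y = blinfun_apply (resolvent D \<i>) z" using dom_resolvent by blast
  let ?r = "\<lambda>x. inverse (\<i> - complex_of_real x)" and ?F = "bounded_transform D"
  have r: "?r \<in> C0" by (rule C0_resolvent[OF nonreal_i(1)])
  have "?F o\<^sub>L (?F o\<^sub>L fun_calc D ?r) = fun_calc D (\<lambda>x. transform_fun x * (transform_fun x * ?r x))"
    by (simp add: bounded_transform_fun_calc r C0_transform_mult)
  also have "(\<lambda>x. transform_fun x * (transform_fun x * ?r x)) = (\<lambda>x. ?r x - inv_square_fun x * ?r x)"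
    unfolding mult.assoc[symmetric] transform_fun_square by (simp add: left_diff_distrib)
  also have "fun_calc D \<dots> = fun_calc D ?r - (fun_calc D inv_square_fun o\<^sub>L fun_calc D ?r)"
    by (simp add: fun_calc_diff fun_calc_mult r C0_inv_square_fun C0_mult)
  finally have "?F o\<^sub>L (?F o\<^sub>L resolvent D \<i>) = resolvent D \<i> - (fun_calc D inv_square_fun o\<^sub>L resolvent D \<i>)"
    unfolding fun_calc_resolvent[OF nonreal_i(1)] .
  from arg_cong[OF this, of "\<lambda>T. blinfun_apply T z"]
  show "blinfun_apply ((?F o\<^sub>L ?F) - id_blinfun) y = blinfun_apply (- fun_calc D inv_square_fun) y"
    by (simp add: z blinfun_simps)
qed

end

section \<open>Commutators with the bounded transform\<close>

lemma commutator_add_left: "commutator (S + T) a = commutator S a + commutator T a"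
  and commutator_diff_left: "commutator (S - T) a = commutator S a - commutator T a"
  by (auto intro!: blinfun_eqI simp: commutator_def blinfun_simps)

lemma commutator_scale_left:
  "a \<in> bounded_ops \<Longrightarrow> commutator (scale_op c T) a = scale_op c (commutator T a)"
  by (auto intro!: blinfun_eqI simp: commutator_def blinfun_simps bounded_opsD algebra_simps)

lemma bounded_linear_commutator_left: "bounded_linear (\<lambda>S. commutator S a)"
  unfolding commutator_def
  by (intro bounded_linear_sub bounded_bilinear.bounded_linear_left[OF bounded_bilinear_blinfun_compose]
      bounded_bilinear.bounded_linear_right[OF bounded_bilinear_blinfun_compose])

text \<open>The factor \<open>2 / pi\<close> matches the limits of \<open>transform_fun\<close> at
  both ends, which puts the difference into \<open>C0\<close> for every positive
  \<open>t\<close>.\<close>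

definition arctan_fun :: "real \<Rightarrow> real \<Rightarrow> complex" where
  "arctan_fun t x = transform_fun x - of_real (2 / pi * arctan (t * x))"

definition arctan_deriv :: "real \<Rightarrow> real \<Rightarrow> complex" where
  "arctan_deriv t x = of_real (- 2 / pi * (x / (1 + (t * x)\<^sup>2)))"

lemma arctan_bound: "\<bar>2 / pi * arctan y\<bar> \<le> 1"
proof -
  have "\<bar>arctan y\<bar> \<le> pi / 2"
    using arctan_lbound[of y] arctan_ubound[of y] by (simp add: abs_le_iff)
  then show ?thesis by (simp add: abs_mult field_simps)
qed

lemma abs_arctan_le: "\<bar>arctan y\<bar> \<le> \<bar>y\<bar>" for y :: real
proof -
  have "\<bar>arctan y - arctan 0\<bar> \<le> 1 * \<bar>y - 0\<bar>"
  proof (rule field_differentiable_bound[of UNIV arctan "\<lambda>x. inverse (1 + x\<^sup>2)" 1 y 0, simplified real_norm_def])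
    show "(arctan has_field_derivative inverse (1 + z\<^sup>2)) (at z within UNIV)" for z :: real
      by (rule DERIV_arctan)
    show "\<bar>inverse (1 + z\<^sup>2)\<bar> \<le> 1" for z :: real
      using one_plus_square_pos[of z] by (simp add: inverse_le_1_iff)
  qed auto
  then show ?thesis by simp
qed

lemma cmod_arctan_fun_diff:
  "cmod (arctan_fun t x - transform_fun x) \<le> 1"
  "t \<ge> 0 \<Longrightarrow> cmod (arctan_fun t x - transform_fun x) \<le> t * (1 + x\<^sup>2)"
proof -
  have eq: "cmod (arctan_fun t x - transform_fun x) = \<bar>2 / pi * arctan (t * x)\<bar>"
    unfolding arctan_fun_def by (simp add: norm_mult norm_divide abs_mult)
  show "cmod (arctan_fun t x - transform_fun x) \<le> 1" unfolding eq by (rule arctan_bound)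
  assume t: "t \<ge> 0"
  have "\<bar>2 / pi * arctan (t * x)\<bar> \<le> 1 * \<bar>t * x\<bar>"
    unfolding abs_mult[of "2 / pi"] using pi_ge_two by (intro mult_mono abs_arctan_le) auto
  also have "\<dots> = t * \<bar>x\<bar>" using t by (simp add: abs_mult)
  also have "\<bar>x\<bar> \<le> 1 + x\<^sup>2"
  proof -
    have "0 \<le> (\<bar>x\<bar> - 1)\<^sup>2" by simp
    then have "2 * \<bar>x\<bar> \<le> 1 + x\<^sup>2" by (simp add: power2_diff)
    then show ?thesis by linarith
  qed
  finally show "cmod (arctan_fun t x - transform_fun x) \<le> t * (1 + x\<^sup>2)"
    unfolding eq using t by (simp add: mult_left_mono)
qed

lemma C0_arctan_fun:
  assumes t: "t > 0"
  shows "arctan_fun t \<in> C0"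
proof -
  let ?f = "\<lambda>x. x / sqrt (1 + x\<^sup>2) - 2 / pi * arctan (t * x)"
  have "(?f \<longlongrightarrow> 0) at_top" "(?f \<longlongrightarrow> 0) at_bot"
    using t by real_asymp+
  then have "(?f \<longlongrightarrow> 0) at_infinity"
    unfolding at_infinity_eq_at_top_bot by (rule filterlim_sup)
  then have "((\<lambda>x. complex_of_real (?f x)) \<longlongrightarrow> of_real 0) at_infinity"
    by (rule tendsto_of_real)
  moreover have "arctan_fun t = (\<lambda>x. complex_of_real (?f x))"
    by (simp add: arctan_fun_def transform_fun_def fun_eq_iff)
  moreover have "continuous_on UNIV (arctan_fun t)"
    unfolding arctan_fun_def[abs_def] by (intro continuous_intros continuous_transform_fun)
  ultimately show ?thesis by (simp add: C0_def)
qed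

lemma arctan_deriv_eq:
  assumes t: "t > 0"
  shows "arctan_deriv t x = of_real (1 / (pi * t\<^sup>2)) *
     (inverse (\<i> * of_real (1 / t) - of_real x) + inverse (\<i> * of_real (- (1 / t)) - of_real x))"
proof -
  have "1 / t \<noteq> 0" "- (1 / t) \<noteq> 0" using t by auto
  note eqs = this[THEN inverse_i_minus[of _ x]]
  define d where "d = (1 / t)\<^sup>2 + x\<^sup>2"
  have d: "(- (1 / t))\<^sup>2 + x\<^sup>2 = d" by (simp add: d_def)
  have td: "t\<^sup>2 * d = 1 + (t * x)\<^sup>2" using t by (simp add: d_def field_simps)
  have "d > 0" unfolding d_def using t by (intro sum_squares_pos) simp
  have "1 / (pi * t\<^sup>2) * (- 2 * x / d) = - 2 / pi * (x / (t\<^sup>2 * d))"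
    by (simp add: field_simps)
  then have re: "- 2 / pi * (x / (1 + (t * x)\<^sup>2)) = 1 / (pi * t\<^sup>2) * (- 2 * x / d)"
    unfolding td by (rule sym)
  have "- (complex_of_real x + \<i> * of_real (1 / t)) / of_real d
      + - (complex_of_real x + \<i> * of_real (- (1 / t))) / of_real d = of_real (- 2 * x / d)"
    unfolding add_divide_distrib[symmetric] by simp
  then show ?thesis
    unfolding eqs d d_def[symmetric] arctan_deriv_def re of_real_mult[symmetric] by (simp only: of_real_mult)
qed

lemma C0_arctan_deriv:
  assumes t: "t > 0"
  shows "arctan_deriv t \<in> C0"
  unfolding arctan_deriv_eq[OF t, abs_def] using t
  by (intro C0_scale C0_add C0_resolvent i_real_nonreal) auto

lemma arctan_mean_value:
  "\<exists>u. min s t \<le> u \<and> u \<le> max s t \<and> arctan (s * x) - arctan (t * x) = (s - t) * (x / (1 + (u * x)\<^sup>2))"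
    for s t x :: real
proof -
  have der: "((\<lambda>t. arctan (t * x)) has_real_derivative x / (1 + (u * x)\<^sup>2)) (at u)" for u
    by (auto intro!: derivative_eq_intros simp: divide_inverse)
  consider "s < t" | "s = t" | "t < s" by linarith
  then show ?thesis
  proof cases
    case 1
    then obtain u where "s < u" "u < t" "arctan (t * x) - arctan (s * x) = (t - s) * (x / (1 + (u * x)\<^sup>2))"
      using MVT2[of s t "\<lambda>t. arctan (t * x)" "\<lambda>u. x / (1 + (u * x)\<^sup>2)"] der by blast
    moreover from this(3) have "arctan (s * x) - arctan (t * x) = (s - t) * (x / (1 + (u * x)\<^sup>2))"
      by (metis minus_diff_eq minus_mult_left)
    ultimately show ?thesis by (intro exI[of _ u]) auto
  next
    case 2
    then show ?thesis by auto
  next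
    case 3
    then obtain u where "t < u" "u < s" "arctan (s * x) - arctan (t * x) = (s - t) * (x / (1 + (u * x)\<^sup>2))"
      using MVT2[of t s "\<lambda>t. arctan (t * x)" "\<lambda>u. x / (1 + (u * x)\<^sup>2)"] der by blast
    then show ?thesis by (intro exI[of _ u]) auto
  qed
qed

text \<open>Over the common denominator \<open>A B\<close> the factor \<open>t - u\<close> splits
  off. The remaining numerator is controlled uniformly in \<open>x\<close> by
  \<open>|t x| \<le> B\<close> and \<open>x^2 \<le> A / m^2\<close>, and symmetrically. The constant
  blows up as \<open>m\<close> tends to 0, so the estimate is used only away from 0.\<close>

lemma arctan_deriv_lipschitz:
  fixes m t u x :: real
  assumes m: "m > 0" "t \<ge> m" "u \<ge> m"
  shows "\<bar>x / (1 + (u * x)\<^sup>2) - x / (1 + (t * x)\<^sup>2)\<bar> \<le> 2 / m\<^sup>2 * \<bar>t - u\<bar>"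
proof -
  define A B where "A = 1 + (u * x)\<^sup>2" and "B = 1 + (t * x)\<^sup>2"
  have A: "A > 0" and B: "B > 0" unfolding A_def B_def by (rule one_plus_square_pos)+
  have "x / A - x / B = (t - u) * ((t * x) * x\<^sup>2 + (u * x) * x\<^sup>2) / (A * B)"
  proof -
    have "x / A - x / B = x * (B - A) / (A * B)" using A B by (simp add: field_simps)
    moreover have "x * (B - A) = (t - u) * ((t * x) * x\<^sup>2 + (u * x) * x\<^sup>2)"
      unfolding A_def B_def by (simp add: algebra_simps power2_eq_square)
    ultimately show ?thesis by simp
  qed
  then have "\<bar>x / A - x / B\<bar> = \<bar>t - u\<bar> * \<bar>(t * x) * x\<^sup>2 + (u * x) * x\<^sup>2\<bar> / (A * B)"
    using A B by (simp add: abs_mult)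
  also have "\<bar>(t * x) * x\<^sup>2 + (u * x) * x\<^sup>2\<bar> \<le> 2 / m\<^sup>2 * (A * B)"
  proof -
    have le: "\<bar>v\<bar> \<le> 1 + v\<^sup>2" for v :: real
    proof -
      have "0 \<le> (\<bar>v\<bar> - 1)\<^sup>2" by simp
      then have "2 * \<bar>v\<bar> \<le> 1 + v\<^sup>2" by (simp add: power2_diff)
      then show ?thesis by linarith
    qed
    have sq: "x\<^sup>2 \<le> (1 + (v * x)\<^sup>2) / m\<^sup>2" if "v \<ge> m" for v
    proof -
      have "m\<^sup>2 * x\<^sup>2 \<le> v\<^sup>2 * x\<^sup>2" using that m(1) by (intro mult_right_mono power_mono) auto
      then have "m\<^sup>2 * x\<^sup>2 \<le> 1 + (v * x)\<^sup>2" unfolding power_mult_distrib by linarith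
      then show ?thesis using m(1) by (simp add: field_simps)
    qed
    have "\<bar>(t * x) * x\<^sup>2\<bar> \<le> B * (A / m\<^sup>2)"
      unfolding abs_mult[of "t * x"] A_def B_def using le[of "t * x"] sq[OF m(3)]
      by (intro mult_mono) auto
    moreover have "\<bar>(u * x) * x\<^sup>2\<bar> \<le> A * (B / m\<^sup>2)"
      unfolding abs_mult[of "u * x"] A_def B_def using le[of "u * x"] sq[OF m(2)]
      by (intro mult_mono) auto
    ultimately have "\<bar>(t * x) * x\<^sup>2 + (u * x) * x\<^sup>2\<bar> \<le> B * (A / m\<^sup>2) + A * (B / m\<^sup>2)"
      using abs_triangle_ineq[of "(t * x) * x\<^sup>2" "(u * x) * x\<^sup>2"] by linarith
    also have "\<dots> = 2 / m\<^sup>2 * (A * B)" by (simp add: field_simps)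
    finally show ?thesis .
  qed
  then have "\<bar>t - u\<bar> * \<bar>(t * x) * x\<^sup>2 + (u * x) * x\<^sup>2\<bar> / (A * B) \<le> \<bar>t - u\<bar> * (2 / m\<^sup>2 * (A * B)) / (A * B)"
    using A B by (intro divide_right_mono mult_left_mono) auto
  also have "\<dots> = 2 / m\<^sup>2 * \<bar>t - u\<bar>" using A B by simp
  finally show ?thesis unfolding A_def B_def .
qed

text \<open>The quadratic remainder is uniform in \<open>x\<close>, which contractivity of the
  calculus turns into differentiability in operator norm.\<close>

lemma arctan_fun_taylor:
  assumes m: "m > 0" "t \<ge> m" "s \<ge> m"
  shows "cmod (arctan_fun s x - arctan_fun t x - of_real (s - t) * arctan_deriv t x) \<le> 2 / m\<^sup>2 * \<bar>s - t\<bar>\<^sup>2"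
proof -
  obtain u where u: "min s t \<le> u" "u \<le> max s t"
    "arctan (s * x) - arctan (t * x) = (s - t) * (x / (1 + (u * x)\<^sup>2))"
    using arctan_mean_value by blast
  let ?q = "x / (1 + (u * x)\<^sup>2) - x / (1 + (t * x)\<^sup>2)"
  have "arctan_fun s x - arctan_fun t x - of_real (s - t) * arctan_deriv t x
      = of_real (- (2 / pi) * (arctan (s * x) - arctan (t * x)) - (s - t) * (- 2 / pi * (x / (1 + (t * x)\<^sup>2))))"
    unfolding arctan_fun_def arctan_deriv_def by (simp add: algebra_simps)
  also have "- (2 / pi) * (arctan (s * x) - arctan (t * x)) - (s - t) * (- 2 / pi * (x / (1 + (t * x)\<^sup>2)))
      = - (2 / pi) * ((s - t) * ?q)"
  proof -
    have "- (2 / pi) * ((s - t) * p) - (s - t) * (- 2 / pi * q) = - (2 / pi) * ((s - t) * (p - q))" for p q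
      by (simp add: algebra_simps diff_divide_distrib)
    then show ?thesis unfolding u(3) .
  qed
  finally have "cmod (arctan_fun s x - arctan_fun t x - of_real (s - t) * arctan_deriv t x)
      = (2 / pi) * (\<bar>s - t\<bar> * \<bar>?q\<bar>)"
    by (simp only: norm_of_real abs_mult abs_minus_cancel) simp
  also have "\<dots> \<le> 1 * (\<bar>s - t\<bar> * (2 / m\<^sup>2 * \<bar>s - t\<bar>))"
  proof (intro mult_mono)
    have "\<bar>?q\<bar> \<le> 2 / m\<^sup>2 * \<bar>t - u\<bar>"
      by (rule arctan_deriv_lipschitz) (use m u in auto)
    also have "\<dots> \<le> 2 / m\<^sup>2 * \<bar>s - t\<bar>" using u(1,2) by (intro mult_left_mono) auto
    finally show "\<bar>?q\<bar> \<le> 2 / m\<^sup>2 * \<bar>s - t\<bar>" .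
  qed (use pi_ge_two in auto)
  finally show ?thesis by (simp add: power2_eq_square mult_ac)
qed

context self_adjoint_operator
begin

lemma fun_calc_arctan_deriv:
  assumes t: "t > 0"
  shows "((\<lambda>t. fun_calc D (arctan_fun t)) has_vector_derivative fun_calc D (arctan_deriv t)) (at t)"
  unfolding has_vector_derivative_def has_derivative_iff_norm
proof (intro conjI)
  show "bounded_linear (\<lambda>h. h *\<^sub>R fun_calc D (arctan_deriv t))"
    by (rule bounded_linear_scaleR_left)
  \<comment> \<open>Half of \<open>t\<close> keeps a whole neighbourhood of \<open>t\<close> away
    from 0, with one fixed constant \<open>2 / m^2\<close>.\<close>
  define m where "m = t / 2"
  have m: "m > 0" "t \<ge> m" using t by (auto simp: m_def)
  have bound: "norm (fun_calc D (arctan_fun s) - fun_calc D (arctan_fun t) - (s - t) *\<^sub>R fun_calc D (arctan_deriv t))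
      / norm (s - t) \<le> 2 / m\<^sup>2 * \<bar>s - t\<bar>" if s: "s \<ge> m" for s
  proof -
    have s0: "s > 0" using s m by simp
    have "fun_calc D (arctan_fun s) - fun_calc D (arctan_fun t) - (s - t) *\<^sub>R fun_calc D (arctan_deriv t)
        = fun_calc D (\<lambda>x. arctan_fun s x - arctan_fun t x - of_real (s - t) * arctan_deriv t x)"
      unfolding scale_op_of_real[symmetric]
      by (simp add: fun_calc_diff fun_calc_scale C0_arctan_fun C0_arctan_deriv s0 t C0_diff C0_scale
          del: of_real_diff)
    also have "norm \<dots> \<le> 2 / m\<^sup>2 * \<bar>s - t\<bar>\<^sup>2"
      by (rule norm_fun_calc_le) (intro C0_diff C0_scale C0_arctan_fun C0_arctan_deriv s0 t arctan_fun_taylor m s)+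
    finally show ?thesis
      by (cases "s = t") (auto simp: field_simps power2_eq_square)
  qed
  have "((\<lambda>s. 2 / m\<^sup>2 * \<bar>s - t\<bar>) \<longlongrightarrow> 2 / m\<^sup>2 * \<bar>t - t\<bar>) (at t)"
    by (intro tendsto_intros)
  then have "((\<lambda>s. 2 / m\<^sup>2 * \<bar>s - t\<bar>) \<longlongrightarrow> 0) (at t)" by simp
  then show "((\<lambda>s. norm (fun_calc D (arctan_fun s) - fun_calc D (arctan_fun t)
      - (s - t) *\<^sub>R fun_calc D (arctan_deriv t)) / norm (s - t)) \<longlongrightarrow> 0) (at t)"
  proof (rule Lim_null_comparison[rotated])
    have "\<forall>\<^sub>F s in at t. s > m"
      by (rule order_tendstoD(1)[OF tendsto_ident_at]) (use t in \<open>simp add: m_def\<close>)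
    then show "\<forall>\<^sub>F s in at t. norm (norm (fun_calc D (arctan_fun s) - fun_calc D (arctan_fun t)
        - (s - t) *\<^sub>R fun_calc D (arctan_deriv t)) / norm (s - t)) \<le> 2 / m\<^sup>2 * \<bar>s - t\<bar>"
      by eventually_elim (use bound in simp)
  qed
qed

definition arctan_approx :: "nat \<Rightarrow> 'h \<Rightarrow>\<^sub>L 'h" where
  "arctan_approx n = fun_calc D (arctan_fun (inverse (real (Suc n))))"

lemma arctan_approx_strong_limit:
  "(\<lambda>n. blinfun_apply (arctan_approx n) y) \<longlonglongrightarrow> blinfun_apply (bounded_transform D) y"
proof (rule strong_limit_on_dense[OF _ dom_dense])
  let ?g = "\<lambda>n. arctan_fun (inverse (real (Suc n)))"
  have g: "?g n \<in> C0" for n by (rule C0_arctan_fun) simp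
  show "norm (arctan_approx n) \<le> 2" for n
    unfolding arctan_approx_def
  proof (rule norm_fun_calc_le[OF g])
    fix x
    have "cmod (?g n x) \<le> cmod (transform_fun x) + cmod (?g n x - transform_fun x)"
      by (rule norm_triangle_sub)
    then show "cmod (?g n x) \<le> 2"
      using cmod_transform_fun_le[of x] cmod_arctan_fun_diff(1)[of "inverse (real (Suc n))" x] by linarith
  qed
  fix y assume "y \<in> dom D"
  then obtain z where z: "y = blinfun_apply (resolvent D \<i>) z" using dom_resolvent by blast
  let ?r = "\<lambda>x. inverse (\<i> - complex_of_real x)"
  have r: "?r \<in> C0" by (rule C0_resolvent[OF nonreal_i(1)])
  have "(\<lambda>n. fun_calc D (\<lambda>x. ?g n x * ?r x)) \<longlonglongrightarrow> fun_calc D (\<lambda>x. transform_fun x * ?r x)"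
  proof (rule fun_calc_tendsto[OF r])
    show "(\<lambda>x. ?g n x * ?r x) \<in> C0" for n by (intro C0_mult g r)
    show "cmod (?g n x - transform_fun x) \<le> 1" for n x by (rule cmod_arctan_fun_diff)
    show "cmod (?g n x - transform_fun x) \<le> inverse (real (Suc n)) * (1 + x\<^sup>2)" for n x
      by (rule cmod_arctan_fun_diff) simp
  qed (rule C0_transform_mult[OF r] LIMSEQ_inverse_real_of_nat)+
  then have "(\<lambda>n. arctan_approx n o\<^sub>L fun_calc D ?r) \<longlonglongrightarrow> (bounded_transform D o\<^sub>L fun_calc D ?r)"
    unfolding arctan_approx_def fun_calc_mult[OF g r] bounded_transform_fun_calc[OF r] .
  from tendsto_blinfun_apply_const[OF this, of z]
  show "(\<lambda>n. blinfun_apply (arctan_approx n) y) \<longlonglongrightarrow> blinfun_apply (bounded_transform D) y"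
    unfolding fun_calc_resolvent[OF nonreal_i(1)] z by simp
qed

end

section \<open>Norm estimates for one operator with bounded commutator\<close>

locale bounded_commutator = self_adjoint_operator D for D :: "'h::complex_hilbert_space unbounded_op" +
  fixes a T :: "'h \<Rightarrow>\<^sub>L 'h"
  assumes a: "a \<in> bounded_ops" "blinfun_apply a ` dom D \<subseteq> dom D"
    and T: "\<And>x. x \<in> dom D \<Longrightarrow> blinfun_apply T x = D_val (blinfun_apply a x) - blinfun_apply a (D_val x)"
begin

lemma norm_commutator_resolvent:
  assumes m: "m \<noteq> 0"
  shows "norm (commutator (resolvent D (\<i> * of_real m)) a) \<le> norm T / m\<^sup>2"
proof -
  let ?R = "resolvent D (\<i> * of_real m)"
  have l: "\<i> * of_real m \<notin> \<real>" by (rule i_real_nonreal[OF m])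
  have R: "norm ?R \<le> inverse \<bar>m\<bar>" using norm_resolvent[OF l] by simp
  have "norm (?R o\<^sub>L T o\<^sub>L ?R) \<le> norm (?R o\<^sub>L T) * norm ?R"
    by (rule norm_blinfun_compose)
  also have "\<dots> \<le> (norm ?R * norm T) * norm ?R"
    by (intro mult_right_mono norm_blinfun_compose norm_ge_zero)
  also have "\<dots> \<le> (inverse \<bar>m\<bar> * norm T) * inverse \<bar>m\<bar>"
    by (intro mult_mono R order_refl) auto
  also have "\<dots> = norm T / m\<^sup>2"
    using m by (simp add: field_simps power2_eq_square flip: abs_mult)
  moreover have "commutator ?R a = ?R o\<^sub>L T o\<^sub>L ?R"
    by (rule commutator_resolvent[OF l a]) (rule T)
  ultimately show ?thesis by simp
qed

text \<open>The prefactor in \<open>cutoff_eq\<close> grows linearly in \<open>Suc n\<close> while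
  the two resolvent commutators decay quadratically, which leaves one power of decay.\<close>

lemma norm_commutator_cutoff: "norm (commutator (fun_calc D (cutoff n)) a) \<le> norm T / real (Suc n)"
proof -
  let ?m = "real (Suc n)"
  let ?P = "commutator (resolvent D (\<i> * of_real ?m)) a" and ?Q = "commutator (resolvent D (\<i> * of_real (- ?m))) a"
  have nr: "\<i> * complex_of_real ?m \<notin> \<real>" "\<i> * complex_of_real (- ?m) \<notin> \<real>"
    by (rule i_real_nonreal; simp)+
  have "fun_calc D (cutoff n) = scale_op (\<i> * of_real ?m / 2)
      (resolvent D (\<i> * of_real ?m) - resolvent D (\<i> * of_real (- ?m)))"
    unfolding cutoff_eq[abs_def] fun_calc_resolvent[OF nr(1), symmetric] fun_calc_resolvent[OF nr(2), symmetric]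
    by (simp only: fun_calc_scale fun_calc_diff C0_resolvent[OF nr(1)] C0_resolvent[OF nr(2)] C0_diff)
  then have "commutator (fun_calc D (cutoff n)) a = scale_op (\<i> * of_real ?m / 2) (?P - ?Q)"
    by (simp only: commutator_scale_left[OF a(1)] commutator_diff_left)
  then have "norm (commutator (fun_calc D (cutoff n)) a) \<le> cmod (\<i> * of_real ?m / 2) * norm (?P - ?Q)"
    using norm_scale_op by metis
  also have "\<dots> \<le> ?m / 2 * (norm T / ?m\<^sup>2 + norm T / (- ?m)\<^sup>2)"
    using norm_triangle_ineq4[of ?P ?Q] norm_commutator_resolvent[of ?m] norm_commutator_resolvent[of "- ?m"]
    by (intro mult_mono) (auto simp: norm_divide norm_mult simp del: of_nat_Suc)
  also have "\<dots> = norm T / ?m" by (simp add: field_simps power2_eq_square del: of_nat_Suc)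
  finally show ?thesis .
qed

text \<open>The poles sit at distance \<open>1 / t\<close> from the real line, so each resolvent
  commutator contributes a factor \<open>t^2\<close>. This cancels the prefactor
  \<open>1 / (pi t^2)\<close> exactly and makes the bound independent of \<open>t\<close>.\<close>

lemma norm_commutator_arctan_deriv:
  assumes t: "t > 0"
  shows "norm (commutator (fun_calc D (arctan_deriv t)) a) \<le> norm T"
proof -
  let ?m = "1 / t"
  let ?P = "commutator (resolvent D (\<i> * of_real ?m)) a" and ?Q = "commutator (resolvent D (\<i> * of_real (- ?m))) a"
  have m: "?m \<noteq> 0" "- ?m \<noteq> 0" using t by auto
  note nr = m[THEN i_real_nonreal]
  have "fun_calc D (arctan_deriv t) = scale_op (of_real (1 / (pi * t\<^sup>2)))
      (resolvent D (\<i> * of_real ?m) + resolvent D (\<i> * of_real (- ?m)))"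
    unfolding arctan_deriv_eq[OF t, abs_def] fun_calc_resolvent[OF nr(1), symmetric] fun_calc_resolvent[OF nr(2), symmetric]
    by (simp only: fun_calc_scale fun_calc_add C0_resolvent[OF nr(1)] C0_resolvent[OF nr(2)] C0_add)
  then have "commutator (fun_calc D (arctan_deriv t)) a = scale_op (of_real (1 / (pi * t\<^sup>2))) (?P + ?Q)"
    by (simp only: commutator_scale_left[OF a(1)] commutator_add_left)
  then have "norm (commutator (fun_calc D (arctan_deriv t)) a) \<le> cmod (of_real (1 / (pi * t\<^sup>2))) * norm (?P + ?Q)"
    using norm_scale_op by metis
  also have "\<dots> \<le> 1 / (pi * t\<^sup>2) * (norm T / ?m\<^sup>2 + norm T / (- ?m)\<^sup>2)"
    using norm_triangle_ineq[of ?P ?Q] norm_commutator_resolvent[OF m(1)] norm_commutator_resolvent[OF m(2)]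
    unfolding norm_of_real by (intro mult_mono) (auto simp: abs_mult)
  also have "\<dots> = 2 / pi * norm T" using t by (simp add: field_simps power2_eq_square)
  also have "\<dots> \<le> 1 * norm T" using pi_ge_two by (intro mult_right_mono) auto
  finally show ?thesis by simp
qed

text \<open>The commutator bounds are uniform in \<open>t\<close>, so the norm limit \<open>t \<rightarrow> 0\<close> exists although
  \<open>arctan_fun t\<close> itself does not converge uniformly.\<close>

lemma commutator_arctan_lipschitz:
  assumes "s > 0" "t > 0"
  shows "norm (commutator (fun_calc D (arctan_fun s)) a - commutator (fun_calc D (arctan_fun t)) a)
    \<le> norm T * \<bar>s - t\<bar>"
proof -
  let ?f = "\<lambda>t. commutator (fun_calc D (arctan_fun t)) a"
  have "norm (?f s - ?f t) \<le> norm T * norm (s - t)"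
  proof (rule differentiable_bound[where S="{0<..}" and f'="\<lambda>t h. h *\<^sub>R commutator (fun_calc D (arctan_deriv t)) a"])
    fix u :: real assume u: "u \<in> {0<..}"
    have "(?f has_vector_derivative commutator (fun_calc D (arctan_deriv u)) a) (at u)"
      by (rule bounded_linear.has_vector_derivative[OF bounded_linear_commutator_left fun_calc_arctan_deriv])
         (use u in simp)
    then show "(?f has_derivative (\<lambda>h. h *\<^sub>R commutator (fun_calc D (arctan_deriv u)) a)) (at u within {0<..})"
      unfolding has_vector_derivative_def by (rule has_derivative_at_withinI)
    show "onorm (\<lambda>h. h *\<^sub>R commutator (fun_calc D (arctan_deriv u)) a) \<le> norm T"
    proof (rule onorm_bound)
      fix h :: real
      show "norm (h *\<^sub>R commutator (fun_calc D (arctan_deriv u)) a) \<le> norm T * norm h"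
        using mult_left_mono[OF norm_commutator_arctan_deriv[of u] abs_ge_zero[of h]] u by (simp add: mult.commute)
    qed simp
  qed (use assms in auto)
  then show ?thesis by simp
qed

text \<open>The Lipschitz bound yields norm convergence to some limit; the strong convergence of
  \<open>arctan_approx\<close> serves to identify it.\<close>

lemma commutator_bounded_transform_limit:
  "(\<lambda>n. commutator (arctan_approx n) a) \<longlonglongrightarrow> commutator (bounded_transform D) a"
proof -
  let ?K = "\<lambda>n. commutator (arctan_approx n) a"
  have lip: "dist (?K m) (?K n) \<le> norm T * dist (inverse (real (Suc m))) (inverse (real (Suc n)))" for m n
    unfolding arctan_approx_def dist_norm real_norm_def by (rule commutator_arctan_lipschitz) auto
  have "Cauchy ?K"
  proof (rule metric_CauchyI)
    fix e :: real assume "e > 0"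
    then have "e / (norm T + 1) > 0" by (simp add: add_nonneg_pos)
    then obtain k where k: "\<And>m n. m \<ge> k \<Longrightarrow> n \<ge> k \<Longrightarrow>
        dist (inverse (real (Suc m))) (inverse (real (Suc n))) < e / (norm T + 1)"
      using metric_CauchyD[OF LIMSEQ_imp_Cauchy[OF LIMSEQ_inverse_real_of_nat]] by blast
    have "dist (?K m) (?K n) < e" if "m \<ge> k" "n \<ge> k" for m n
    proof -
      have "dist (?K m) (?K n) \<le> norm T * (e / (norm T + 1))"
        using lip[of m n] k[OF that] by (meson less_imp_le mult_left_mono norm_ge_zero order_trans)
      also have "\<dots> < e"
      proof -
        have "norm T + 1 > 0" by (simp add: add_nonneg_pos)
        moreover have "norm T * e < e * (norm T + 1)" using \<open>e > 0\<close> by (simp add: algebra_simps)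
        ultimately show ?thesis unfolding times_divide_eq_right by (simp only: pos_divide_less_eq)
      qed
      finally show ?thesis .
    qed
    then show "\<exists>k. \<forall>m\<ge>k. \<forall>n\<ge>k. dist (?K m) (?K n) < e" by blast
  qed
  then obtain L where L: "?K \<longlonglongrightarrow> L"
    unfolding Cauchy_convergent_iff convergent_def by blast
  have "L = commutator (bounded_transform D) a"
  proof (rule blinfun_eqI)
    fix y
    have "(\<lambda>n. blinfun_apply (?K n) y) \<longlonglongrightarrow> blinfun_apply (commutator (bounded_transform D) a) y"
      unfolding commutator_def blinfun_simps blinfun_apply_blinfun_compose
      by (intro tendsto_diff blinfun.tendsto tendsto_const arctan_approx_strong_limit)
    then show "blinfun_apply L y = blinfun_apply (commutator (bounded_transform D) a) y"
      using LIMSEQ_unique tendsto_blinfun_apply_const[OF L] by blast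
  qed
  then show ?thesis using L by simp
qed

end

section \<open>The algebra of a spectral triple\<close>

text \<open>The points of \<open>C\<close> may lie outside \<open>B\<close>. Each small ball around
  such a point that meets \<open>B\<close> therefore contributes one chosen point of
  \<open>B\<close>.\<close>

lemma separable_space_subset_closure:
  fixes B :: "'a::metric_space set"
  assumes C: "countable C" "B \<subseteq> closure C"
  shows "separable_space (top_of_set B)"
proof -
  define I where "I = {(c, k::nat). c \<in> C \<and> B \<inter> ball c (inverse (Suc k)) \<noteq> {}}"
  define g where "g = (\<lambda>(c, k::nat). SOME b. b \<in> B \<inter> ball c (inverse (Suc k)))"
  have g: "g (c, k) \<in> B \<inter> ball c (inverse (Suc k))" if "(c, k) \<in> I" for c k
    unfolding g_def prod.case by (rule someI_ex) (use that in \<open>auto simp: I_def\<close>)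
  have "countable I"
    by (rule countable_subset[of _ "C \<times> UNIV"]) (use C(1) in \<open>auto simp: I_def\<close>)
  then have "countable (g ` I)" by (rule countable_image)
  moreover have sub: "g ` I \<subseteq> B" using g by auto
  moreover have "b \<in> closure (g ` I)" if b: "b \<in> B" for b
    unfolding closure_approachable
  proof (intro allI impI)
    fix e :: real assume "e > 0"
    then obtain k where k: "inverse (Suc k) < e / 2"
      using reals_Archimedean[of "e / 2"] by auto
    have "inverse (real (Suc k)) > 0" by simp
    moreover have "b \<in> closure C" using b C(2) by blast
    ultimately obtain c where c: "c \<in> C" "dist c b < inverse (Suc k)"
      unfolding closure_approachable by blast
    then have ck: "(c, k) \<in> I" using b by (auto simp: I_def)
    have "dist (g (c, k)) b \<le> dist c (g (c, k)) + dist c b" by metric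
    then have "dist (g (c, k)) b < e" using g[OF ck] c(2) k by auto
    then show "\<exists>y\<in>g ` I. dist y b < e" using ck by blast
  qed
  then have "top_of_set B closure_of (g ` I) = B"
    using sub by (auto simp: closure_of_subtopology inf_absorb2 Int_absorb1)
  ultimately show ?thesis
    unfolding separable_space_def topspace_euclidean_subtopology by blast
qed

lemma separable_space_countable_dense:
  fixes A :: "'a::metric_space set"
  assumes "separable_space (top_of_set A)"
  obtains C where "countable C" "C \<subseteq> A" "A \<subseteq> closure C"
proof -
  obtain C where C: "countable C" "C \<subseteq> A" "top_of_set A closure_of C = A"
    using assms unfolding separable_space_def topspace_euclidean_subtopology by blast
  then have "A \<subseteq> closure C" by (auto simp: closure_of_subtopology Int_absorb1)
  then show thesis using C that by blast
qed

text \<open>The maps \<open>L n\<close> are uniformly contractive, so convergence passes to limits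
  of points by an \<open>e / 3\<close> argument.\<close>

lemma closed_tendsto_self:
  fixes L :: "nat \<Rightarrow> 'a::real_normed_vector \<Rightarrow> 'a"
  assumes diff: "\<And>n x y. L n (x - y) = L n x - L n y" and bound: "\<And>n x. norm (L n x) \<le> norm x"
  shows "closed {b. (\<lambda>n. L n b) \<longlonglongrightarrow> b}"
proof -
  have "b \<in> {b. (\<lambda>n. L n b) \<longlonglongrightarrow> b}" if b: "b \<in> closure {b. (\<lambda>n. L n b) \<longlonglongrightarrow> b}" for b
  proof (rule CollectI, rule metric_LIMSEQ_I)
    fix e :: real assume "e > 0"
    then have e: "e / 3 > 0" by simp
    then obtain c where c: "(\<lambda>n. L n c) \<longlonglongrightarrow> c" "dist c b < e / 3"
      using b unfolding closure_approachable by blast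
    obtain k where k: "\<And>n. n \<ge> k \<Longrightarrow> dist (L n c) c < e / 3"
      using metric_LIMSEQ_D[OF c(1) e] by blast
    have "dist (L n b) b < e" if "n \<ge> k" for n
    proof -
      have "dist (L n b) (L n c) \<le> dist c b"
        using bound[of n "b - c"] by (simp add: diff dist_norm norm_minus_commute)
      moreover have "dist (L n b) b \<le> dist (L n b) (L n c) + dist (L n c) c + dist c b" by metric
      ultimately show ?thesis using k[OF that] c(2) by linarith
    qed
    then show "\<exists>k. \<forall>n\<ge>k. dist (L n b) b < e" by blast
  qed
  then show ?thesis using closure_subset_eq by blast
qed

section \<open>Operators absorbed by an approximate unit\<close>

locale approximate_unit =
  fixes e :: "nat \<Rightarrow> 'h::complex_hilbert_space \<Rightarrow>\<^sub>L 'h"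
  assumes e_bounded_ops: "\<And>n. e n \<in> bounded_ops"
    and adj_e: "\<And>n. adj (e n) = e n"
    and norm_e: "\<And>n. norm (e n) \<le> 1"
begin

text \<open>The two sides are treated separately because they behave differently: multiplication on
  the far side by any bounded operator is harmless, while on the near side the multiplier has to
  commute asymptotically with \<open>e n\<close>.\<close>

definition left_absorbed :: "('h \<Rightarrow>\<^sub>L 'h) set" where
  "left_absorbed = {b \<in> bounded_ops. (\<lambda>n. e n o\<^sub>L b) \<longlonglongrightarrow> b}"

definition right_absorbed :: "('h \<Rightarrow>\<^sub>L 'h) set" where
  "right_absorbed = {b \<in> bounded_ops. (\<lambda>n. b o\<^sub>L e n) \<longlonglongrightarrow> b}"

lemma closed_left_absorbed: "closed left_absorbed"
proof -
  have "norm (e n o\<^sub>L b) \<le> norm b" for n b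
    using norm_blinfun_compose[of "e n" b] mult_right_mono[OF norm_e[of n] norm_ge_zero[of b]] by linarith
  then have "closed {b. (\<lambda>n. e n o\<^sub>L b) \<longlonglongrightarrow> b}"
    by (intro closed_tendsto_self) (auto simp: blinfun_compose_simps)
  then show ?thesis
    unfolding left_absorbed_def using closed_bounded_ops closed_Int by (simp add: Collect_conj_eq)
qed

lemma closed_right_absorbed: "closed right_absorbed"
proof -
  have "norm (b o\<^sub>L e n) \<le> norm b" for n b
    using norm_blinfun_compose[of b "e n"] mult_left_mono[OF norm_e[of n] norm_ge_zero[of b]] by linarith
  then have "closed {b. (\<lambda>n. b o\<^sub>L e n) \<longlonglongrightarrow> b}"
    by (intro closed_tendsto_self) (auto simp: blinfun_compose_simps)
  then show ?thesis
    unfolding right_absorbed_def using closed_bounded_ops closed_Int by (simp add: Collect_conj_eq)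
qed

lemma left_absorbed_diff:
  assumes "b \<in> left_absorbed" "c \<in> left_absorbed"
  shows "b - c \<in> left_absorbed"
  using assms tendsto_diff[of "\<lambda>n. e n o\<^sub>L b" b sequentially "\<lambda>n. e n o\<^sub>L c" c]
  by (simp add: left_absorbed_def blinfun_compose_simps bounded_ops_diff)

lemma right_absorbed_diff:
  assumes "b \<in> right_absorbed" "c \<in> right_absorbed"
  shows "b - c \<in> right_absorbed"
  using assms tendsto_diff[of "\<lambda>n. b o\<^sub>L e n" b sequentially "\<lambda>n. c o\<^sub>L e n" c]
  by (simp add: right_absorbed_def blinfun_compose_simps bounded_ops_diff)

lemma left_absorbed_compose:
  assumes "b \<in> left_absorbed" "S \<in> bounded_ops"
  shows "b o\<^sub>L S \<in> left_absorbed"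
proof -
  have "(\<lambda>n. (e n o\<^sub>L b) o\<^sub>L S) \<longlonglongrightarrow> (b o\<^sub>L S)"
    using assms by (intro tendsto_blinfun_compose tendsto_const) (simp add: left_absorbed_def)
  then show ?thesis
    using assms by (simp add: left_absorbed_def blinfun_compose_assoc bounded_ops_compose)
qed

lemma right_absorbed_compose:
  assumes "b \<in> right_absorbed" "S \<in> bounded_ops"
  shows "S o\<^sub>L b \<in> right_absorbed"
proof -
  have "(\<lambda>n. S o\<^sub>L (b o\<^sub>L e n)) \<longlonglongrightarrow> (S o\<^sub>L b)"
    using assms by (intro tendsto_blinfun_compose tendsto_const) (simp add: right_absorbed_def)
  then show ?thesis
    using assms by (simp add: right_absorbed_def blinfun_compose_assoc bounded_ops_compose)
qed

text \<open>Write \<open>e S b = S e b + [e, S] b\<close>; the first term tends to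
  \<open>S b\<close> and the second to 0.\<close>

lemma left_absorbed_almost_commuting:
  assumes b: "b \<in> left_absorbed" and S: "S \<in> bounded_ops" "(\<lambda>n. commutator (e n) S) \<longlonglongrightarrow> 0"
  shows "S o\<^sub>L b \<in> left_absorbed"
proof -
  have "(\<lambda>n. (S o\<^sub>L (e n o\<^sub>L b)) + (commutator (e n) S o\<^sub>L b)) \<longlonglongrightarrow> (S o\<^sub>L b) + (0 o\<^sub>L b)"
    using b by (intro tendsto_add tendsto_blinfun_compose tendsto_const S(2)) (simp add: left_absorbed_def)
  moreover have "(S o\<^sub>L (e n o\<^sub>L b)) + (commutator (e n) S o\<^sub>L b) = e n o\<^sub>L (S o\<^sub>L b)" for n
    by (auto intro!: blinfun_eqI simp: commutator_def blinfun_simps)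
  ultimately show ?thesis
    using b S(1) by (simp add: left_absorbed_def bounded_ops_compose)
qed

lemma right_absorbed_almost_commuting:
  assumes b: "b \<in> right_absorbed" and S: "S \<in> bounded_ops" "(\<lambda>n. commutator (e n) S) \<longlonglongrightarrow> 0"
  shows "b o\<^sub>L S \<in> right_absorbed"
proof -
  have "(\<lambda>n. ((b o\<^sub>L e n) o\<^sub>L S) - (b o\<^sub>L commutator (e n) S)) \<longlonglongrightarrow> (b o\<^sub>L S) - (b o\<^sub>L 0)"
    using b by (intro tendsto_diff tendsto_blinfun_compose tendsto_const S(2)) (simp add: right_absorbed_def)
  moreover have "((b o\<^sub>L e n) o\<^sub>L S) - (b o\<^sub>L commutator (e n) S) = (b o\<^sub>L S) o\<^sub>L e n" for n
    by (auto intro!: blinfun_eqI simp: commutator_def blinfun_simps)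
  ultimately show ?thesis
    using b S(1) by (simp add: right_absorbed_def bounded_ops_compose)
qed

lemma adj_absorbed:
  "b \<in> left_absorbed \<Longrightarrow> adj b \<in> right_absorbed" "b \<in> right_absorbed \<Longrightarrow> adj b \<in> left_absorbed"
proof -
  show "adj b \<in> right_absorbed" if b: "b \<in> left_absorbed"
  proof -
    have b': "b \<in> bounded_ops" "(\<lambda>n. e n o\<^sub>L b) \<longlonglongrightarrow> b" using b by (auto simp: left_absorbed_def)
    have "(\<lambda>n. adj (e n o\<^sub>L b)) \<longlonglongrightarrow> adj b"
      by (intro tendsto_adj bounded_ops_compose b' e_bounded_ops)
    then show ?thesis
      by (simp add: right_absorbed_def adj_compose adj_e e_bounded_ops b'(1) adj_bounded_ops)
  qed
  show "adj b \<in> left_absorbed" if b: "b \<in> right_absorbed"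
  proof -
    have b': "b \<in> bounded_ops" "(\<lambda>n. b o\<^sub>L e n) \<longlonglongrightarrow> b" using b by (auto simp: right_absorbed_def)
    have "(\<lambda>n. adj (b o\<^sub>L e n)) \<longlonglongrightarrow> adj b"
      by (intro tendsto_adj bounded_ops_compose b' e_bounded_ops)
    then show ?thesis
      by (simp add: left_absorbed_def adj_compose adj_e e_bounded_ops b'(1) adj_bounded_ops)
  qed
qed

text \<open>In a product the left factor is absorbed on the left and the right factor on the right.
  Hence a generated C*-algebra has the approximate unit once its generators are absorbed.\<close>

lemma cstar_algebra_absorbed: "cstar_algebra (left_absorbed \<inter> right_absorbed)"
  unfolding cstar_algebra_def
proof (intro conjI star_algebraI)
  let ?V = "left_absorbed \<inter> right_absorbed"
  show sub: "?V \<subseteq> bounded_ops" by (auto simp: left_absorbed_def)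
  show zero: "0 \<in> ?V" by (simp add: left_absorbed_def right_absorbed_def bounded_ops_zero)
  show "closed ?V" by (intro closed_Int closed_left_absorbed closed_right_absorbed)
  fix b assume b: "b \<in> ?V"
  show "adj b \<in> ?V" using b adj_absorbed by blast
  show "scale_op c b \<in> ?V" for c
  proof -
    have "(\<lambda>n. scale_op c (e n o\<^sub>L b)) \<longlonglongrightarrow> scale_op c b" "(\<lambda>n. scale_op c (b o\<^sub>L e n)) \<longlonglongrightarrow> scale_op c b"
      using b by (auto intro!: tendsto_scale_op simp: left_absorbed_def right_absorbed_def)
    then show ?thesis
      using b by (auto simp: left_absorbed_def right_absorbed_def scale_op_compose_left
          scale_op_compose_right[OF e_bounded_ops] bounded_ops_scale)
  qed
  fix d assume d: "d \<in> ?V"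
  show "b o\<^sub>L d \<in> ?V" using b d sub left_absorbed_compose right_absorbed_compose by blast
  have "0 - d \<in> ?V" using zero d left_absorbed_diff right_absorbed_diff by blast
  then have "b - (0 - d) \<in> ?V" using b left_absorbed_diff right_absorbed_diff by blast
  then show "b + d \<in> ?V" by simp
qed

lemma multiplier_of_absorbed_subalgebra:
  assumes B: "cstar_algebra B" "B \<subseteq> left_absorbed" and S: "\<And>n. S o\<^sub>L e n \<in> B" and b: "b \<in> B"
  shows "S o\<^sub>L b \<in> B"
proof (rule closed_sequentially)
  show "closed B" using B(1) by (simp add: cstar_algebra_def)
  show "(S o\<^sub>L e n) o\<^sub>L b \<in> B" for n
    using star_algebraD(5)[of B] B(1) S b by (simp add: cstar_algebra_def)
  have "(\<lambda>n. S o\<^sub>L (e n o\<^sub>L b)) \<longlonglongrightarrow> (S o\<^sub>L b)"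
    using b B(2) by (intro tendsto_blinfun_compose tendsto_const) (auto simp: left_absorbed_def)
  then show "(\<lambda>n. (S o\<^sub>L e n) o\<^sub>L b) \<longlonglongrightarrow> (S o\<^sub>L b)" by (simp add: blinfun_compose_assoc)
qed

end

lemma left_mult_adjointable:
  assumes "S \<in> bounded_ops" "B \<subseteq> bounded_ops"
    and "\<And>b. b \<in> B \<Longrightarrow> S o\<^sub>L b \<in> B" "\<And>b. b \<in> B \<Longrightarrow> adj S o\<^sub>L b \<in> B"
  shows "left_mult S \<in> adjointable_ops B"
  unfolding adjointable_ops_def
proof (intro CollectI conjI exI[of _ "left_mult (adj S)"] ballI)
  fix x y assume "x \<in> B"
  then show "module_inner (left_mult S x) y = module_inner x (left_mult (adj S) y)"
    using assms(1,2) by (simp add: module_inner_def left_mult_def adj_compose blinfun_compose_assoc subset_iff)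
qed (use assms(3,4) in \<open>auto simp: left_mult_def\<close>)

locale unital_spectral_triple =
  fixes N J \<A> :: "('h::complex_hilbert_space \<Rightarrow>\<^sub>L 'h) set" and D :: "'h unbounded_op"
  assumes triple: "unital_vn_spectral_triple N J \<A> D"
begin

sublocale self_adjoint_operator D
  by standard (use triple in \<open>simp add: unital_vn_spectral_triple_def vn_spectral_triple_def\<close>)

abbreviation F :: "'h \<Rightarrow>\<^sub>L 'h" where "F \<equiv> bounded_transform D"

lemma vN: "von_neumann_algebra N"
  and J: "closed_ideal J N"
  and \<A>: "star_algebra \<A>" "\<A> \<subseteq> N" "id_blinfun \<in> \<A>"
  and resolvent_J: "a \<in> \<A> \<Longrightarrow> l \<notin> \<real> \<Longrightarrow> a o\<^sub>L resolvent D l \<in> J"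
  using triple by (auto simp: unital_vn_spectral_triple_def vn_spectral_triple_def)

lemma J_D:
  shows "J \<subseteq> N" "op_subspace J" "closed J"
    "\<And>S T. S \<in> J \<Longrightarrow> T \<in> N \<Longrightarrow> S o\<^sub>L T \<in> J" "\<And>S T. S \<in> J \<Longrightarrow> T \<in> N \<Longrightarrow> T o\<^sub>L S \<in> J"
  using J by (auto simp: closed_ideal_def)

lemma N_star: "star_algebra N"
  using vN by (simp add: von_neumann_algebra_def)

lemma \<A>_bounded_ops: "a \<in> \<A> \<Longrightarrow> a \<in> bounded_ops"
  using star_algebraD(1)[OF \<A>(1)] by blast

lemma bounded_commutator_exists:
  assumes "a \<in> \<A>"
  shows "\<exists>T. bounded_commutator D a T"
proof -
  have "blinfun_apply a ` dom D \<subseteq> dom D \<and> (\<exists>T\<in>bounded_ops. \<forall>x\<in>dom D.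
      blinfun_apply T x = the (D (blinfun_apply a x)) - blinfun_apply a (the (D x)))"
    using triple assms unfolding unital_vn_spectral_triple_def vn_spectral_triple_def by blast
  then obtain T where T: "blinfun_apply a ` dom D \<subseteq> dom D" "\<And>x. x \<in> dom D \<Longrightarrow>
      blinfun_apply T x = the (D (blinfun_apply a x)) - blinfun_apply a (the (D x))"
    by blast
  have "bounded_commutator D a T"
    by standard (use T \<A>_bounded_ops[OF assms] in \<open>auto simp: D_val_def\<close>)
  then show ?thesis by blast
qed

lemma commutator_F_limit:
  assumes "a \<in> \<A>"
  shows "(\<lambda>n. commutator (arctan_approx n) a) \<longlonglongrightarrow> commutator F a"
proof -
  obtain T where "bounded_commutator D a T" using bounded_commutator_exists[OF assms] by blast
  then show ?thesis by (rule bounded_commutator.commutator_bounded_transform_limit)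
qed

lemma arctan_approx_C0: "arctan_fun (inverse (real (Suc n))) \<in> C0"
  by (rule C0_arctan_fun) simp

subsection \<open>Containment in the ideal\<close>

lemma fun_calc_J: "f \<in> C0 \<Longrightarrow> fun_calc D f \<in> J"
  using resolvent_J[OF \<A>(3) nonreal_i(1)] resolvent_J[OF \<A>(3) nonreal_i(2)] J_D
  by (intro fun_calc_mem) auto

lemma F_N: "F \<in> N"
proof -
  have "F o\<^sub>L S = S o\<^sub>L F" if S: "S \<in> commutant N" for S
  proof (rule blinfun_eqI)
    fix y
    let ?T = "\<lambda>n. fun_calc D (\<lambda>x. cutoff n x * transform_fun x)"
    have "?T n \<in> N" for n using fun_calc_J[OF C0_cutoff_transform] J_D(1) by blast
    then have "?T n o\<^sub>L S = S o\<^sub>L ?T n" for n using S by (simp add: commutant_def)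
    then have eq: "blinfun_apply (?T n) (blinfun_apply S y) = blinfun_apply S (blinfun_apply (?T n) y)" for n
      by (metis blinfun_apply_blinfun_compose)
    have "(\<lambda>n. blinfun_apply S (blinfun_apply (?T n) y)) \<longlonglongrightarrow> blinfun_apply S (blinfun_apply F y)"
      by (intro blinfun.tendsto tendsto_const bounded_transform_limit)
    moreover have "(\<lambda>n. blinfun_apply S (blinfun_apply (?T n) y)) \<longlonglongrightarrow> blinfun_apply F (blinfun_apply S y)"
      unfolding eq[symmetric] by (rule bounded_transform_limit)
    ultimately show "blinfun_apply (F o\<^sub>L S) y = blinfun_apply (S o\<^sub>L F) y"
      using LIMSEQ_unique by simp
  qed
  then have "F \<in> commutant (commutant N)"
    unfolding commutant_def[of "commutant N"] using bounded_transform_bounded_ops by simp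
  then show ?thesis using vN by (simp add: von_neumann_algebra_def)
qed

lemma commutator_F_J:
  assumes a: "a \<in> \<A>"
  shows "commutator F a \<in> J"
proof (rule closed_sequentially[OF J_D(3) _ commutator_F_limit[OF a]])
  fix n
  have "arctan_approx n \<in> J" unfolding arctan_approx_def by (rule fun_calc_J[OF arctan_approx_C0])
  then show "commutator (arctan_approx n) a \<in> J"
    unfolding commutator_def using a \<A>(2) J_D by (intro op_subspace_diff[OF J_D(2)]) auto
qed

text \<open>The hull defining the triple algebra is minimal among C*-algebras, so it is compared
  with a C*-algebra inside \<open>J\<close> and not with \<open>J\<close> itself.\<close>

definition sym_ideal :: "('h \<Rightarrow>\<^sub>L 'h) set" where
  "sym_ideal = {b \<in> J. adj b \<in> J}"

lemma cstar_algebra_sym_ideal: "cstar_algebra sym_ideal"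
  unfolding cstar_algebra_def
proof (intro conjI star_algebraI)
  have J_bo: "J \<subseteq> bounded_ops" using J_D(2) by (simp add: op_subspace_def)
  then show "sym_ideal \<subseteq> bounded_ops" by (auto simp: sym_ideal_def)
  show "0 \<in> sym_ideal" using J_D(2) by (simp add: sym_ideal_def op_subspace_def)
  show "closed sym_ideal"
    unfolding closed_sequential_limits
  proof (intro allI impI, elim conjE)
    fix f b assume f: "\<forall>n. f n \<in> sym_ideal" and lim: "f \<longlonglongrightarrow> b"
    have b: "b \<in> J" by (rule closed_sequentially[OF J_D(3) _ lim]) (use f in \<open>simp add: sym_ideal_def\<close>)
    have "(\<lambda>n. adj (f n)) \<longlonglongrightarrow> adj b"
      by (rule tendsto_adj[OF _ _ lim]) (use f b J_bo in \<open>auto simp: sym_ideal_def\<close>)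
    then have "adj b \<in> J"
      by (rule closed_sequentially[OF J_D(3), rotated]) (use f in \<open>simp add: sym_ideal_def\<close>)
    then show "b \<in> sym_ideal" using b by (simp add: sym_ideal_def)
  qed
  fix b assume b: "b \<in> sym_ideal"
  then have b_bo: "b \<in> bounded_ops" using J_bo by (auto simp: sym_ideal_def)
  show "adj b \<in> sym_ideal" using b b_bo by (simp add: sym_ideal_def adj_adj)
  show "scale_op c b \<in> sym_ideal" for c
    using b b_bo J_D(2) by (simp add: sym_ideal_def adj_scale op_subspace_def)
  fix d assume d: "d \<in> sym_ideal"
  then have d_bo: "d \<in> bounded_ops" using J_bo by (auto simp: sym_ideal_def)
  show "b + d \<in> sym_ideal"
    using b d b_bo d_bo J_D(2) by (simp add: sym_ideal_def adj_add op_subspace_def)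
  show "b o\<^sub>L d \<in> sym_ideal"
    using b d b_bo d_bo J_D(1,4) by (auto simp: sym_ideal_def adj_compose)
qed

text \<open>The adjoint of a product reverses the order, so left multiplication by \<open>N\<close>
  uses that \<open>J\<close> absorbs \<open>N\<close> on both sides.\<close>

lemma sym_ideal_left_mult:
  assumes "b \<in> sym_ideal" "S \<in> N"
  shows "S o\<^sub>L b \<in> sym_ideal"
proof -
  have "S \<in> bounded_ops" "b \<in> bounded_ops" "adj S \<in> N"
    using assms J_D(2) star_algebraD[OF N_star] by (auto simp: sym_ideal_def op_subspace_def)
  then show ?thesis
    using assms J_D(4,5) by (auto simp: sym_ideal_def adj_compose)
qed

lemma commutator_F_sym_ideal:
  assumes a: "a \<in> \<A>"
  shows "commutator F a \<in> sym_ideal"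
proof -
  have "adj (commutator F a) = commutator (adj a) F"
    by (simp add: adj_commutator bounded_transform_bounded_ops \<A>_bounded_ops[OF a] adj_bounded_transform)
  also have "\<dots> = scale_op (- 1) (commutator F (adj a))"
    by (simp add: commutator_def scale_op_minus_one)
  finally have "adj (commutator F a) \<in> J"
    using commutator_F_J[OF star_algebraD(6)[OF \<A>(1) a]] J_D(2) by (simp add: op_subspace_def)
  then show ?thesis using commutator_F_J[OF a] by (simp add: sym_ideal_def)
qed

lemma fun_calc_sym_ideal: "f \<in> C0 \<Longrightarrow> fun_calc D f \<in> sym_ideal"
  by (simp add: sym_ideal_def fun_calc_J C0_cnj flip: fun_calc_cnj)

subsection \<open>The approximate unit\<close>

sublocale approximate_unit "\<lambda>n. fun_calc D (cutoff n)"
proof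
  fix n
  show "fun_calc D (cutoff n) \<in> bounded_ops" by (rule fun_calc_bounded_ops[OF C0_cutoff])
  show "adj (fun_calc D (cutoff n)) = fun_calc D (cutoff n)"
    unfolding fun_calc_cnj[OF C0_cutoff, symmetric]
    by (intro arg_cong[of _ _ "fun_calc D"] ext) (simp add: cutoff_def)
  show "norm (fun_calc D (cutoff n)) \<le> 1"
    by (rule norm_fun_calc_le[OF C0_cutoff cmod_cutoff_le])
qed

lemma positive_cutoff: "positive_op (fun_calc D (cutoff n))"
proof -
  define m where "m = real (Suc n)"
  have nr: "\<i> * complex_of_real m \<notin> \<real>" by (rule i_real_nonreal) (simp add: m_def)
  \<comment> \<open>The cutoff is the squared modulus of a scaled resolvent function, which shows
    the operator as an adjoint times itself.\<close>
  define k where "k x = of_real m * inverse (\<i> * of_real m - complex_of_real x)" for x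
  have k: "k \<in> C0" unfolding k_def[abs_def] by (intro C0_scale C0_resolvent nr)
  have "cutoff n x = cnj (k x) * k x" for x
  proof -
    have "(cmod (\<i> * of_real m - complex_of_real x))\<^sup>2 = m\<^sup>2 + x\<^sup>2"
      by (simp add: cmod_power2)
    then have "(cmod (k x))\<^sup>2 = m\<^sup>2 / (m\<^sup>2 + x\<^sup>2)"
      by (simp add: k_def norm_mult norm_inverse power_mult_distrib power_inverse divide_inverse)
    then have "complex_of_real (m\<^sup>2 / (m\<^sup>2 + x\<^sup>2)) = k x * cnj (k x)"
      by (metis complex_norm_square)
    then show ?thesis unfolding cutoff_def m_def[symmetric] by (simp only: mult.commute)
  qed
  then have "fun_calc D (cutoff n) = adj (fun_calc D k) o\<^sub>L fun_calc D k"
    unfolding fun_calc_cnj[OF k, symmetric] fun_calc_mult[OF C0_cnj[OF k] k, symmetric]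
    by (intro arg_cong[of _ _ "fun_calc D"] ext)
  then show ?thesis using positive_op_adj_compose[OF fun_calc_bounded_ops[OF k]] by simp
qed

lemma fun_calc_absorbed:
  assumes f: "f \<in> C0"
  shows "fun_calc D f \<in> left_absorbed" "fun_calc D f \<in> right_absorbed"
proof -
  have eq: "fun_calc D (\<lambda>x. cutoff n x * f x) = fun_calc D (cutoff n) o\<^sub>L fun_calc D f"
    "fun_calc D (\<lambda>x. cutoff n x * f x) = fun_calc D f o\<^sub>L fun_calc D (cutoff n)" for n
    unfolding fun_calc_mult[OF C0_cutoff f, symmetric] fun_calc_mult[OF f C0_cutoff, symmetric]
    by (simp_all only: mult.commute)
  show "fun_calc D f \<in> left_absorbed"
    using fun_calc_bounded_ops[OF f] fun_calc_cutoff_tendsto[OF f]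
    unfolding eq(1) by (simp add: left_absorbed_def)
  show "fun_calc D f \<in> right_absorbed"
    using fun_calc_bounded_ops[OF f] fun_calc_cutoff_tendsto[OF f]
    unfolding eq(2) by (simp add: right_absorbed_def)
qed

lemma commutator_cutoff_tendsto:
  assumes "a \<in> \<A>"
  shows "(\<lambda>n. commutator (fun_calc D (cutoff n)) a) \<longlonglongrightarrow> 0"
proof -
  obtain T where T: "bounded_commutator D a T" using bounded_commutator_exists[OF assms] by blast
  have "(\<lambda>n. norm T * inverse (real (Suc n))) \<longlonglongrightarrow> 0"
    by (intro tendsto_mult_right_zero LIMSEQ_inverse_real_of_nat)
  then show ?thesis
    by (rule tendsto_norm_bound[rotated])
       (use bounded_commutator.norm_commutator_cutoff[OF T] in \<open>simp only: diff_zero divide_inverse\<close>)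
qed

lemma commutator_cutoff_F: "commutator (fun_calc D (cutoff n)) F = 0"
  unfolding commutator_def bounded_transform_fun_calc[OF C0_cutoff] fun_calc_bounded_transform[OF C0_cutoff]
  by simp

lemma left_absorbed_left_mult:
  "b \<in> left_absorbed \<Longrightarrow> a \<in> \<A> \<Longrightarrow> a o\<^sub>L b \<in> left_absorbed"
  "b \<in> left_absorbed \<Longrightarrow> F o\<^sub>L b \<in> left_absorbed"
  by (rule left_absorbed_almost_commuting;
      simp add: \<A>_bounded_ops commutator_cutoff_tendsto bounded_transform_bounded_ops commutator_cutoff_F)+

text \<open>The approximants \<open>arctan_approx\<close> are \<open>C0\<close> functions of
  \<open>D\<close>, hence absorbed. Asymptotic commutation lets \<open>a\<close> stand on either
  side of them, and closedness of the absorbed sets carries this to the norm limit.\<close>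

lemma commutator_F_absorbed:
  assumes a: "a \<in> \<A>"
  shows "commutator F a \<in> left_absorbed" "commutator F a \<in> right_absorbed"
proof -
  have a_bo: "a \<in> bounded_ops" by (rule \<A>_bounded_ops[OF a])
  have \<psi>: "arctan_approx n \<in> left_absorbed" "arctan_approx n \<in> right_absorbed" for n
    unfolding arctan_approx_def using fun_calc_absorbed[OF arctan_approx_C0] by auto
  have "commutator (arctan_approx n) a \<in> left_absorbed" for n
    unfolding commutator_def
    by (intro left_absorbed_diff left_absorbed_compose left_absorbed_left_mult \<psi> a a_bo)
  then show "commutator F a \<in> left_absorbed"
    by (rule closed_sequentially[OF closed_left_absorbed _ commutator_F_limit[OF a]])
  have "commutator (arctan_approx n) a \<in> right_absorbed" for n
    unfolding commutator_def
    by (intro right_absorbed_diff right_absorbed_compose right_absorbed_almost_commuting \<psi> a_bo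
        commutator_cutoff_tendsto a)
  then show "commutator F a \<in> right_absorbed"
    by (rule closed_sequentially[OF closed_right_absorbed _ commutator_F_limit[OF a]])
qed

subsection \<open>The generated algebra\<close>

definition gens :: "('h \<Rightarrow>\<^sub>L 'h) set" where
  "gens = {F o\<^sub>L commutator F a |a. a \<in> \<A>} \<union>
     {b o\<^sub>L commutator F a |a b. a \<in> \<A> \<and> b \<in> \<A>} \<union>
     {F o\<^sub>L b o\<^sub>L commutator F a |a b. a \<in> \<A> \<and> b \<in> \<A>} \<union>
     {a o\<^sub>L fun_calc D f |a f. a \<in> \<A> \<and> f \<in> C0}"

lemma triple_algebra_eq: "triple_algebra \<A> D = cstar_algebra hull gens"
  by (simp add: triple_algebra_def gens_def Let_def)

lemma triple_algebra_least:
  assumes V: "cstar_algebra V"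
    and "\<And>a. a \<in> \<A> \<Longrightarrow> F o\<^sub>L commutator F a \<in> V"
    and "\<And>a b. a \<in> \<A> \<Longrightarrow> b \<in> \<A> \<Longrightarrow> b o\<^sub>L commutator F a \<in> V"
    and "\<And>a b. a \<in> \<A> \<Longrightarrow> b \<in> \<A> \<Longrightarrow> F o\<^sub>L b o\<^sub>L commutator F a \<in> V"
    and "\<And>a f. a \<in> \<A> \<Longrightarrow> f \<in> C0 \<Longrightarrow> a o\<^sub>L fun_calc D f \<in> V"
  shows "triple_algebra \<A> D \<subseteq> V"
  unfolding triple_algebra_eq
  by (rule hull_minimal) (use assms in \<open>auto simp: gens_def\<close>)

lemma gens_bounded_ops: "gens \<subseteq> bounded_ops"
  unfolding gens_def
  by (auto intro!: bounded_ops_compose bounded_ops_commutator bounded_transform_bounded_ops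
      fun_calc_bounded_ops intro: \<A>_bounded_ops)

lemma cstar_algebra_triple_algebra: "cstar_algebra (triple_algebra \<A> D)"
  unfolding triple_algebra_eq by (rule cstar_algebra_hull[OF gens_bounded_ops])

lemma triple_algebra_bounded_ops: "triple_algebra \<A> D \<subseteq> bounded_ops"
  using cstar_algebra_triple_algebra star_algebraD(1) by (auto simp: cstar_algebra_def)

lemma closed_triple_algebra: "closed (triple_algebra \<A> D)"
  using cstar_algebra_triple_algebra by (simp add: cstar_algebra_def)

lemma gens_triple_algebra: "gens \<subseteq> triple_algebra \<A> D"
  unfolding triple_algebra_eq by (rule hull_subset)

lemma triple_algebra_ideal: "triple_algebra \<A> D \<subseteq> J"
proof -
  have "triple_algebra \<A> D \<subseteq> sym_ideal"
    using \<A>(2)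
    by (intro triple_algebra_least cstar_algebra_sym_ideal sym_ideal_left_mult commutator_F_sym_ideal
        fun_calc_sym_ideal F_N star_algebraD(5)[OF N_star]) auto
  then show ?thesis by (auto simp: sym_ideal_def)
qed

text \<open>Every generator ends on the right in \<open>[F, a]\<close> or in a function of
  \<open>D\<close>, both absorbed on the two sides. The factors in front are \<open>F\<close> and
  elements of \<open>\<A>\<close>, which the cutoffs commute with exactly or asymptotically.\<close>

lemma triple_algebra_absorbed: "triple_algebra \<A> D \<subseteq> left_absorbed \<inter> right_absorbed"
  by (rule triple_algebra_least[OF cstar_algebra_absorbed])
     (auto simp: blinfun_compose_assoc
       intro!: left_absorbed_left_mult right_absorbed_compose commutator_F_absorbed fun_calc_absorbed
         bounded_transform_bounded_ops intro: \<A>_bounded_ops)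

text \<open>The unit of \<open>\<A>\<close> as left factor makes a function of \<open>D\<close>
  itself a generator; it does the same for \<open>[F, a]\<close> below.\<close>

lemma fun_calc_triple_algebra:
  assumes "f \<in> C0"
  shows "fun_calc D f \<in> triple_algebra \<A> D"
proof -
  have "id_blinfun o\<^sub>L fun_calc D f \<in> gens" unfolding gens_def using \<A>(3) assms by blast
  then show ?thesis using gens_triple_algebra by auto
qed

lemma sigma_unital_triple_algebra: "sigma_unital (triple_algebra \<A> D)"
  unfolding sigma_unital_def
proof (intro exI[of _ "\<lambda>n. fun_calc D (cutoff n)"] conjI allI ballI)
  fix n
  show "fun_calc D (cutoff n) \<in> triple_algebra \<A> D" by (rule fun_calc_triple_algebra[OF C0_cutoff])
  show "positive_op (fun_calc D (cutoff n))" by (rule positive_cutoff)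
  show "norm (fun_calc D (cutoff n)) \<le> 1" by (rule norm_e)
next
  fix b assume "b \<in> triple_algebra \<A> D"
  then show "(\<lambda>n. fun_calc D (cutoff n) o\<^sub>L b) \<longlonglongrightarrow> b" "(\<lambda>n. b o\<^sub>L fun_calc D (cutoff n)) \<longlonglongrightarrow> b"
    using triple_algebra_absorbed by (auto simp: left_absorbed_def right_absorbed_def)
qed

lemma cstar_algebra_closure_\<A>: "cstar_algebra (closure \<A>)"
  by (rule cstar_algebra_closure_star_algebra[OF \<A>(1)])

lemma closure_\<A>_D:
  shows "closure \<A> \<subseteq> bounded_ops" "a \<in> closure \<A> \<Longrightarrow> adj a \<in> closure \<A>"
  using cstar_algebra_closure_\<A> star_algebraD[of "closure \<A>"] by (auto simp: cstar_algebra_def)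

lemma closure_\<A>_fun_calc:
  assumes a: "a \<in> closure \<A>" and f: "f \<in> C0"
  shows "a o\<^sub>L fun_calc D f \<in> triple_algebra \<A> D"
proof -
  obtain s where s: "\<And>n. s n \<in> \<A>" "s \<longlonglongrightarrow> a" using a by (auto simp: closure_sequential)
  show ?thesis
  proof (rule closed_sequentially[OF closed_triple_algebra])
    show "s n o\<^sub>L fun_calc D f \<in> triple_algebra \<A> D" for n
      using gens_triple_algebra s(1) f unfolding gens_def by blast
    show "(\<lambda>n. s n o\<^sub>L fun_calc D f) \<longlonglongrightarrow> (a o\<^sub>L fun_calc D f)"
      by (intro tendsto_blinfun_compose s tendsto_const)
  qed
qed

lemma closure_\<A>_commutator:
  assumes a: "a \<in> closure \<A>"
  shows "commutator F a \<in> triple_algebra \<A> D"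
proof -
  obtain s where s: "\<And>n. s n \<in> \<A>" "s \<longlonglongrightarrow> a" using a by (auto simp: closure_sequential)
  show ?thesis
  proof (rule closed_sequentially[OF closed_triple_algebra])
    fix n
    have "id_blinfun o\<^sub>L commutator F (s n) \<in> gens"
      unfolding gens_def using s(1) \<A>(3) by blast
    then show "commutator F (s n) \<in> triple_algebra \<A> D" using gens_triple_algebra by auto
    show "(\<lambda>n. commutator F (s n)) \<longlonglongrightarrow> commutator F a"
      unfolding commutator_def by (intro tendsto_diff tendsto_blinfun_compose s tendsto_const)
  qed
qed

lemma triple_algebra_multiplier:
  assumes "\<And>n. S o\<^sub>L fun_calc D (cutoff n) \<in> triple_algebra \<A> D" "b \<in> triple_algebra \<A> D"
  shows "S o\<^sub>L b \<in> triple_algebra \<A> D"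
  by (rule multiplier_of_absorbed_subalgebra[OF cstar_algebra_triple_algebra _ assms])
     (use triple_algebra_absorbed in blast)

lemma kasparov_triple_algebra: "kasparov_left_mult_module (closure \<A>) (triple_algebra \<A> D) F"
  unfolding kasparov_left_mult_module_def
proof (intro conjI ballI)
  show "cstar_algebra (closure \<A>)" by (rule cstar_algebra_closure_\<A>)
  show "cstar_algebra (triple_algebra \<A> D)" by (rule cstar_algebra_triple_algebra)
  show "sigma_unital (triple_algebra \<A> D)" by (rule sigma_unital_triple_algebra)
  show "F \<in> bounded_ops" by (rule bounded_transform_bounded_ops)
  \<comment> \<open>Multiplying by the bounded function \<open>transform_fun\<close> keeps the
    cutoff in \<open>C0\<close>, so the product is again a function of \<open>D\<close>. With
    \<open>F\<close> self-adjoint, left multiplication by \<open>F\<close> is then its own adjoint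
    on the module.\<close>
  have F_cutoff: "F o\<^sub>L fun_calc D (cutoff n) \<in> triple_algebra \<A> D" for n
    unfolding bounded_transform_fun_calc[OF C0_cutoff]
    by (rule fun_calc_triple_algebra[OF C0_transform_mult[OF C0_cutoff]])
  show "left_mult F \<in> adjointable_ops (triple_algebra \<A> D)"
    by (rule left_mult_adjointable[OF bounded_transform_bounded_ops triple_algebra_bounded_ops])
       (simp_all add: adj_bounded_transform triple_algebra_multiplier F_cutoff)
  fix a assume a: "a \<in> closure \<A>"
  have a_bo: "a \<in> bounded_ops" using a closure_\<A>_D(1) by blast
  have mult: "S o\<^sub>L b \<in> triple_algebra \<A> D" if "S \<in> closure \<A>" "b \<in> triple_algebra \<A> D" for S b
    by (rule triple_algebra_multiplier[OF closure_\<A>_fun_calc[OF that(1) C0_cutoff] that(2)])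
  show "left_mult a \<in> adjointable_ops (triple_algebra \<A> D)"
    by (rule left_mult_adjointable[OF a_bo triple_algebra_bounded_ops]) (simp_all add: mult a closure_\<A>_D(2))
  have alg: "star_algebra (triple_algebra \<A> D)"
    using cstar_algebra_triple_algebra by (simp add: cstar_algebra_def)
  \<comment> \<open>Here \<open>F^2 - 1\<close> is \<open>-(1 + D^2)^{-1}\<close>, so the defect is
    a \<open>C0\<close> function of \<open>D\<close> up to sign.\<close>
  have "a o\<^sub>L ((F o\<^sub>L F) - id_blinfun) = scale_op (- 1) (a o\<^sub>L fun_calc D inv_square_fun)"
    unfolding bounded_transform_square scale_op_minus_one by (simp add: blinfun_compose_simps)
  then show "a o\<^sub>L ((F o\<^sub>L F) - id_blinfun) \<in> triple_algebra \<A> D"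
    using star_algebraD(4)[OF alg closure_\<A>_fun_calc[OF a C0_inv_square_fun]] by metis
  show "a o\<^sub>L (F - adj F) \<in> triple_algebra \<A> D"
    using star_algebraD(2)[OF alg] by (simp add: adj_bounded_transform)
  show "commutator F a \<in> triple_algebra \<A> D" by (rule closure_\<A>_commutator[OF a])
qed

text \<open>It suffices to find a separable C*-algebra that contains all generators: it may be
  larger than the triple algebra, because separability passes to subsets of metric spaces.\<close>

lemma separable_triple_algebra:
  assumes "separable_space (top_of_set (closure \<A>))"
  shows "separable_space (top_of_set (triple_algebra \<A> D))"
proof -
  obtain C where C: "countable C" "C \<subseteq> closure \<A>" "closure \<A> \<subseteq> closure C"
    using assms by (rule separable_space_countable_dense)
  \<comment> \<open>One resolvent and its adjoint yield all functions of \<open>D\<close>, and a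
    countable dense subset yields \<open>\<A>\<close> in the closure, so this countable set reaches
    every generator.\<close>
  let ?X = "C \<union> {F, resolvent D \<i>}"
  have "countable ?X" using C(1) by simp
  moreover have "?X \<subseteq> bounded_ops"
    using C(2) closure_\<A>_D(1) bounded_transform_bounded_ops resolvent_bounded_ops[OF nonreal_i(1)] by auto
  ultimately obtain E where E: "countable E" "cstar_algebra (closure E)" "?X \<subseteq> closure E"
    using cstar_algebra_separable_if_countably_generated by blast
  have alg: "star_algebra (closure E)" using E(2) by (simp add: cstar_algebra_def)
  have AE: "a \<in> closure E" if "a \<in> \<A>" for a
  proof -
    have "closure C \<subseteq> closure E" using E(3) by (intro closure_minimal) auto
    moreover have "a \<in> closure C" using that C(3) closure_subset by blast
    ultimately show ?thesis by blast
  qed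
  have FE: "F \<in> closure E" using E(3) by blast
  have "resolvent D (- \<i>) = adj (resolvent D \<i>)" using adj_resolvent[OF nonreal_i(1)] by simp
  then have res: "resolvent D \<i> \<in> closure E" "resolvent D (- \<i>) \<in> closure E"
    using E(3) star_algebraD(6)[OF alg] by auto
  have fc: "fun_calc D f \<in> closure E" if "f \<in> C0" for f
    by (rule fun_calc_mem[OF _ _ _ res that]) (use alg in \<open>auto simp: star_algebra_def\<close>)
  have "triple_algebra \<A> D \<subseteq> closure E"
    by (intro triple_algebra_least E(2) star_algebraD(5)[OF alg] star_algebra_commutator[OF alg] AE FE fc)
  then show ?thesis by (rule separable_space_subset_closure[OF E(1)])
qed

end

theorem theorem5p3:
  fixes N J \<A> A B :: "('h::complex_hilbert_space \<Rightarrow>\<^sub>L 'h) set"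
    and D :: "'h unbounded_op"
    and F :: "'h \<Rightarrow>\<^sub>L 'h"
  assumes triple: "unital_vn_spectral_triple N J \<A> D"
    and A: "A = closure \<A>"
    and sep: "separable_space (top_of_set A)"
    and F: "F = bounded_transform D"
    and B: "B = triple_algebra \<A> D"
  shows "separable_space (top_of_set B) \<and> B \<subseteq> J \<and>
         kasparov_left_mult_module A B F \<and> sigma_unital B"
proof -
  interpret unital_spectral_triple N J \<A> D
    by standard (rule triple)
  show ?thesis
    using separable_triple_algebra triple_algebra_ideal kasparov_triple_algebra
      sigma_unital_triple_algebra sep
    by (simp add: A B F)
qed

end
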